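(* Let $\omega=(\sqrt5-1)/2$ and let $\Sigma_\omega\subset\mathbb R$ be the spectrum of the Almost Mathieu operator with coupling $b=2$ and frequency $\omega$. Then 8 bounded spectral gaps, namely those with labels $\pm1,\pm2,\pm3,\pm4$, are open (non-collapsed). More precisely, each of the following open intervals is contained in the open spectral gap (bounded connected component of $\mathbb R\setminus\Sigma_\omega$) having the indicated label: \begin{itemize} \item $(-2.50857481536,\,-2.37612614288)$: label $-3$; \item $(-2.30758848800,\,-2.00845718154)$: label $2$; \item $(-1.789961146545,\,-0.273318241882)$: label $-1$; \item $(-0.1298164588928,\,-0.0196121757507)$: label $4$; \item $(0.0196121757507,\,0.1298164588928)$: label $-4$; \item $(0.273318241882,\,1.789961146545)$: label $1$; \item $(2.00845718154,\,2.30758848800)$: label $-2$; \item $(2.37612614288,\,2.50857481536)$: label $3$. \end{itemize} Moreover $(-\infty,-2.59851518536)$ and $(2.59851518536,+\infty)$ are contained in the lower and upper unbounded connected components of $\mathbb R\setminus\Sigma_\omega$, respectively (label $0$).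
   Context: The Almost Mathieu operator with coupling $b=2$, frequency $\omega$ and phase $\theta\in\mathbb T=\mathbb R/\mathbb Z$ acts on $\ell^2(\mathbb Z)$ by $$(H_{2,\omega,\theta}x)_n=x_{n+1}+x_{n-1}+2\cos(2\pi(\omega n+\theta))\,x_n,\qquad n\in\mathbb Z.$$ For irrational $\omega$ its spectrum is a compact subset of $\mathbb R$ independent of $\theta$, denoted $\Sigma_\omega$. A (open, non-collapsed) spectral gap is a connected component of $\mathbb R\setminus\Sigma_\omega$. The integrated density of states $N:\mathbb R\to[0,1]$ (the limit as $L\to\infty$ of $\frac1L$ times the number of eigenvalues $\le a$ of the restriction of the operator to $\{1,\dots,L\}$) is continuous, nondecreasing, and constant exactly on the components of $\mathbb R\setminus\Sigma_\omega$. By the Gap Labelling Theorem, on each bounded gap the value of $N$ is $\{k\omega\}$ for a unique integer $k$, called the label of the gap, where $\{\cdot\}$ denotes the fractional part. The two unbounded components (where $N=0$ and $N=1$) are given the label $0$. *)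

theory Defs
  imports "HOL-Analysis.Analysis" "Jordan_Normal_Form.Char_Poly"
begin

text \<open>
  The space of square-summable complex sequences over the integers is a set of functions;
  operators on it are functions on \<^typ>\<open>int \<Rightarrow> complex\<close> of which only the
  values on this set matter.
\<close>

definition l2_int :: "(int \<Rightarrow> complex) set" where
  "l2_int = {x. (\<lambda>n. (cmod (x n))\<^sup>2) summable_on UNIV}"

definition l2_int_norm :: "(int \<Rightarrow> complex) \<Rightarrow> real" where
  "l2_int_norm x = sqrt (\<Sum>\<^sub>\<infinity>n. (cmod (x n))\<^sup>2)"

definition bounded_operator_l2 :: "((int \<Rightarrow> complex) \<Rightarrow> (int \<Rightarrow> complex)) \<Rightarrow> bool" where
  "bounded_operator_l2 T \<longleftrightarrow>
     (\<forall>x\<in>l2_int. T x \<in> l2_int) \<and>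
     (\<forall>x\<in>l2_int. \<forall>y\<in>l2_int. T (\<lambda>n. x n + y n) = (\<lambda>n. T x n + T y n)) \<and>
     (\<forall>c. \<forall>x\<in>l2_int. T (\<lambda>n. c * x n) = (\<lambda>n. c * T x n)) \<and>
     (\<exists>C. \<forall>x\<in>l2_int. l2_int_norm (T x) \<le> C * l2_int_norm x)"

text \<open>In the following, \<open>R\<close> is the two-sided bounded inverse of \<open>T - z\<close>.\<close>

definition spectrum_l2 :: "((int \<Rightarrow> complex) \<Rightarrow> (int \<Rightarrow> complex)) \<Rightarrow> complex set" where
  "spectrum_l2 T =
     {z. \<not> (\<exists>R. bounded_operator_l2 R \<and>
            (\<forall>x\<in>l2_int. R (\<lambda>n. T x n - z * x n) = x \<and>
                        (\<lambda>n. T (R x) n - z * R x n) = x))}"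

definition amo_potential :: "real \<Rightarrow> real \<Rightarrow> real \<Rightarrow> int \<Rightarrow> real" where
  "amo_potential b \<omega> \<theta> n = b * cos (2 * pi * (\<omega> * of_int n + \<theta>))"

definition almost_mathieu ::
  "real \<Rightarrow> real \<Rightarrow> real \<Rightarrow> (int \<Rightarrow> complex) \<Rightarrow> (int \<Rightarrow> complex)" where
  "almost_mathieu b \<omega> \<theta> x =
     (\<lambda>n. x (n + 1) + x (n - 1) + complex_of_real (amo_potential b \<omega> \<theta> n) * x n)"

definition amo_spectrum :: "real \<Rightarrow> real \<Rightarrow> real \<Rightarrow> real set" where
  "amo_spectrum b \<omega> \<theta> =
     {E. complex_of_real E \<in> spectrum_l2 (almost_mathieu b \<omega> \<theta>)}"

text \<open>
  Connected components of the complement of the spectrum, including the two unbounded ones.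
\<close>

definition amo_gaps :: "real \<Rightarrow> real \<Rightarrow> real \<Rightarrow> real set set" where
  "amo_gaps b \<omega> \<theta> = components (UNIV - amo_spectrum b \<omega> \<theta>)"

text \<open>
  Restriction of the operator to the sites \<open>1, \<dots>, L\<close> (with Dirichlet boundary
  conditions); the matrix index \<open>i\<close> starts at 0 and stands for the site \<open>i + 1\<close>.
\<close>

definition amo_restriction :: "real \<Rightarrow> real \<Rightarrow> real \<Rightarrow> nat \<Rightarrow> real mat" where
  "amo_restriction b \<omega> \<theta> L =
     mat L L (\<lambda>(i, j).
       if i = j then amo_potential b \<omega> \<theta> (int i + 1)
       else if i = j + 1 \<or> j = i + 1 then 1 else 0)"

text \<open>Number of real eigenvalues up to \<open>a\<close>, counted with algebraic multiplicity.\<close>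

definition eigenvalue_count :: "real mat \<Rightarrow> real \<Rightarrow> nat" where
  "eigenvalue_count A a =
     (\<Sum>E | eigenvalue A E \<and> E \<le> a. Polynomial.order E (char_poly A))"

text \<open>Integrated density of states.\<close>

definition amo_ids :: "real \<Rightarrow> real \<Rightarrow> real \<Rightarrow> real \<Rightarrow> real" where
  "amo_ids b \<omega> \<theta> a =
     lim (\<lambda>L. real (eigenvalue_count (amo_restriction b \<omega> \<theta> L) a) / real L)"

text \<open>
  \<open>k\<close> is the label of the gap \<open>G\<close>. For irrational \<open>\<omega>\<close> there is at most
  one such \<open>k\<close>, since the fractional parts of its integer multiples are distinct.
\<close>

definition has_gap_label :: "real \<Rightarrow> real \<Rightarrow> real \<Rightarrow> real set \<Rightarrow> int \<Rightarrow> bool" where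
  "has_gap_label b \<omega> \<theta> G k \<longleftrightarrow>
     (bounded G \<and> (\<forall>a\<in>G. amo_ids b \<omega> \<theta> a = frac (of_int k * \<omega>))) \<or>
     (\<not> bdd_below G \<and> (\<forall>a\<in>G. amo_ids b \<omega> \<theta> a = 0) \<and> k = 0) \<or>
     (\<not> bdd_above G \<and> (\<forall>a\<in>G. amo_ids b \<omega> \<theta> a = 1) \<and> k = 0)"

end

theory Submission
  imports Defs "HOL-Analysis.Kronecker_Approximation_Theorem"
begin

text \<open>
  Why the theorem holds.  Restrict the operator to \<open>L\<close> sites and solve the eigenvalue equation
  for the energy \<open>E\<close> from the left end.  The values of the solution are polynomials \<open>p\<^sub>n(E)\<close>
  (\<open>jac\<close>), and their ratios \<open>r\<^sub>n = p\<^sub>n\<^sub>+\<^sub>1(E) / p\<^sub>n(E)\<close> obey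
  \<open>r\<^sub>n\<^sub>+\<^sub>1 = E - v\<^sub>n\<^sub>+\<^sub>1 - 1 / r\<^sub>n\<close>.  By Sturm's theorem (\<open>sturm_count\<close>) the number of positive
  ratios among the first \<open>L\<close> is the number of eigenvalues below \<open>E\<close>.  The map
  \<open>r \<mapsto> E - v - 1 / r\<close> preserves the cyclic order of the projective line and increases with
  \<open>E\<close>.  Hence the pair (number of positive ratios so far, current ratio), ordered
  lexicographically, is bounded below by every sequence that satisfies the recursion as an
  inequality (\<open>lex_le_step\<close>).

  The phases of the potential form an orbit of the rotation by the golden mean \<open>\<omega>\<close>.  Its first
  return map to a short interval has two branches, with consecutive Fibonacci numbers \<open>q\<close> as
  return times and their predecessors \<open>p\<close> as numbers of turns.  Suppose that on both branches a
  ratio at least \<open>c\<close> is again at least \<open>c\<close> at the return, and that \<open>k p + j q\<close> of the ratios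
  in between are positive.  Every orbit is a concatenation of the two branches, so at least
  \<open>(k \<omega> + j) L - O(1)\<close> eigenvalues lie below \<open>E\<close>, uniformly in the phase and in \<open>L\<close>
  (\<open>tower_lower_bound\<close>).  For one energy this hypothesis is a finite computation in integer
  arithmetic (\<open>run_word\<close>).  It is carried out for the lower edges of the eight gaps and for
  the top of the spectrum.  The reflection \<open>E \<mapsto> - E\<close>, \<open>\<theta> \<mapsto> \<theta> + 1/2\<close> turns lower edges into
  upper edges, so on each of the intervals the number of eigenvalues below \<open>E\<close> is
  \<open>(k \<omega> + j) L + O(1)\<close> (\<open>counts_like\<close>), that is, \<open>k\<close> is the label.

  It remains to pass from counts to the spectrum.  If \<open>E\<close> lies in such an interval and \<open>H - E\<close>
  were not bounded below, a finitely supported approximate eigenvector could be translated by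
  almost periods of the potential.  Many disjoint translates would give more eigenvalues near
  \<open>E\<close> than the counts allow (\<open>gap_lower_bound\<close>), and a self-adjoint operator that is bounded
  below is invertible (\<open>T_surj\<close>).  Conversely, near a point off the spectrum a restriction has
  at most two eigenvalues, because three eigenvectors would combine to a vector that vanishes at
  both ends (\<open>few_roots_off_spectrum\<close>).  So the integrated density of states is constant on
  each component of the complement of the spectrum (\<open>has_ids_connected\<close>), and its values
  separate the gaps from each other and from the unbounded components.
\<close>

section \<open>Jacobi polynomials and Sturm's theorem\<close>

text \<open>
  \<open>poly (jac V n) E\<close> is the solution of the eigenvalue equation of the Jacobi matrix with
  diagonal \<open>V\<close> that starts with 1; at the same time \<open>jac V n\<close> is the characteristic polynomial
  of the leading \<open>n \<times> n\<close> block.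
\<close>

fun jac :: "(nat \<Rightarrow> real) \<Rightarrow> nat \<Rightarrow> real poly" where
  "jac V 0 = 1"
| "jac V (Suc 0) = [:- V 0, 1:]"
| "jac V (Suc (Suc n)) = [:- V (Suc n), 1:] * jac V (Suc n) - jac V n"

lemma degree_lead_coeff_diff:
  fixes p q :: "real poly"
  assumes "degree q < degree p"
  shows "degree (p - q) = degree p \<and> lead_coeff (p - q) = lead_coeff p"
proof -
  have "degree (p + - q) = degree p" using assms by (intro degree_add_eq_left) simp
  then have d: "degree (p - q) = degree p" by simp
  then show ?thesis using assms by (simp add: coeff_eq_0)
qed

lemma jac_degree_monic: "degree (jac V n) = n \<and> lead_coeff (jac V n) = 1"
proof (induction V n rule: jac.induct)
  case (3 V n)
  let ?p = "[:- V (Suc n), 1:] * jac V (Suc n)"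
  have nz: "jac V (Suc n) \<noteq> 0" using 3 by auto
  have d: "degree ?p = Suc (Suc n)"
    using nz 3 by (subst degree_mult_eq) auto
  moreover have "lead_coeff ?p = 1"
    using 3 by (simp only: lead_coeff_mult) auto
  moreover have "degree (?p - jac V n) = degree ?p \<and> lead_coeff (?p - jac V n) = lead_coeff ?p"
    by (rule degree_lead_coeff_diff) (use 3 d in presburger)
  ultimately show ?case unfolding jac.simps(3) by metis
qed auto

lemma monic_eq_prod_roots:
  fixes p :: "real poly" and c :: "nat \<Rightarrow> real"
  assumes "degree p = n" "lead_coeff p = 1" "inj_on c {..<n}" "\<And>i. i < n \<Longrightarrow> poly p (c i) = 0"
  shows "p = (\<Prod>i<n. [:- c i, 1:])"
proof -
  let ?q = "\<Prod>i<n. [:- c i, 1:]"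
  have dq: "degree ?q = n" by (subst degree_prod_eq_sum_degree) auto
  have lq: "lead_coeff ?q = 1" by (simp add: lead_coeff_prod)
  show ?thesis
  proof (rule ccontr)
    assume ne: "p \<noteq> ?q"
    define d where "d = p - ?q"
    have dn: "d \<noteq> 0" using ne d_def by simp
    have "degree d \<le> n" unfolding d_def using assms(1) dq by (metis degree_diff_le order_refl)
    moreover have "coeff d n = 0" unfolding d_def using assms(1,2) lq dq by simp
    ultimately have dd: "degree d < n"
      using dn by (metis eq_zero_or_degree_less)
    have "c ` {..<n} \<subseteq> {x. poly d x = 0}"
      using assms(4) by (auto simp: d_def poly_prod)
    then have "card (c ` {..<n}) \<le> card {x. poly d x = 0}"
      using poly_roots_finite[OF dn] by (rule card_mono[rotated])
    also have "\<dots> \<le> degree d" using dn poly_roots_degree by blast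
    finally show False using dd assms(3) by (simp add: card_image)
  qed
qed

lemma strict_chain:
  fixes f :: "nat \<Rightarrow> real"
  assumes "\<And>i. Suc i < n \<Longrightarrow> f i < f (Suc i)" "i < j" "j < n"
  shows "f i < f j"
  using assms(2,3)
proof (induction j)
  case (Suc j)
  show ?case
  proof (cases "i = j")
    case False
    then have "f i < f j" using Suc by simp
    then show ?thesis using assms(1)[of j] Suc.prems by simp
  qed (use assms(1)[of j] Suc.prems in simp)
qed simp

lemma chain_inj:
  fixes f :: "nat \<Rightarrow> real"
  assumes "\<And>i. Suc i < n \<Longrightarrow> f i < f (Suc i)"
  shows "inj_on f {..<n}"
proof (rule inj_onI)
  fix i j assume ij: "i \<in> {..<n}" "j \<in> {..<n}" "f i = f j"
  show "i = j"
  proof (rule linorder_cases[of i j])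
    assume "i < j"
    then show ?thesis using strict_chain[of n f i j] assms ij by auto
  next
    assume "j < i"
    then show ?thesis using strict_chain[of n f j i] assms ij by auto
  qed
qed

definition interlaced :: "(nat \<Rightarrow> real) \<Rightarrow> nat \<Rightarrow> (nat \<Rightarrow> real) \<Rightarrow> (nat \<Rightarrow> real) \<Rightarrow> bool" where
  "interlaced V n a b \<longleftrightarrow> jac V n = (\<Prod>i<n. [:- a i, 1:]) \<and> jac V (Suc n) = (\<Prod>i<Suc n. [:- b i, 1:])
     \<and> (\<forall>i<n. b i < a i \<and> a i < b (Suc i))"

declare jac.simps(3) [simp del]

lemma minus_one_power_cases: "(-1::real)^k = 1 \<or> (-1::real)^k = -1"
  by (induction k) auto

lemma sign_prod_roots:
  fixes a :: "nat \<Rightarrow> real"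
  assumes "k \<le> n" "\<And>i. i < k \<Longrightarrow> a i < x" "\<And>i. k \<le> i \<Longrightarrow> i < n \<Longrightarrow> x < a i"
  shows "0 < (-1)^(n - k) * (\<Prod>i<n. x - a i)"
proof -
  have "(\<Prod>i<n. x - a i) = (\<Prod>i<k. x - a i) * (\<Prod>i=k..<n. x - a i)"
    using assms(1) by (metis atLeast0LessThan le0 prod.atLeastLessThan_concat)
  also have "(\<Prod>i=k..<n. x - a i) = (\<Prod>i=k..<n. (-1) * (a i - x))" by simp
  also have "\<dots> = (-1)^(n-k) * (\<Prod>i=k..<n. a i - x)" by (simp only: prod.distrib) simp
  finally have "(-1)^(n - k) * (\<Prod>i<n. x - a i) = (\<Prod>i<k. x - a i) * (\<Prod>i=k..<n. a i - x)"
    by (simp flip: power_mult_distrib mult.assoc)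
  also have "\<dots> > 0" using assms by (intro mult_pos_pos prod_pos) auto
  finally show ?thesis .
qed

lemma monic_eventually_ge_1:
  fixes p :: "real poly"
  assumes "lead_coeff p = 1"
  obtains M where "\<forall>x\<ge>M. 1 \<le> poly p x"
  using poly_pinfty_gt_lc[of p] assms by auto

text \<open>
  At a root of \<open>jac V (Suc n)\<close> the recursion reduces to
  \<open>jac V (Suc (Suc n)) = - jac V n\<close>, whose sign alternates from root to root by interlacing; so
  there is a root in each gap, and two more outside because of the behaviour at infinity.
\<close>

lemma interlaced_step:
  assumes "interlaced V n a b"
  shows "\<exists>c. interlaced V (Suc n) b c"
proof -
  note A = assms[unfolded interlaced_def]
  let ?p = "jac V (Suc (Suc n))"
  have b_step: "b i < b (Suc i)" if "Suc i < Suc n" for i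
    using A that by (meson Suc_less_eq less_trans)
  have mono_b: "b i < b j" if "i < j" "j < Suc n" for i j
    using strict_chain[of "Suc n" b] b_step that by blast
  have root: "poly ?p (b i) = - poly (jac V n) (b i)" if "i \<le> n" for i
  proof -
    have "poly (jac V (Suc n)) (b i) = 0" using A that by (auto simp: poly_prod simp del: prod.lessThan_Suc)
    then show ?thesis by (simp add: jac.simps(3))
  qed
  have ba: "a l < b i" if "l < i" "i \<le> n" for l i
  proof -
    have "a l < b (Suc l)" using A that by auto
    also have "b (Suc l) \<le> b i" using mono_b[of "Suc l" i] that by (cases "Suc l = i") auto
    finally show ?thesis .
  qed
  have ab: "b i < a l" if "i \<le> l" "l < n" for l i
  proof -
    have "b i \<le> b l" using mono_b[of i l] that by (cases "l = i") auto
    also have "b l < a l" using A that by auto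
    finally show ?thesis .
  qed
  have sb: "0 < (-1)^(Suc n - i) * poly ?p (b i)" if "i \<le> n" for i
  proof -
    have "0 < (-1)^(n - i) * (\<Prod>l<n. b i - a l)"
      using that ba ab by (intro sign_prod_roots) auto
    then have "0 < (-1)^(n - i) * poly (jac V n) (b i)" using A by (simp add: poly_prod)
    then show ?thesis unfolding root[OF that] using that by (simp add: Suc_diff_le)
  qed
  have dm: "degree ?p = Suc (Suc n)" "lead_coeff ?p = 1" using jac_degree_monic by blast+
  obtain M1 where M1: "\<forall>x\<ge>M1. 1 \<le> poly ?p x"
    using monic_eventually_ge_1[OF dm(2)] by blast
  let ?r = "Polynomial.smult ((-1)^Suc (Suc n)) (pcompose ?p [:0,-1:])"
  have lr: "lead_coeff ?r = 1"
  proof -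
    have "lead_coeff (pcompose ?p [:0,-1:]) = (-1)^Suc (Suc n)"
      by (subst lead_coeff_comp) (use dm in auto)
    then show ?thesis by (simp only: lead_coeff_smult) (simp flip: power_mult_distrib)
  qed
  obtain M2 where M2: "\<forall>x\<ge>M2. 1 \<le> poly ?r x"
    using monic_eventually_ge_1[OF lr] by blast
  define M where "M = \<bar>M1\<bar> + \<bar>M2\<bar> + \<bar>b n\<bar> + \<bar>b 0\<bar> + 1"
  have M: "M \<ge> M1" "M \<ge> M2" "M > b n" "- M < b 0" unfolding M_def by linarith+
  define \<beta> where "\<beta> i = (if i = 0 then - M else if i = Suc (Suc n) then M else b (i - 1))" for i
  have s\<beta>: "0 < (-1)^(Suc (Suc n) - i) * poly ?p (\<beta> i)" if le: "i \<le> Suc (Suc n)" for i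
  proof -
    consider "i = 0" | "i = Suc (Suc n)" | k where "i = Suc k" "k \<le> n"
      using le by (cases i) (auto elim!: le_SucE)
    then show ?thesis
    proof cases
      case 1
      then show ?thesis using M2[rule_format, OF M(2)] unfolding \<beta>_def
        by (simp only: poly_smult poly_pcompose) simp
    next
      case 2
      then show ?thesis using M1[rule_format, OF M(1)] by (simp add: \<beta>_def)
    next
      case 3
      then show ?thesis using sb[of k] by (simp add: \<beta>_def)
    qed
  qed
  have mono_\<beta>: "\<beta> i < \<beta> (Suc i)" if "i < Suc (Suc n)" for i
    using that mono_b[of "i-1" i] M unfolding \<beta>_def by (auto simp: less_Suc_eq)
  have "\<exists>x. \<beta> i < x \<and> x < \<beta> (Suc i) \<and> poly ?p x = 0" if i: "i < Suc (Suc n)" for i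
  proof -
    have 1: "0 < (-1)^(Suc (Suc n) - i) * poly ?p (\<beta> i)" "0 < (-1)^(Suc (Suc n) - Suc i) * poly ?p (\<beta> (Suc i))"
      using s\<beta>[of i] s\<beta>[of "Suc i"] i by auto
    have e: "Suc (Suc n) - i = Suc (Suc (Suc n) - Suc i)" using i by simp
    define s :: real where "s = (-1)^(Suc (Suc n) - Suc i)"
    have "s = 1 \<or> s = -1" unfolding s_def by (rule minus_one_power_cases)
    moreover have "0 < - s * poly ?p (\<beta> i)" "0 < s * poly ?p (\<beta> (Suc i))"
      using 1 unfolding e s_def by simp_all
    ultimately have "poly ?p (\<beta> i) * poly ?p (\<beta> (Suc i)) < 0"
      by (auto simp: mult_less_0_iff)
    with mono_\<beta>[OF i] show ?thesis using poly_IVT by blast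
  qed
  then obtain c where c: "\<And>i. i < Suc (Suc n) \<Longrightarrow> \<beta> i < c i \<and> c i < \<beta> (Suc i) \<and> poly ?p (c i) = 0"
    by metis
  have "inj_on c {..<Suc (Suc n)}"
  proof (rule chain_inj)
    fix i assume "Suc i < Suc (Suc n)"
    then show "c i < c (Suc i)" using c[of i] c[of "Suc i"] by linarith
  qed
  then have "?p = (\<Prod>i<Suc (Suc n). [:- c i, 1:])"
    using c dm by (intro monic_eq_prod_roots) auto
  moreover have "c i < b i \<and> b i < c (Suc i)" if "i < Suc n" for i
    using c[of i] c[of "Suc i"] that by (auto simp: \<beta>_def)
  ultimately show ?thesis using A unfolding interlaced_def by blast
qed

lemma interlaced_exists: "\<exists>a b. interlaced V n a b"
proof (induction n)
  case 0
  show ?case by (rule exI[of _ "\<lambda>_. 0"], rule exI[of _ "\<lambda>_. V 0"]) (simp add: interlaced_def)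
next
  case (Suc n)
  then show ?case using interlaced_step by blast
qed

lemma interlaced_mono:
  assumes "interlaced V n a b"
  shows "inj_on a {..<n}" "inj_on b {..<Suc n}"
proof -
  have A: "\<And>i. i < n \<Longrightarrow> b i < a i" "\<And>i. i < n \<Longrightarrow> a i < b (Suc i)"
    using assms interlaced_def by auto
  show "inj_on a {..<n}"
  proof (rule chain_inj)
    fix i assume "Suc i < n"
    then show "a i < a (Suc i)" using A(2)[of i] A(1)[of "Suc i"] by linarith
  qed
  show "inj_on b {..<Suc n}"
  proof (rule chain_inj)
    fix i assume "Suc i < Suc n"
    then show "b i < b (Suc i)" using A(1)[of i] A(2)[of i] by linarith
  qed
qed

definition jroots :: "(nat \<Rightarrow> real) \<Rightarrow> nat \<Rightarrow> real set" where
  "jroots V n = {x. poly (jac V n) x = 0}"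

lemma jac_nz: "jac V n \<noteq> 0"
  using jac_degree_monic[of V n] by auto

lemma finite_jroots [simp]: "finite (jroots V n)"
  unfolding jroots_def using poly_roots_finite[OF jac_nz] .

lemma jroots_interlaced:
  assumes "interlaced V n a b"
  shows "jroots V n = a ` {..<n}" "jroots V (Suc n) = b ` {..<Suc n}"
  using assms unfolding jroots_def interlaced_def by (auto simp: poly_prod simp del: prod.lessThan_Suc)

lemma card_jroots: "card (jroots V n) = n"
  using interlaced_exists[of V n] interlaced_mono jroots_interlaced(1) by (metis card_image card_lessThan)

lemma card_image_less:
  fixes a :: "nat \<Rightarrow> real"
  assumes "inj_on a {..<n}"
  shows "card {y \<in> a ` {..<n}. y < x} = card {i. i < n \<and> a i < x}"
proof -
  have "{y \<in> a ` {..<n}. y < x} = a ` {i. i < n \<and> a i < x}" by auto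
  moreover have "inj_on a {i. i < n \<and> a i < x}" by (rule inj_on_subset[OF assms]) auto
  ultimately show ?thesis by (simp add: card_image)
qed

lemma jroots_count_step:
  "card {y \<in> jroots V n. y < x} \<le> card {y \<in> jroots V (Suc n). y < x}"
  "card {y \<in> jroots V (Suc n). y < x} \<le> Suc (card {y \<in> jroots V n. y < x})"
proof -
  obtain a b where I: "interlaced V n a b" using interlaced_exists by blast
  have A: "\<And>i. i < n \<Longrightarrow> b i < a i \<and> a i < b (Suc i)" using I interlaced_def by auto
  note e = jroots_interlaced[OF I] card_image_less[OF interlaced_mono(1)[OF I], of x]
    card_image_less[OF interlaced_mono(2)[OF I], of x]
  have "card {i. i < n \<and> a i < x} \<le> card {i. i < Suc n \<and> b i < x}"
  proof (rule card_mono)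
    show "{i. i < n \<and> a i < x} \<subseteq> {i. i < Suc n \<and> b i < x}"
      using A by (auto intro: less_trans)
  qed simp
  then show "card {y \<in> jroots V n. y < x} \<le> card {y \<in> jroots V (Suc n). y < x}" by (simp only: e)
  have "{i. i < Suc n \<and> b i < x} \<subseteq> insert 0 (Suc ` {i. i < n \<and> a i < x})"
  proof
    fix i assume "i \<in> {i. i < Suc n \<and> b i < x}"
    then show "i \<in> insert 0 (Suc ` {i. i < n \<and> a i < x})"
      using A[of "i - 1"] by (cases i) auto
  qed
  then have "card {i. i < Suc n \<and> b i < x} \<le> card (insert 0 (Suc ` {i. i < n \<and> a i < x}))"
    by (rule card_mono[rotated]) auto
  also have "\<dots> \<le> Suc (card (Suc ` {i. i < n \<and> a i < x}))"
    by (simp add: card_insert_if)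
  also have "\<dots> = Suc (card {i. i < n \<and> a i < x})" by (simp add: card_image)
  finally show "card {y \<in> jroots V (Suc n). y < x} \<le> Suc (card {y \<in> jroots V n. y < x})" by (simp only: e)
qed

lemma prod_sign_general:
  fixes x :: real
  assumes "finite A" "x \<notin> A"
  shows "0 < (-1)^(card {y\<in>A. x < y}) * (\<Prod>y\<in>A. x - y)"
  using assms
proof (induction A rule: finite_induct)
  case (insert z A)
  have IH: "0 < (-1)^(card {y\<in>A. x < y}) * (\<Prod>y\<in>A. x - y)" using insert by simp
  have p: "(\<Prod>y\<in>insert z A. x - y) = (x - z) * (\<Prod>y\<in>A. x - y)" using insert by simp
  show ?case
  proof (cases "x < z")
    case True
    then have "{y \<in> insert z A. x < y} = insert z {y\<in>A. x < y}" by blast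
    then have "card {y \<in> insert z A. x < y} = Suc (card {y\<in>A. x < y})" using insert by simp
    then have "(-1)^(card {y\<in>insert z A. x < y}) * (\<Prod>y\<in>insert z A. x - y) =
      (z - x) * ((-1)^(card {y\<in>A. x < y}) * (\<Prod>y\<in>A. x - y))"
      unfolding p by (simp add: algebra_simps)
    then show ?thesis using mult_pos_pos[OF _ IH, of "z - x"] True by simp
  next
    case False
    then have "{y \<in> insert z A. x < y} = {y\<in>A. x < y}" by blast
    then have "(-1)^(card {y\<in>insert z A. x < y}) * (\<Prod>y\<in>insert z A. x - y) =
      (x - z) * ((-1)^(card {y\<in>A. x < y}) * (\<Prod>y\<in>A. x - y))"
      unfolding p by (simp add: algebra_simps)
    moreover have "x - z > 0" using False insert.prems by auto
    ultimately show ?thesis using mult_pos_pos[OF _ IH, of "x - z"] by simp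
  qed
qed simp

lemma poly_jac_prod: "poly (jac V n) x = (\<Prod>y\<in>jroots V n. x - y)"
proof -
  obtain a b where I: "interlaced V n a b" using interlaced_exists by blast
  show ?thesis using I jroots_interlaced(1)[OF I] interlaced_mono(1)[OF I]
    by (simp add: interlaced_def poly_prod prod.reindex)
qed

lemma jac_sign:
  assumes "poly (jac V n) x \<noteq> 0"
  shows "0 < (-1)^(n - card {y \<in> jroots V n. y < x}) * poly (jac V n) x"
proof -
  have nx: "x \<notin> jroots V n" using assms by (simp add: jroots_def)
  have "x < y \<longleftrightarrow> \<not> y < x" if "y \<in> jroots V n" for y
    using nx that by (metis less_asym linorder_less_linear)
  then have "{y \<in> jroots V n. x < y} = jroots V n - {y \<in> jroots V n. y < x}" by blast
  then have "card {y \<in> jroots V n. x < y} = n - card {y \<in> jroots V n. y < x}"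
    by (simp add: card_Diff_subset card_jroots)
  then show ?thesis using prod_sign_general[OF finite_jroots nx] poly_jac_prod by simp
qed

definition pos_count :: "(nat \<Rightarrow> real) \<Rightarrow> real \<Rightarrow> nat \<Rightarrow> nat" where
  "pos_count V x n = card {i. i < n \<and> poly (jac V (Suc i)) x / poly (jac V i) x > 0}"

lemma pos_count_Suc:
  "pos_count V x (Suc n) = pos_count V x n + (if poly (jac V (Suc n)) x / poly (jac V n) x > 0 then 1 else 0)"
proof -
  have "{i. i < Suc n \<and> poly (jac V (Suc i)) x / poly (jac V i) x > 0} =
    (if poly (jac V (Suc n)) x / poly (jac V n) x > 0 then insert n else id)
      {i. i < n \<and> poly (jac V (Suc i)) x / poly (jac V i) x > 0}"
    by (auto simp: less_Suc_eq)
  then show ?thesis unfolding pos_count_def by simp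
qed

text \<open>
  The number of roots below \<open>x\<close> grows by 0 or 1 from \<open>n\<close> to \<open>Suc n\<close>, and its parity is the sign
  of the polynomial at \<open>x\<close>.
\<close>

lemma sturm_count:
  assumes "\<And>i. i \<le> n \<Longrightarrow> poly (jac V i) x \<noteq> 0"
  shows "card {y \<in> jroots V n. y < x} = pos_count V x n"
  using assms
proof (induction n)
  case 0
  have "jroots V 0 = {}" by (simp add: jroots_def)
  then show ?case unfolding pos_count_def by simp
next
  case (Suc n)
  define N where "N k = card {y \<in> jroots V k. y < x}" for k
  have IH: "N n = pos_count V x n" unfolding N_def using Suc by auto
  have s: "0 < (-1)^(n - N n) * poly (jac V n) x" "0 < (-1)^(Suc n - N (Suc n)) * poly (jac V (Suc n)) x"
    unfolding N_def using Suc.prems by (auto intro!: jac_sign)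
  have le: "N n \<le> n" unfolding N_def using card_mono[of "jroots V n" "{y \<in> jroots V n. y < x}"] card_jroots by auto
  have c: "N (Suc n) = N n \<or> N (Suc n) = Suc (N n)"
    using jroots_count_step[of V n x] unfolding N_def by linarith
  note m1 = minus_one_power_cases
  show ?case
  proof (cases "N (Suc n) = N n")
    case True
    then have "Suc n - N (Suc n) = Suc (n - N n)" using le by simp
    then have "poly (jac V (Suc n)) x / poly (jac V n) x < 0"
      using s m1[of "n - N n"] by (auto simp: divide_less_0_iff)
    then show ?thesis using IH True unfolding pos_count_Suc N_def by simp
  next
    case False
    then have k: "N (Suc n) = Suc (N n)" using c by simp
    then have "0 < poly (jac V (Suc n)) x / poly (jac V n) x"
      using s m1[of "n - N n"] by (auto simp: zero_less_divide_iff)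
    then show ?thesis using IH k unfolding pos_count_Suc N_def by simp
  qed
qed

section \<open>Finite Jacobi matrices\<close>

lemma jac_rec:
  "poly (jac V (Suc i)) E = (E - V i) * poly (jac V i) E - (if i = 0 then 0 else poly (jac V (i - 1)) E)"
proof (cases i)
  case (Suc k)
  then show ?thesis by (simp add: jac.simps(3) algebra_simps)
qed simp

text \<open>
  The Jacobi matrix with diagonal \<open>V\<close> as an operator on functions; only arguments below \<open>L\<close>
  matter.
\<close>

definition jop :: "(nat \<Rightarrow> real) \<Rightarrow> nat \<Rightarrow> (nat \<Rightarrow> real) \<Rightarrow> nat \<Rightarrow> real" where
  "jop V L x i = V i * x i + (if i = 0 then 0 else x (i - 1)) + (if Suc i < L then x (Suc i) else 0)"

lemma jop_eigen:
  assumes "E \<in> jroots V L" "i < L"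
  shows "jop V L (\<lambda>i. poly (jac V i) E) i = E * poly (jac V i) E"
proof -
  have "(if Suc i < L then poly (jac V (Suc i)) E else 0) = poly (jac V (Suc i)) E"
    using assms by (cases "Suc i = L") (auto simp: jroots_def)
  then show ?thesis unfolding jop_def using jac_rec[of V i E] by (simp add: algebra_simps)
qed

lemma sum_shift_pred:
  fixes f :: "nat \<Rightarrow> nat \<Rightarrow> real"
  shows "(\<Sum>i<L. if i = 0 then 0 else f (i - 1) i) = (\<Sum>i<L. if Suc i < L then f i (Suc i) else 0)"
proof (cases L)
  case (Suc M)
  have "(\<Sum>i<Suc M. if i = 0 then 0 else f (i - 1) i) = (\<Sum>i<M. f i (Suc i))"
    by (subst sum.lessThan_Suc_shift) simp
  moreover have "(\<Sum>i<Suc M. if Suc i < Suc M then f i (Suc i) else 0) = (\<Sum>i<M. f i (Suc i))"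
    by simp
  ultimately show ?thesis using Suc by simp
qed simp

lemma jop_symmetric: "(\<Sum>i<L. jop V L x i * y i) = (\<Sum>i<L. x i * jop V L y i)"
proof -
  have shift: "(\<Sum>i<L. (if i = 0 then 0 else x (i - 1)) * y i) = (\<Sum>i<L. x i * (if Suc i < L then y (Suc i) else 0))"
    for x y :: "nat \<Rightarrow> real"
  proof -
    have "(\<Sum>i<L. (if i = 0 then 0 else x (i - 1)) * y i) = (\<Sum>i<L. if i = 0 then 0 else x (i - 1) * y i)"
      by (rule sum.cong) auto
    also have "\<dots> = (\<Sum>i<L. if Suc i < L then x i * y (Suc i) else 0)"
      by (rule sum_shift_pred)
    also have "\<dots> = (\<Sum>i<L. x i * (if Suc i < L then y (Suc i) else 0))"
      by (rule sum.cong) auto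
    finally show ?thesis .
  qed
  show ?thesis unfolding jop_def
    using shift[of x y] shift[of y x]
    by (simp only: distrib_left distrib_right sum.distrib) (simp add: mult_ac)
qed

lemma jac_orthogonal:
  assumes "E \<in> jroots V L" "F \<in> jroots V L" "E \<noteq> F"
  shows "(\<Sum>i<L. poly (jac V i) E * poly (jac V i) F) = 0"
proof -
  have "(\<Sum>i<L. jop V L (\<lambda>i. poly (jac V i) E) i * poly (jac V i) F) =
    (\<Sum>i<L. poly (jac V i) E * jop V L (\<lambda>i. poly (jac V i) F) i)" by (rule jop_symmetric)
  then have "(\<Sum>i<L. E * poly (jac V i) E * poly (jac V i) F) = (\<Sum>i<L. poly (jac V i) E * (F * poly (jac V i) F))"
    by (simp add: jop_eigen[OF assms(1)] jop_eigen[OF assms(2)])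
  then have "(E - F) * (\<Sum>i<L. poly (jac V i) E * poly (jac V i) F) = 0"
    by (simp add: sum_distrib_left algebra_simps sum_subtractf)
  then show ?thesis using assms(3) by simp
qed

lemma jac_norm_pos:
  assumes "E \<in> jroots V L"
  shows "0 < (\<Sum>i<L. (poly (jac V i) E)\<^sup>2)"
proof -
  have "L \<noteq> 0" using assms by (auto simp: jroots_def intro: ccontr)
  then have "(poly (jac V 0) E)\<^sup>2 \<le> (\<Sum>i<L. (poly (jac V i) E)\<^sup>2)"
    by (intro member_le_sum) auto
  then show ?thesis by simp
qed

text \<open>
  The normalised eigenvectors form an orthogonal \<open>L \<times> L\<close> matrix; its columns are orthonormal
  because its rows are.
\<close>

lemma jac_parseval:
  "(\<Sum>E\<in>jroots V L. (\<Sum>i<L. y i * poly (jac V i) E)\<^sup>2 / (\<Sum>i<L. (poly (jac V i) E)\<^sup>2)) = (\<Sum>i<L. (y i)\<^sup>2)"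
proof -
  obtain c where c: "bij_betw c {..<L} (jroots V L)"
    using ex_bij_betw_nat_finite[OF finite_jroots[of V L]] card_jroots[of V L] by (auto simp: atLeast0LessThan)
  define N where "N E = (\<Sum>i<L. (poly (jac V i) E)\<^sup>2)" for E
  have cr: "c k \<in> jroots V L" if "k < L" for k using c that by (auto simp: bij_betw_def)
  have Np: "N (c k) > 0" if "k < L" for k unfolding N_def using jac_norm_pos cr[OF that] by blast
  have cinj: "c k \<noteq> c l" if "k < L" "l < L" "k \<noteq> l" for k l
    using c that by (auto simp: bij_betw_def inj_on_def)
  define Q where "Q = mat L L (\<lambda>(k, i). poly (jac V i) (c k) / sqrt (N (c k)))"
  have Q: "Q \<in> carrier_mat L L" "transpose_mat Q \<in> carrier_mat L L" unfolding Q_def by auto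
  have "Q * transpose_mat Q = 1\<^sub>m L"
  proof (rule eq_matI)
    fix k l assume kl: "k < dim_row (1\<^sub>m L :: real mat)" "l < dim_col (1\<^sub>m L :: real mat)"
    then have "(Q * transpose_mat Q) $$ (k, l) = (\<Sum>i<L. poly (jac V i) (c k) / sqrt (N (c k)) * (poly (jac V i) (c l) / sqrt (N (c l))))"
      unfolding Q_def by (simp add: scalar_prod_def atLeast0LessThan)
    also have "\<dots> = (\<Sum>i<L. poly (jac V i) (c k) * poly (jac V i) (c l)) / (sqrt (N (c k)) * sqrt (N (c l)))"
      by (simp add: sum_divide_distrib)
    also have "\<dots> = (if k = l then 1 else 0)"
    proof (cases "k = l")
      case True
      then show ?thesis using Np[of k] kl by (simp add: N_def power2_eq_square)
    next
      case False
      then show ?thesis using jac_orthogonal[of "c k" V L "c l"] kl cr cinj by simp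
    qed
    finally show "(Q * transpose_mat Q) $$ (k, l) = 1\<^sub>m L $$ (k, l)" using kl by simp
  qed (auto simp: Q_def)
  then have QQ: "transpose_mat Q * Q = 1\<^sub>m L"
    using mat_mult_left_right_inverse[OF Q] by simp
  have compl: "(\<Sum>k<L. poly (jac V i) (c k) * poly (jac V j) (c k) / N (c k)) = (if i = j then 1 else 0)"
    if "i < L" "j < L" for i j
  proof -
    have "(transpose_mat Q * Q) $$ (i, j) = (\<Sum>k<L. poly (jac V i) (c k) / sqrt (N (c k)) * (poly (jac V j) (c k) / sqrt (N (c k))))"
      using that unfolding Q_def by (simp add: scalar_prod_def atLeast0LessThan)
    also have "\<dots> = (\<Sum>k<L. poly (jac V i) (c k) * poly (jac V j) (c k) / N (c k))"
      by (rule sum.cong) (use Np in \<open>auto simp: less_imp_le\<close>)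
    finally show ?thesis using that by (simp add: QQ)
  qed
  have "(\<Sum>E\<in>jroots V L. (\<Sum>i<L. y i * poly (jac V i) E)\<^sup>2 / N E) = (\<Sum>k<L. (\<Sum>i<L. y i * poly (jac V i) (c k))\<^sup>2 / N (c k))"
    using sum.reindex_bij_betw[OF c, of "\<lambda>E. (\<Sum>i<L. y i * poly (jac V i) E)\<^sup>2 / N E"] by simp
  also have "\<dots> = (\<Sum>k<L. \<Sum>i<L. \<Sum>j<L. y i * y j * (poly (jac V i) (c k) * poly (jac V j) (c k) / N (c k)))"
    by (intro sum.cong refl) (simp add: power2_eq_square sum_product sum_divide_distrib mult_ac)
  also have "\<dots> = (\<Sum>i<L. \<Sum>j<L. \<Sum>k<L. y i * y j * (poly (jac V i) (c k) * poly (jac V j) (c k) / N (c k)))"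
    by (subst sum.swap) (intro sum.cong refl sum.swap)
  also have "\<dots> = (\<Sum>i<L. \<Sum>j<L. y i * y j * (if i = j then 1 else 0))"
    by (intro sum.cong refl) (simp only: sum_distrib_left[symmetric], simp add: compl)
  also have "\<dots> = (\<Sum>i<L. (y i)\<^sup>2)" by (simp add: power2_eq_square if_distrib cong: if_cong)
  finally show ?thesis unfolding N_def .
qed

lemma jop_lower_bound:
  assumes "\<And>E. E \<in> jroots V L \<Longrightarrow> \<bar>E - E0\<bar> < e \<Longrightarrow> (\<Sum>i<L. y i * poly (jac V i) E) = 0" "0 \<le> e"
  shows "e\<^sup>2 * (\<Sum>i<L. (y i)\<^sup>2) \<le> (\<Sum>i<L. (jop V L y i - E0 * y i)\<^sup>2)"
proof -
  define N where "N E = (\<Sum>i<L. (poly (jac V i) E)\<^sup>2)" for E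
  define p where "p z E = (\<Sum>i<L. z i * poly (jac V i) E)" for z :: "nat \<Rightarrow> real" and E
  have "e\<^sup>2 * (\<Sum>i<L. (y i)\<^sup>2) = (\<Sum>E\<in>jroots V L. e\<^sup>2 * ((p y E)\<^sup>2 / N E))"
    unfolding p_def N_def jac_parseval[symmetric, of y L V] by (simp add: sum_distrib_left)
  also have "\<dots> \<le> (\<Sum>E\<in>jroots V L. (p (\<lambda>i. jop V L y i - E0 * y i) E)\<^sup>2 / N E)"
  proof (rule sum_mono)
    fix E assume E: "E \<in> jroots V L"
    have "p (\<lambda>i. jop V L y i - E0 * y i) E = (\<Sum>i<L. jop V L y i * poly (jac V i) E) - E0 * p y E"
      unfolding p_def by (simp add: algebra_simps sum_subtractf sum_distrib_left)
    also have "(\<Sum>i<L. jop V L y i * poly (jac V i) E) = (\<Sum>i<L. y i * (E * poly (jac V i) E))"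
      unfolding jop_symmetric by (simp add: jop_eigen[OF E])
    also have "\<dots> = E * p y E" unfolding p_def by (simp add: sum_distrib_left mult_ac)
    finally have e: "p (\<lambda>i. jop V L y i - E0 * y i) E = (E - E0) * p y E" by (simp add: algebra_simps)
    have "e\<^sup>2 * (p y E)\<^sup>2 \<le> ((E - E0) * p y E)\<^sup>2"
    proof (cases "\<bar>E - E0\<bar> < e")
      case True
      then show ?thesis using assms(1)[OF E] by (simp add: p_def)
    next
      case False
      then have "e\<^sup>2 \<le> (E - E0)\<^sup>2" using assms(2) by (simp add: abs_le_square_iff[symmetric])
      then show ?thesis by (simp add: power_mult_distrib mult_right_mono)
    qed
    then show "e\<^sup>2 * ((p y E)\<^sup>2 / N E) \<le> (p (\<lambda>i. jop V L y i - E0 * y i) E)\<^sup>2 / N E"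
      using jac_norm_pos[OF E] unfolding e N_def by (simp add: divide_right_mono)
  qed
  also have "\<dots> = (\<Sum>i<L. (jop V L y i - E0 * y i)\<^sup>2)"
    unfolding p_def N_def by (rule jac_parseval)
  finally show ?thesis .
qed

definition tridiag :: "(nat \<Rightarrow> real) \<Rightarrow> nat \<Rightarrow> real mat" where
  "tridiag V L = mat L L (\<lambda>(i, j). if i = j then V i else if i = j + 1 \<or> j = i + 1 then 1 else 0)"

lemma tridiag_mult:
  assumes "i < L"
  shows "(tridiag V L *\<^sub>v vec L x) $ i = jop V L x i"
proof -
  have "(tridiag V L *\<^sub>v vec L x) $ i = (\<Sum>j<L. (if i = j then V i else if i = j + 1 \<or> j = i + 1 then 1 else 0) * x j)"
    using assms unfolding tridiag_def by (simp add: scalar_prod_def atLeast0LessThan)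
  also have "\<dots> = (\<Sum>j<L. (if j = i then V i * x i else 0) + (if j = i - 1 then (if i = 0 then 0 else x (i - 1)) else 0)
      + (if j = Suc i then x (Suc i) else 0))"
    by (rule sum.cong) auto
  also have "\<dots> = jop V L x i"
    using assms unfolding jop_def by (simp add: sum.distrib)
  finally show ?thesis .
qed

lemma jroots_eigenvalue:
  assumes "E \<in> jroots V L"
  shows "eigenvalue (tridiag V L) E"
proof -
  let ?v = "vec L (\<lambda>i. poly (jac V i) E)"
  have L: "L \<noteq> 0" using assms by (auto simp: jroots_def intro: ccontr)
  have "?v $ 0 \<noteq> 0\<^sub>v L $ 0" using L by simp
  then have "?v \<noteq> 0\<^sub>v L" by auto
  moreover have "tridiag V L *\<^sub>v ?v = E \<cdot>\<^sub>v ?v"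
  proof (rule eq_vecI)
    fix i assume "i < dim_vec (E \<cdot>\<^sub>v ?v)"
    then have i: "i < L" by simp
    then show "(tridiag V L *\<^sub>v ?v) $ i = (E \<cdot>\<^sub>v ?v) $ i"
      unfolding tridiag_mult[OF i] jop_eigen[OF assms i] by simp
  qed (simp add: tridiag_def)
  ultimately show ?thesis unfolding eigenvalue_def eigenvector_def
    by (intro exI[of _ ?v]) (simp add: tridiag_def)
qed

text \<open>
  The \<open>L\<close> roots of \<open>jac V L\<close> are \<open>L\<close> different eigenvalues, which leaves multiplicity one for
  each; the determinant is never expanded.
\<close>

lemma eigenvalue_count_tridiag:
  "eigenvalue_count (tridiag V L) a = card {E \<in> jroots V L. E \<le> a}"
proof -
  let ?A = "tridiag V L" let ?p = "char_poly ?A"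
  have A: "?A \<in> carrier_mat L L" by (simp add: tridiag_def)
  have d: "degree ?p = L" "lead_coeff ?p = 1" using degree_monic_char_poly[OF A] by auto
  have nz: "?p \<noteq> 0" using d(2) by auto
  have ev: "eigenvalue ?A E \<longleftrightarrow> poly ?p E = 0" for E using eigenvalue_root_char_poly[OF A] .
  have fin: "finite {x. poly ?p x = 0}" using poly_roots_finite[OF nz] .
  have sub: "jroots V L \<subseteq> {x. poly ?p x = 0}" using jroots_eigenvalue ev by auto
  have "card {x. poly ?p x = 0} \<le> L" using poly_roots_degree[OF nz] d by simp
  then have eq: "jroots V L = {x. poly ?p x = 0}"
    using card_seteq[OF fin sub] card_jroots by simp
  have ge1: "1 \<le> Polynomial.order E ?p" if "E \<in> jroots V L" for E
    using that order_gt_0_iff[OF nz, of E] unfolding eq by simp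
  have le: "(\<Sum>E\<in>jroots V L. Polynomial.order E ?p) \<le> L"
    using sum_order_le_degree[OF nz] d(1) unfolding eq by simp
  have one: "Polynomial.order E ?p = 1" if E: "E \<in> jroots V L" for E
  proof (rule ccontr)
    assume "Polynomial.order E ?p \<noteq> 1"
    then have "1 < Polynomial.order E ?p" using ge1[OF E] by simp
    then have "(\<Sum>E\<in>jroots V L. 1) < (\<Sum>E\<in>jroots V L. Polynomial.order E ?p)"
      using ge1 E by (intro sum_strict_mono_ex1) auto
    then show False using le card_jroots by simp
  qed
  have "eigenvalue_count ?A a = (\<Sum>E\<in>{E \<in> jroots V L. E \<le> a}. Polynomial.order E ?p)"
    unfolding eigenvalue_count_def ev eq by simp
  also have "\<dots> = (\<Sum>E\<in>{E \<in> jroots V L. E \<le> a}. 1)" by (intro sum.cong) (auto simp: one)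
  finally show ?thesis by simp
qed

text \<open>
  Padding with zero rows gives a singular square matrix.
\<close>

lemma underdetermined:
  fixes a :: "nat \<Rightarrow> nat \<Rightarrow> real"
  assumes "n < m"
  obtains c where "\<exists>i<m. c i \<noteq> 0" "\<And>k. k < n \<Longrightarrow> (\<Sum>i<m. a k i * c i) = 0"
proof -
  define A where "A = mat m m (\<lambda>(k, i). if k < n then a k i else 0)"
  have A: "A \<in> carrier_mat m m" unfolding A_def by simp
  have "transpose_mat A *\<^sub>v unit_vec m n = 0\<^sub>v m"
    using assms by (intro eq_vecI) (auto simp: A_def)
  moreover have "unit_vec m n \<noteq> (0\<^sub>v m :: real vec)"
    using assms by simp
  ultimately have "Determinant.det (transpose_mat A) = 0"
    using det_0_iff_vec_prod_zero_field[of "transpose_mat A" m] A by (metis transpose_carrier_mat unit_vec_carrier)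
  then have "Determinant.det A = 0" using det_transpose[OF A] by simp
  then obtain v where v: "v \<in> carrier_vec m" "v \<noteq> 0\<^sub>v m" "A *\<^sub>v v = 0\<^sub>v m"
    using det_0_iff_vec_prod_zero_field[OF A] by auto
  show thesis
  proof
    show "\<exists>i<m. v $ i \<noteq> 0"
    proof (rule ccontr)
      assume "\<not> ?thesis"
      then have "v = 0\<^sub>v m" using v(1) by (intro eq_vecI) auto
      then show False using v(2) by simp
    qed
    fix k assume k: "k < n"
    have "(A *\<^sub>v v) $ k = (\<Sum>i<m. a k i * v $ i)"
      using k assms v(1) unfolding A_def by (auto simp: scalar_prod_def atLeast0LessThan)
    then show "(\<Sum>i<m. a k i * v $ i) = 0" using v(3) k assms by simp
  qed
qed

lemma sum_square_orthogonal:
  fixes f :: "nat \<Rightarrow> 'b \<Rightarrow> real"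
  assumes "\<And>i j. i < m \<Longrightarrow> j < m \<Longrightarrow> i \<noteq> j \<Longrightarrow> (\<Sum>n\<in>A. f i n * f j n) = 0"
  shows "(\<Sum>n\<in>A. (\<Sum>i<m. c i * f i n)\<^sup>2) = (\<Sum>i<m. (c i)\<^sup>2 * (\<Sum>n\<in>A. (f i n)\<^sup>2))"
proof -
  have "(\<Sum>n\<in>A. (\<Sum>i<m. c i * f i n)\<^sup>2) = (\<Sum>n\<in>A. \<Sum>i<m. \<Sum>j<m. c i * c j * (f i n * f j n))"
    by (intro sum.cong refl) (simp add: power2_eq_square sum_product mult_ac)
  also have "\<dots> = (\<Sum>i<m. \<Sum>j<m. \<Sum>n\<in>A. c i * c j * (f i n * f j n))"
    by (subst sum.swap) (intro sum.cong refl sum.swap)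
  also have "\<dots> = (\<Sum>i<m. \<Sum>j<m. if j = i then (c i)\<^sup>2 * (\<Sum>n\<in>A. (f i n)\<^sup>2) else 0)"
    by (intro sum.cong refl) (use assms in \<open>auto simp: sum_distrib_left[symmetric] power2_eq_square\<close>)
  also have "\<dots> = (\<Sum>i<m. (c i)\<^sup>2 * (\<Sum>n\<in>A. (f i n)\<^sup>2))" by simp
  finally show ?thesis .
qed

section \<open>Certified iteration of the ratios\<close>

definition ratio :: "(nat \<Rightarrow> real) \<Rightarrow> real \<Rightarrow> nat \<Rightarrow> real" where
  "ratio V E n = poly (jac V (Suc n)) E / poly (jac V n) E"

lemma ratio_Suc:
  assumes "\<And>i. poly (jac V i) E \<noteq> 0"
  shows "ratio V E (Suc n) = E - V (Suc n) - 1 / ratio V E n" "ratio V E n \<noteq> 0"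
proof -
  show "ratio V E n \<noteq> 0" using assms unfolding ratio_def by simp
  have "poly (jac V (Suc (Suc n))) E = (E - V (Suc n)) * poly (jac V (Suc n)) E - poly (jac V n) E"
    using jac_rec[of V "Suc n" E] by simp
  then show "ratio V E (Suc n) = E - V (Suc n) - 1 / ratio V E n"
    unfolding ratio_def using assms[of "Suc n"] by (simp add: diff_divide_distrib)
qed

text \<open>
  Order on the universal cover of the projective line: a point is a pair of a turn number and a
  slope.
\<close>

definition lex_le :: "int \<Rightarrow> real \<Rightarrow> int \<Rightarrow> real \<Rightarrow> bool" where
  "lex_le m s b r \<longleftrightarrow> m < b \<or> (m = b \<and> s \<le> r)"

text \<open>
  Monotonicity of the lifted map \<open>r \<mapsto> e - 1 / r\<close>.  If \<open>s = 0\<close>, then \<open>s'\<close> is arbitrary: the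
  turn number of the exact sequence is already larger, or it increases while that of the bound
  does not.
\<close>

lemma lex_le_step:
  assumes "lex_le m s b r" "r \<noteq> 0" "e \<le> e'" "s \<noteq> 0 \<Longrightarrow> s' \<le> e - 1 / s"
  shows "lex_le (if s > 0 then m + 1 else m) s' (if r > 0 then b + 1 else b) (e' - 1 / r)"
proof (cases "m < b")
  case True
  show ?thesis
  proof (cases "s > 0 \<and> r < 0")
    case sr: True
    then have "1 / r < 0" "1 / s > 0" "s' \<le> e - 1 / s" using assms(4) by auto
    then have "s' \<le> e' - 1 / r" using assms(3) by linarith
    then show ?thesis using True sr by (auto simp: lex_le_def)
  qed (use True assms(2) in \<open>auto simp: lex_le_def\<close>)
next
  case False
  then have m: "m = b" "s \<le> r" using assms(1) by (auto simp: lex_le_def)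
  consider "s > 0" | "s = 0" | "s < 0" "r > 0" | "s < 0" "r < 0" using assms(2) by linarith
  then show ?thesis
  proof cases
    case 1
    then have "1 / r \<le> 1 / s" using m by (simp add: frac_le)
    then show ?thesis using 1 m assms(3,4) by (auto simp: lex_le_def)
  next
    case 2
    then show ?thesis using m assms(2) by (auto simp: lex_le_def)
  next
    case 3
    then show ?thesis using m by (auto simp: lex_le_def)
  next
    case 4
    then have "1 / r \<le> 1 / s" using m by (simp add: divide_simps)
    then show ?thesis using 4 m assms(3,4) by (auto simp: lex_le_def)
  qed
qed

text \<open>
  Fixed-point arithmetic: \<open>C\<close> and \<open>S\<close> are \<open>2^28\<close> times cosine and sine of the current phase, \<open>R\<close>
  is \<open>2^16\<close> times a lower bound for the ratio, \<open>m\<close> counts the positive ratios.  The rotation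
  constants are \<open>2^28 cis (2 \<pi> \<omega>)\<close>, truncated towards zero to keep the modulus at most 1.  The
  parameter \<open>e0\<close> is \<open>2^28 E\<close> minus an allowance for rounding and for the curvature of the cosine, and \<open>hn\<close> accounts for the
  slope of the cosine over a branch of angular width \<open>h\<close>: it is at least \<open>2^19 h\<close>, because the
  potential is twice the cosine and the sine enters with 10 binary digits; \<open>sg\<close> says on which side of the reference phase the branch
  lies, so that only one sign of the sine matters.  All divisions round downwards, and a
  division by \<open>R = 0\<close> gives the harmless value 0, see \<open>lex_le_step\<close>.
\<close>

primrec run_word :: "int \<Rightarrow> int \<Rightarrow> int \<Rightarrow> nat \<Rightarrow> int \<Rightarrow> int \<Rightarrow> int \<Rightarrow> int \<Rightarrow> int \<times> int" where
  "run_word e0 hn sg 0 C S R m = (m, R)"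
| "run_word e0 hn sg (Suc n) C S R m = run_word e0 hn sg n
     (drop_bit 28 (C * (-197935951) - S * (-181325545)))
     (drop_bit 28 (C * (-181325545) + S * (-197935951)))
     (drop_bit 12 (e0 - 2 * C - (drop_bit 18 (max 0 (sg * S)) + 1) * hn) + (-4294967296) div R)
     (if R > 0 then m + 1 else m)"

lemma drop_bit_bounds:
  fixes x :: int and n :: nat
  shows "real_of_int (drop_bit n x) \<le> real_of_int x / 2^n" "real_of_int x / 2^n < real_of_int (drop_bit n x) + 1"
proof -
  have "drop_bit n x = \<lfloor>real_of_int x / real_of_int (2^n)\<rfloor>"
    by (simp only: drop_bit_eq_div floor_divide_of_int_eq)
  then have e: "drop_bit n x = \<lfloor>real_of_int x / 2^n\<rfloor>" by simp
  show "real_of_int (drop_bit n x) \<le> real_of_int x / 2^n" "real_of_int x / 2^n < real_of_int (drop_bit n x) + 1"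
    unfolding e by linarith+
qed

text \<open>
  Since the approximate rotation does not expand, the errors only add up: 2 units for rounding and
  2 for the rotation constants.
\<close>

lemma rotation_step:
  fixes C S a b :: int and z w :: complex
  assumes Z: "cmod (Complex C S / 2^28 - z) \<le> \<epsilon>" and z: "cmod z = 1"
    and W: "cmod (Complex a b / 2^28 - w) \<le> 2 / 2^28" "cmod (Complex a b / 2^28) \<le> 1"
  shows "cmod (Complex (drop_bit 28 (C * a - S * b)) (drop_bit 28 (C * b + S * a)) / 2^28 - z * w) \<le> \<epsilon> + 4 / 2^28"
proof -
  let ?Z' = "Complex (drop_bit 28 (C * a - S * b)) (drop_bit 28 (C * b + S * a))"
  let ?Z = "Complex C S" let ?W = "Complex a b / 2^28"
  have ZW: "?Z * ?W = Complex (real_of_int (C * a - S * b) / 2^28) (real_of_int (C * b + S * a) / 2^28)"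
    by (simp add: complex_eq_iff)
  have "cmod (?Z' - ?Z * ?W) \<le> \<bar>Re (?Z' - ?Z * ?W)\<bar> + \<bar>Im (?Z' - ?Z * ?W)\<bar>" by (rule cmod_le)
  also have "\<dots> \<le> 1 + 1"
  proof (rule add_mono)
    show "\<bar>Re (?Z' - ?Z * ?W)\<bar> \<le> 1"
      unfolding ZW minus_complex.sel complex.sel
      using drop_bit_bounds[where n = 28 and x = "C * a - S * b"] by linarith
    show "\<bar>Im (?Z' - ?Z * ?W)\<bar> \<le> 1"
      unfolding ZW minus_complex.sel complex.sel
      using drop_bit_bounds[where n = 28 and x = "C * b + S * a"] by linarith
  qed
  finally have 1: "cmod (?Z' / 2^28 - (?Z / 2^28) * ?W) \<le> 2 / 2^28"
  proof -
    assume A: "cmod (?Z' - ?Z * ?W) \<le> 1 + 1"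
    have "?Z' / 2^28 - (?Z / 2^28) * ?W = (?Z' - ?Z * ?W) / 2^28" by (simp add: diff_divide_distrib)
    then have "cmod (?Z' / 2^28 - (?Z / 2^28) * ?W) = cmod (?Z' - ?Z * ?W) / 2^28"
      by (simp only: norm_divide norm_power norm_numeral)
    also have "\<dots> \<le> 2 / 2^28" using A by (intro divide_right_mono) auto
    finally show ?thesis .
  qed
  have "(?Z / 2^28) * ?W - z * w = (?Z / 2^28 - z) * ?W + z * (?W - w)" by (simp add: algebra_simps)
  then have "cmod ((?Z / 2^28) * ?W - z * w) \<le> cmod (?Z / 2^28 - z) * cmod ?W + cmod z * cmod (?W - w)"
    by (metis norm_mult norm_triangle_ineq)
  also have "\<dots> \<le> \<epsilon> * 1 + 1 * (2 / 2^28)"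
    using Z W z by (intro add_mono mult_mono) (auto intro: order_trans[OF norm_ge_zero])
  finally have 2: "cmod ((?Z / 2^28) * ?W - z * w) \<le> \<epsilon> + 2 / 2^28" by simp
  show ?thesis using norm_triangle_le[OF add_mono[OF 1 2]] by simp
qed

lemma Re_cis_bound:
  fixes z :: complex
  assumes z: "cmod z = 1" and sg: "sg = 1 \<or> sg = -1" and x: "0 \<le> - sg * x" "- sg * x \<le> h" and h: "h \<le> 3"
  shows "Re (z * cis x) \<le> Re z + h\<^sup>2 / 2 + h * max 0 (sg * Im z)"
proof -
  have "\<bar>sin (x / 2)\<bar> \<le> \<bar>x / 2\<bar>" by (rule abs_sin_x_le_abs_x)
  then have "(sin (x / 2))\<^sup>2 \<le> (x / 2)\<^sup>2" by (simp only: abs_le_square_iff)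
  then have c1: "1 - x\<^sup>2 / 2 \<le> cos x" using cos_double_sin[of "x / 2"] by (simp add: power_divide)
  have hx: "x\<^sup>2 \<le> h\<^sup>2" using sg x by (intro power2_le_iff_abs_le[THEN iffD2]) auto
  have rz: "\<bar>Re z\<bar> \<le> 1" using abs_Re_le_cmod[of z] z by simp
  have "Re z * cos x \<le> Re z + h\<^sup>2 / 2"
  proof -
    have "Re z * cos x - Re z = - Re z * (1 - cos x)" by (simp add: algebra_simps)
    also have "\<dots> \<le> 1 * (1 - cos x)" using rz by (intro mult_right_mono) auto
    also have "\<dots> \<le> h\<^sup>2 / 2" using c1 hx by simp
    finally show ?thesis by simp
  qed
  moreover have "- Im z * sin x \<le> h * max 0 (sg * Im z)"
  proof -
    define y where "y = - sg * x"
    have y: "0 \<le> y" "y \<le> h" using x y_def by auto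
    have e: "- Im z * sin x = (sg * Im z) * sin y" using sg by (auto simp: y_def)
    have sy: "\<bar>sin y\<bar> \<le> y" using abs_sin_x_le_abs_x[of y] y by simp
    have "0 \<le> sin y" by (rule sin_ge_zero) (use y h pi_gt3 in linarith)+
    then have "(sg * Im z) * sin y \<le> max 0 (sg * Im z) * sin y" by (intro mult_right_mono) auto
    also have "\<dots> \<le> max 0 (sg * Im z) * h" using sy y by (intro mult_left_mono) auto
    finally show ?thesis unfolding e by (simp add: mult.commute)
  qed
  ultimately show ?thesis by (simp add: algebra_simps)
qed

text \<open>
  One round of \<open>run_word\<close> stays below the exact ratios for all phases of the branch at once:
  \<open>z\<close> is the exact reference phase, \<open>x\<close> the deviation from it, and \<open>\<eta>\<close> bounds the accumulated error
  of \<open>C\<close> and \<open>S\<close>.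
\<close>

lemma word_sound:
  fixes w z :: complex and E x h \<eta> :: real and sg :: int
  assumes W: "cmod (Complex (-197935951) (-181325545) / 2^28 - w) \<le> 2 / 2^28" "cmod w = 1"
    and nz: "\<And>i. poly (jac V i) E \<noteq> 0"
    and sg: "sg = 1 \<or> sg = -1" and x: "0 \<le> - real_of_int sg * x" "- real_of_int sg * x \<le> h" and h: "h \<le> 3" "2^19 * h \<le> hn"
    and e0: "e0 / 2^28 \<le> E - 2 * \<eta> - 2 * h * \<eta> - h\<^sup>2"
    and "run_word e0 hn sg q C S R m = (m', R')"
    and "cmod z = 1" "cmod (Complex C S / 2^28 - z) + real q * (4 / 2^28) \<le> \<eta>"
    and "\<And>i. i < q \<Longrightarrow> V (Suc (n + i)) = 2 * Re (z * w^i * cis x)"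
    and "lex_le m (R / 2^16) (pos_count V E n) (ratio V E n)"
  shows "lex_le m' (R' / 2^16) (pos_count V E (n + q)) (ratio V E (n + q))"
  using assms(10-)
proof (induction q arbitrary: C S R m z n)
  case 0
  then show ?case by simp
next
  case (Suc q)
  let ?a = "-197935951 :: int" let ?b = "-181325545 :: int"
  let ?C = "drop_bit 28 (C * ?a - S * ?b)" let ?S = "drop_bit 28 (C * ?b + S * ?a)"
  define D where "D = drop_bit 18 (max 0 (sg * S))"
  define e where "e = drop_bit 12 (e0 - 2 * C - (D + 1) * hn)"
  let ?R = "e + (-4294967296) div R" let ?m = "if R > 0 then m + 1 else m"
  have run: "run_word e0 hn sg q ?C ?S ?R ?m = (m', R')"
    using Suc.prems(1) unfolding e_def D_def by simp
  have cm: "cmod (Complex C S / 2^28 - z) \<le> \<eta>" using Suc.prems(3) by (rule order_trans[rotated]) simp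
  have h0: "0 \<le> h" using x by linarith
  have \<eta>0: "0 \<le> \<eta>" using cm norm_ge_zero order_trans by blast
  have hn0: "0 \<le> hn" using h(2) h0 by (metis mult_nonneg_nonneg of_int_0_le_iff order_trans zero_le_numeral zero_le_power)
  have re: "Re z \<le> C / 2^28 + \<eta>"
  proof -
    have "\<bar>Re (Complex C S / 2^28 - z)\<bar> \<le> \<eta>" using abs_Re_le_cmod cm order_trans by blast
    then show ?thesis by simp
  qed
  have im: "sg * Im z \<le> max 0 (sg * S) / 2^28 + \<eta>"
  proof -
    have "\<bar>Im (Complex C S / 2^28 - z)\<bar> \<le> \<eta>" using abs_Im_le_cmod cm order_trans by blast
    then have "\<bar>S / 2^28 - Im z\<bar> \<le> \<eta>" by simp
    then have "sg * Im z \<le> sg * (S / 2^28) + \<eta>" using sg by auto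
    also have "sg * (S / 2^28) = real_of_int (sg * S) / 2^28" by simp
    also have "\<dots> + \<eta> \<le> max 0 (sg * S) / 2^28 + \<eta>"
      by (intro add_right_mono divide_right_mono) (simp_all only: of_int_le_iff max.cobounded2 zero_le_power zero_le_numeral)
    finally show ?thesis .
  qed
  have "max 0 (sg * S) / 2^18 < real_of_int (D + 1)"
    using drop_bit_bounds(2)[where n = 18 and x = "max 0 (sg * S)"] unfolding D_def by simp
  then have D: "max 0 (sg * S) / 2^28 \<le> real_of_int (D + 1) / 2^10" by simp
  have D0: "0 \<le> D" unfolding D_def by simp
  have mx: "max 0 (sg * Im z) \<le> real_of_int (D + 1) / 2^10 + \<eta>"
  proof -
    have "0 \<le> real_of_int (D + 1) / 2^10" using D0 by simp
    then show ?thesis using im D \<eta>0 by (intro max.boundedI) linarith+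
  qed
  have "2 * h * max 0 (sg * Im z) \<le> 2 * h * (real_of_int (D + 1) / 2^10) + 2 * h * \<eta>"
    using mult_left_mono[OF mx, of "2 * h"] h0 by (simp add: algebra_simps)
  also have "2 * h * (real_of_int (D + 1) / 2^10) = (2^19 * h) * real_of_int (D + 1) / 2^28" by simp
  also have "\<dots> \<le> hn * real_of_int (D + 1) / 2^28"
    using h(2) D0 by (intro divide_right_mono mult_right_mono) auto
  finally have slope: "2 * (h * max 0 (sg * Im z)) \<le> real_of_int ((D + 1) * hn) / 2^28 + 2 * h * \<eta>"
    by (simp add: mult.commute mult.assoc)
  have Vn: "V (Suc n) = 2 * Re (z * cis x)" using Suc.prems(4)[of 0] by simp
  have "Re (z * cis x) \<le> Re z + h\<^sup>2 / 2 + h * max 0 (sg * Im z)"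
    by (rule Re_cis_bound) (use Suc.prems(2) sg x h in auto)
  then have "V (Suc n) \<le> 2 * C / 2^28 + 2 * \<eta> + h\<^sup>2 + 2 * (h * max 0 (sg * Im z))"
    using re Vn by simp
  then have "(e0 - 2 * C - (D + 1) * hn) / 2^28 \<le> E - V (Suc n)"
    using e0 slope by (simp add: diff_divide_distrib)
  moreover have "e / 2^16 \<le> (e0 - 2 * C - (D + 1) * hn) / 2^28"
    using drop_bit_bounds(1)[where n = 12 and x = "e0 - 2 * C - (D + 1) * hn"] unfolding e_def by simp
  ultimately have eV: "e / 2^16 \<le> E - V (Suc n)" by linarith
  have Rdiv: "?R / 2^16 \<le> e / 2^16 - 1 / (R / 2^16)" if "R / 2^16 \<noteq> 0"
  proof -
    have "real_of_int ((-4294967296) div R) \<le> real_of_int (-4294967296) / real_of_int R"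
      by (rule real_of_int_div4)
    then have "real_of_int ?R / 2^16 \<le> (real_of_int e + real_of_int (-4294967296) / real_of_int R) / 2^16"
      by (intro divide_right_mono) auto
    also have "\<dots> = e / 2^16 - 1 / (R / 2^16)" by (simp add: add_divide_distrib)
    finally show ?thesis .
  qed
  have "lex_le (if real_of_int R / 2^16 > 0 then m + 1 else m) (?R / 2^16)
     (if ratio V E n > 0 then int (pos_count V E n) + 1 else pos_count V E n) (E - V (Suc n) - 1 / ratio V E n)"
    by (rule lex_le_step[OF Suc.prems(5) ratio_Suc(2)[OF nz] eV Rdiv])
  moreover have "real_of_int R / 2^16 > 0 \<longleftrightarrow> R > 0" by simp
  moreover have "int (pos_count V E (Suc n)) = (if ratio V E n > 0 then int (pos_count V E n) + 1 else pos_count V E n)"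
    unfolding pos_count_Suc ratio_def by simp
  ultimately have lex: "lex_le ?m (?R / 2^16) (pos_count V E (Suc n)) (ratio V E (Suc n))"
    unfolding ratio_Suc(1)[OF nz] by simp
  have "lex_le m' (R' / 2^16) (pos_count V E (Suc n + q)) (ratio V E (Suc n + q))"
  proof (rule Suc.IH[OF run _ _ _ lex])
    show "cmod (z * w) = 1" using Suc.prems(2) W(2) by (simp add: norm_mult)
    have "cmod (Complex ?C ?S / 2^28 - z * w) \<le> cmod (Complex C S / 2^28 - z) + 4 / 2^28"
    proof (rule rotation_step[OF order_refl Suc.prems(2)])
      show "cmod (Complex (real_of_int ?a) (real_of_int ?b) / 2^28 - w) \<le> 2 / 2^28" using W(1) by simp
      show "cmod (Complex (real_of_int ?a) (real_of_int ?b) / 2^28) \<le> 1"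
      proof -
        have "(cmod (Complex (real_of_int ?a) (real_of_int ?b)))\<^sup>2 \<le> (2^28)\<^sup>2"
          unfolding cmod_power2 by simp
        then have "cmod (Complex (real_of_int ?a) (real_of_int ?b)) \<le> 2^28"
          by (rule power2_le_imp_le) simp
        then show ?thesis by (simp add: norm_divide)
      qed
    qed
    moreover have "real (Suc q) * (4 / 2^28) = 4 / 2^28 + real q * (4 / 2^28)"
      by (simp add: field_simps)
    ultimately show "cmod (Complex ?C ?S / 2^28 - z * w) + real q * (4 / 2^28) \<le> \<eta>"
      using Suc.prems(3) by linarith
    fix i assume "i < q"
    then show "V (Suc (Suc n + i)) = 2 * Re (z * w * w^i * cis x)"
      using Suc.prems(4)[of "Suc i"] by (simp add: mult.assoc)
  qed
  then show ?case by simp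
qed

section \<open>Counting along the return words of a rotation\<close>

definition cos_potential :: "real \<Rightarrow> real \<Rightarrow> nat \<Rightarrow> real" where
  "cos_potential \<omega> \<theta> i = 2 * cos (2 * pi * (\<omega> * real (Suc i) + \<theta>))"

lemma pos_count_mono: "n \<le> m \<Longrightarrow> pos_count V E n \<le> pos_count V E m"
  unfolding pos_count_def by (rule card_mono) auto

text \<open>
  In the lifted order, the word moves every ratio above \<open>c\<close> beyond \<open>c\<close> with \<open>N\<close> further turns;
  \<open>\<sigma>\<close> is the value of \<open>cis\<close> at the base phase, in which the word starts.
\<close>

definition word_ok :: "int \<Rightarrow> int \<Rightarrow> int \<Rightarrow> int \<Rightarrow> nat \<Rightarrow> int \<Rightarrow> int \<Rightarrow> bool" where
  "word_ok e0 hn sg \<sigma> q c N = (case run_word e0 hn sg q (\<sigma> * 268435456) 0 c 0 of (m, R) \<Rightarrow> m = N \<and> c \<le> R)"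

lemma run_word_shift:
  "run_word e0 hn sg q C S R (m + d) = (case run_word e0 hn sg q C S R m of (m', R') \<Rightarrow> (m' + d, R'))"
proof (induction q arbitrary: C S R m)
  case (Suc q)
  show ?case
    unfolding run_word.simps Suc.IH[symmetric] by (simp add: add.commute add.left_commute)
qed simp

lemma word_ok_step:
  fixes \<omega> \<theta> E u \<tau> h :: real and sg \<sigma> c :: int
  assumes W: "cmod (Complex (-197935951) (-181325545) / 2^28 - cis (2 * pi * \<omega>)) \<le> 2 / 2^28"
    and ok: "word_ok e0 hn sg \<sigma> q c N"
    and nz: "\<And>i. poly (jac (cos_potential \<omega> \<theta>) i) E \<noteq> 0"
    and sg: "sg = 1 \<or> sg = -1" and u: "0 \<le> - real_of_int sg * u" "- real_of_int sg * (2 * pi * u) \<le> h" and h: "h \<le> 3" "2^19 * h \<le> hn"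
    and e0: "e0 / 2^28 \<le> E - 2 * (real q * (4 / 2^28)) - 2 * h * (real q * (4 / 2^28)) - h\<^sup>2"
    and \<tau>: "cis (2 * pi * \<tau>) = of_int \<sigma>" "\<sigma> = 1 \<or> \<sigma> = -1"
    and pos: "\<theta> + real (n + 2) * \<omega> = of_int z + \<tau> + u"
    and lex: "lex_le m (c / 2^16) (pos_count (cos_potential \<omega> \<theta>) E n) (ratio (cos_potential \<omega> \<theta>) E n)"
  shows "lex_le (m + N) (c / 2^16) (pos_count (cos_potential \<omega> \<theta>) E (n + q)) (ratio (cos_potential \<omega> \<theta>) E (n + q))"
proof -
  obtain R where R: "run_word e0 hn sg q (\<sigma> * 268435456) 0 c 0 = (N, R)" "c \<le> R"
    using ok unfolding word_ok_def by (auto split: prod.splits)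
  have run: "run_word e0 hn sg q (\<sigma> * 268435456) 0 c m = (m + N, R)"
    using run_word_shift[of e0 hn sg q "\<sigma> * 268435456" 0 c 0 m] R(1) by simp
  have "lex_le (m + N) (R / 2^16) (pos_count (cos_potential \<omega> \<theta>) E (n + q)) (ratio (cos_potential \<omega> \<theta>) E (n + q))"
  proof (rule word_sound[OF W norm_cis nz sg _ _ h e0 run _ _ _ lex, where x = "2 * pi * u"])
    show "0 \<le> - real_of_int sg * (2 * pi * u)" using u(1) sg by (elim disjE) (simp_all add: mult_le_0_iff zero_le_mult_iff)
    show "- real_of_int sg * (2 * pi * u) \<le> h" using u(2) by simp
    show "cmod (of_int \<sigma>) = 1" using \<tau>(2) by auto
    show "cmod (Complex (real_of_int (\<sigma> * 268435456)) (real_of_int 0) / 2^28 - of_int \<sigma>) + real q * (4 / 2^28) \<le> real q * (4 / 2^28)"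
      by (simp add: complex_eq_iff)
    fix i assume "i < q"
    have "2 * pi * (\<omega> * real (Suc (Suc (n + i))) + \<theta>) = 2 * pi * (\<theta> + real (n + 2) * \<omega>) + 2 * pi * (real i * \<omega>)"
      by (simp add: algebra_simps)
    also have "\<dots> = 2 * pi * \<tau> + real i * (2 * pi * \<omega>) + 2 * pi * u + of_int z * (2 * pi)"
      unfolding pos by (simp add: algebra_simps)
    finally have "cis (2 * pi * (\<omega> * real (Suc (Suc (n + i))) + \<theta>)) =
      cis (2 * pi * \<tau>) * cis (real i * (2 * pi * \<omega>)) * cis (2 * pi * u) * cis (of_int z * (2 * pi))"
      by (simp only: cis_mult)
    also have "cis (of_int z * (2 * pi)) = 1" by (metis Ints_of_int cis_multiple_2pi mult.commute)
    also have "cis (real i * (2 * pi * \<omega>)) = cis (2 * pi * \<omega>) ^ i" by (rule Complex.DeMoivre[symmetric])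
    finally show "cos_potential \<omega> \<theta> (Suc (n + i)) = 2 * Re (of_int \<sigma> * cis (2 * pi * \<omega>) ^ i * cis (2 * pi * u))"
      unfolding cos_potential_def \<tau>(1) by (metis cis.sel(1) mult.right_neutral)
  qed
  then show ?thesis using R(2) unfolding lex_le_def by auto
qed

text \<open>
  The base interval is \<open>[\<tau> - b, \<tau> + a]\<close> modulo 1 with \<open>a = q\<^sub>A \<omega> - p\<^sub>A\<close> and \<open>b = p\<^sub>B - q\<^sub>B \<omega>\<close>.
  Its left part returns after \<open>q\<^sub>A\<close> steps, shifted by \<open>a\<close>, and its right part after \<open>q\<^sub>B\<close> steps,
  shifted by \<open>- b\<close>.
\<close>

locale tower_certificate =
  fixes \<omega> E1 \<tau> h\<^sub>A h\<^sub>B :: real and q\<^sub>A q\<^sub>B :: nat and p\<^sub>A p\<^sub>B k j c \<sigma> eA hA eB hB :: int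
  assumes W: "cmod (Complex (-197935951) (-181325545) / 2^28 - cis (2 * pi * \<omega>)) \<le> 2 / 2^28"
    and okA: "word_ok eA hA 1 \<sigma> q\<^sub>A c (k * p\<^sub>A + j * int q\<^sub>A)"
    and okB: "word_ok eB hB (-1) \<sigma> q\<^sub>B c (k * p\<^sub>B + j * int q\<^sub>B)"
    and \<tau>: "cis (2 * pi * \<tau>) = of_int \<sigma>" "\<sigma> = 1 \<or> \<sigma> = -1"
    and hA: "2 * pi * (p\<^sub>B - q\<^sub>B * \<omega>) \<le> h\<^sub>A" "h\<^sub>A \<le> 3" "2^19 * h\<^sub>A \<le> hA"
    and hB: "2 * pi * (q\<^sub>A * \<omega> - p\<^sub>A) \<le> h\<^sub>B" "h\<^sub>B \<le> 3" "2^19 * h\<^sub>B \<le> hB"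
    and eA: "eA / 2^28 \<le> E1 - 2 * (real q\<^sub>A * (4 / 2^28)) - 2 * h\<^sub>A * (real q\<^sub>A * (4 / 2^28)) - h\<^sub>A\<^sup>2"
    and eB: "eB / 2^28 \<le> E1 - 2 * (real q\<^sub>B * (4 / 2^28)) - 2 * h\<^sub>B * (real q\<^sub>B * (4 / 2^28)) - h\<^sub>B\<^sup>2"
    and \<delta>: "0 < q\<^sub>A * \<omega> - p\<^sub>A" "0 < p\<^sub>B - q\<^sub>B * \<omega>"
    and q: "0 < q\<^sub>A" "0 < q\<^sub>B"
    and kj: "0 \<le> k * \<omega> + j" "k * \<omega> + j \<le> 1"
begin

text \<open>
  Steps of length \<open>q\<^sub>A\<close> move by \<open>a\<close>, less than the length of the base interval, and so cannot jump
  over it.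
\<close>

lemma base_entry:
  "\<exists>M. \<forall>\<theta>. \<exists>n\<le>M. \<exists>z::int. - (p\<^sub>B - q\<^sub>B * \<omega>) \<le> \<theta> + real n * \<omega> - of_int z \<and> \<theta> + real n * \<omega> - of_int z \<le> q\<^sub>A * \<omega> - p\<^sub>A"
proof -
  define a where "a = q\<^sub>A * \<omega> - p\<^sub>A"
  define b where "b = p\<^sub>B - q\<^sub>B * \<omega>"
  have ab: "0 < a" "0 < b" using \<delta> by (auto simp: a_def b_def)
  define M where "M = q\<^sub>A * nat (\<lceil>1 / a\<rceil> + 1)"
  have "\<exists>n\<le>M. \<exists>z::int. - b \<le> \<theta> + real n * \<omega> - of_int z \<and> \<theta> + real n * \<omega> - of_int z \<le> a" for \<theta>
  proof -
    define z1 where "z1 = \<lceil>\<theta> + b\<rceil>"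
    define y where "y = z1 - (\<theta> + b)"
    have y: "0 \<le> y" "y < 1" unfolding y_def z1_def by linarith+
    define i where "i = nat \<lceil>y / a\<rceil>"
    have i0: "0 \<le> y / a" using y ab by simp
    then have ri: "real i = of_int \<lceil>y / a\<rceil>" unfolding i_def by simp
    have "y / a \<le> real i" "real i < y / a + 1" unfolding ri by linarith+
    then have i: "y \<le> real i * a" "real i * a \<le> y + a"
      using ab by (simp_all add: field_simps)
    have "y / a \<le> 1 / a" using y ab by (simp add: divide_right_mono)
    then have "\<lceil>y / a\<rceil> \<le> \<lceil>1 / a\<rceil>" by (rule ceiling_mono)
    then have "i \<le> nat (\<lceil>1 / a\<rceil> + 1)" unfolding i_def by linarith
    then have "q\<^sub>A * i \<le> M" unfolding M_def by simp
    moreover have "\<theta> + real (q\<^sub>A * i) * \<omega> - of_int (z1 + int i * p\<^sub>A) = real i * a - y - b"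
      unfolding a_def y_def by (simp add: algebra_simps)
    ultimately show ?thesis using i ab by (intro exI[of _ "q\<^sub>A * i"] conjI exI[of _ "z1 + int i * p\<^sub>A"]) auto
  qed
  then show ?thesis unfolding a_def b_def by blast
qed

text \<open>
  The invariant of the returns is \<open>lex_le (k z + j n + m0) c\<close>, where \<open>z\<close> is the integer part of
  the phase at step \<open>n\<close>.  As \<open>z = n \<omega> + O(1)\<close>, this gives the density \<open>k \<omega> + j\<close>.
\<close>

lemma tower_lower_bound:
  "\<exists>K. \<forall>\<theta> E L. E1 \<le> E \<longrightarrow> (\<forall>i. poly (jac (cos_potential \<omega> \<theta>) i) E \<noteq> 0) \<longrightarrow>
     (k * \<omega> + j) * real L - K \<le> real (pos_count (cos_potential \<omega> \<theta>) E L)"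
proof -
  obtain M where M: "\<And>\<theta>. \<exists>n\<le>M. \<exists>z::int. - (p\<^sub>B - q\<^sub>B * \<omega>) \<le> \<theta> + real n * \<omega> - of_int z \<and> \<theta> + real n * \<omega> - of_int z \<le> q\<^sub>A * \<omega> - p\<^sub>A"
    using base_entry by blast
  define a where "a = q\<^sub>A * \<omega> - p\<^sub>A"
  define b where "b = p\<^sub>B - q\<^sub>B * \<omega>"
  have ab: "0 < a" "0 < b" using \<delta> by (auto simp: a_def b_def)
  define K where "K = real (M + q\<^sub>A + q\<^sub>B) + \<bar>real_of_int k\<bar> * (a + b) + 1"
  have "(k * \<omega> + j) * real L - K \<le> real (pos_count (cos_potential \<omega> \<theta>) E L)"
    if E: "E1 \<le> E" and nz: "\<And>i. poly (jac (cos_potential \<omega> \<theta>) i) E \<noteq> 0" for \<theta> E L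
  proof -
    let ?V = "cos_potential \<omega> \<theta>"
    obtain n0 z0 where n0: "n0 \<le> M" "- b \<le> (\<theta> + 2 * \<omega> - \<tau>) + real n0 * \<omega> - of_int z0"
        "(\<theta> + 2 * \<omega> - \<tau>) + real n0 * \<omega> - of_int z0 \<le> a"
      using M[of "\<theta> + 2 * \<omega> - \<tau>"] unfolding a_def b_def by blast
    \<comment> \<open>With this offset the invariant holds at \<open>n0\<close> whatever the ratio is there.\<close>
    define m0 where "m0 = - 1 - k * z0 - j * int n0"
    define good where "good n z \<longleftrightarrow> - b \<le> \<theta> + real (n + 2) * \<omega> - \<tau> - of_int z \<and> \<theta> + real (n + 2) * \<omega> - \<tau> - of_int z \<le> a
      \<and> lex_le (k * z + j * int n + m0) (c / 2^16) (pos_count ?V E n) (ratio ?V E n)" for n :: nat and z :: int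
    have g0: "good n0 z0"
      using n0 unfolding good_def m0_def lex_le_def by (auto simp: algebra_simps)
    have step: "good (n + q\<^sub>A) (z + p\<^sub>A) \<or> good (n + q\<^sub>B) (z + p\<^sub>B)" if g: "good n z" for n z
    proof -
      define u where "u = \<theta> + real (n + 2) * \<omega> - \<tau> - of_int z"
      have u: "- b \<le> u" "u \<le> a" using g unfolding good_def u_def by auto
      have lex: "lex_le (k * z + j * int n + m0) (c / 2^16) (pos_count ?V E n) (ratio ?V E n)"
        using g unfolding good_def by auto
      have pos: "\<theta> + real (n + 2) * \<omega> = of_int z + \<tau> + u" unfolding u_def by simp
      show ?thesis
      proof (cases "u \<le> 0")
        case True
        have "lex_le (k * z + j * int n + m0 + (k * p\<^sub>A + j * int q\<^sub>A)) (c / 2^16) (pos_count ?V E (n + q\<^sub>A)) (ratio ?V E (n + q\<^sub>A))"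
        proof (rule word_ok_step[OF W okA nz _ _ _ hA(2,3) _ \<tau> pos lex])
          have "2 * pi * (- u) \<le> 2 * pi * b" using u by (intro mult_left_mono) auto
          then show "- real_of_int 1 * (2 * pi * u) \<le> h\<^sub>A" using hA(1) unfolding b_def by simp
        qed (use True eA E in auto)
        then have "good (n + q\<^sub>A) (z + p\<^sub>A)"
          using u True ab unfolding good_def u_def by (auto simp: algebra_simps a_def)
        then show ?thesis ..
      next
        case False
        have "lex_le (k * z + j * int n + m0 + (k * p\<^sub>B + j * int q\<^sub>B)) (c / 2^16) (pos_count ?V E (n + q\<^sub>B)) (ratio ?V E (n + q\<^sub>B))"
        proof (rule word_ok_step[OF W okB nz _ _ _ hB(2,3) _ \<tau> pos lex])
          have "2 * pi * u \<le> 2 * pi * a" using u by (intro mult_left_mono) auto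
          then have "2 * pi * u \<le> h\<^sub>B" using hB(1) unfolding a_def by linarith
          then show "- real_of_int (- 1) * (2 * pi * u) \<le> h\<^sub>B" by simp
        qed (use False eB E in auto)
        then have "good (n + q\<^sub>B) (z + p\<^sub>B)"
          using u False ab unfolding good_def u_def by (auto simp: algebra_simps b_def)
        then show ?thesis ..
      qed
    qed
    have reach: "\<exists>n z. good n z \<and> n0 \<le> n \<and> n \<le> L \<and> L < n + (q\<^sub>A + q\<^sub>B)" if "n0 \<le> L" for L
      using that
    proof (induction L rule: less_induct)
      case (less L)
      show ?case
      proof (cases "L = n0")
        case True
        then show ?thesis using g0 q by auto
      next
        case False
        then have "n0 \<le> L - 1" "L - 1 < L" using less.prems by auto
        then obtain n z where nz': "good n z" "n0 \<le> n" "n \<le> L - 1" "L - 1 < n + (q\<^sub>A + q\<^sub>B)"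
          using less.IH by blast
        show ?thesis
        proof (cases "L < n + (q\<^sub>A + q\<^sub>B)")
          case True
          then show ?thesis using nz' by (intro exI[of _ n] exI[of _ z]) auto
        next
          case False
          then have L: "L = n + (q\<^sub>A + q\<^sub>B)" using nz' \<open>L - 1 < L\<close> by linarith
          from step[OF nz'(1)] show ?thesis
          proof
            assume "good (n + q\<^sub>A) (z + p\<^sub>A)"
            then show ?thesis using L q nz'(2) by (intro exI[of _ "n + q\<^sub>A"] exI[of _ "z + p\<^sub>A"]) auto
          next
            assume "good (n + q\<^sub>B) (z + p\<^sub>B)"
            then show ?thesis using L q nz'(2) by (intro exI[of _ "n + q\<^sub>B"] exI[of _ "z + p\<^sub>B"]) auto
          qed
        qed
      qed
    qed
    have mul: "(k * \<omega> + j) * x \<le> x" if "0 \<le> x" for x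
      using mult_right_mono[OF kj(2) that] by simp
    show ?thesis
    proof (cases "n0 \<le> L")
      case False
      then have "(k * \<omega> + j) * real L \<le> real M" using mul[of "real L"] n0(1) by simp
      moreover have "0 \<le> \<bar>real_of_int k\<bar> * (a + b)" using ab by simp
      ultimately have "(k * \<omega> + j) * real L - K \<le> 0" unfolding K_def by simp
      then show ?thesis by (rule order_trans) simp
    next
      case True
      then obtain n z where g: "good n z" "n0 \<le> n" "n \<le> L" "L < n + (q\<^sub>A + q\<^sub>B)" using reach by blast
      have "k * z + j * int n + m0 \<le> pos_count ?V E n"
        using g(1) unfolding good_def lex_le_def by auto
      then have "k * (z - z0) + j * (int n - int n0) - 1 \<le> int (pos_count ?V E n)"
        unfolding m0_def by (simp add: algebra_simps)
      then have 1: "real_of_int (k * (z - z0) + j * (int n - int n0) - 1) \<le> real (pos_count ?V E n)"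
        by (metis of_int_le_iff of_int_of_nat_eq)
      define d where "d = (of_int z - of_int z0) - (real n - real n0) * \<omega>"
      have d: "\<bar>d\<bar> \<le> a + b"
        using g(1) n0(2,3) unfolding good_def d_def by (auto simp: algebra_simps abs_le_iff)
      have "\<bar>k * d\<bar> \<le> \<bar>real_of_int k\<bar> * (a + b)" unfolding abs_mult using d by (intro mult_left_mono) auto
      then have kd: "- (\<bar>real_of_int k\<bar> * (a + b)) \<le> k * d" by linarith
      have "real_of_int (k * (z - z0) + j * (int n - int n0) - 1) = (k * \<omega> + j) * (real n - real n0) + k * d - 1"
        unfolding d_def by (simp add: algebra_simps)
      moreover have "(k * \<omega> + j) * (real n - real n0) = (k * \<omega> + j) * real L - (k * \<omega> + j) * (real L - real n + real n0)"
        by (simp add: algebra_simps)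
      moreover have "(k * \<omega> + j) * (real L - real n + real n0) \<le> real L - real n + real n0"
        by (rule mul) (use g in auto)
      moreover have "real L - real n + real n0 \<le> real (M + q\<^sub>A + q\<^sub>B)" using g n0(1) by simp
      ultimately have "(k * \<omega> + j) * real L - K \<le> real_of_int (k * (z - z0) + j * (int n - int n0) - 1)"
        using kd unfolding K_def by linarith
      also note 1
      also have "real (pos_count ?V E n) \<le> real (pos_count ?V E L)" using pos_count_mono[OF g(3)] by simp
      finally show ?thesis .
    qed
  qed
  then show ?thesis by blast
qed

end

section \<open>The golden mean\<close>

lemma golden_bounds: "2.2360679774997 \<le> sqrt 5" "sqrt 5 \<le> (2.2360679774998 :: real)"
  by (rule real_le_rsqrt, simp add: power2_eq_square) (rule real_le_lsqrt, simp_all add: power2_eq_square)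

lemma cos_sin_lipschitz:
  fixes x y :: real
  shows "\<bar>cos y - cos x\<bar> \<le> \<bar>y - x\<bar>" "\<bar>sin y - sin x\<bar> \<le> \<bar>y - x\<bar>"
proof -
  have s: "\<bar>sin ((y - x) / 2)\<bar> \<le> \<bar>y - x\<bar> / 2" using abs_sin_x_le_abs_x[of "(y - x) / 2"] by simp
  have "\<bar>cos x - cos y\<bar> = 2 * (\<bar>sin ((x + y) / 2)\<bar> * \<bar>sin ((y - x) / 2)\<bar>)"
    unfolding cos_diff_cos by (simp add: abs_mult)
  also have "\<dots> \<le> 2 * (1 * (\<bar>y - x\<bar> / 2))" using s by (intro mult_left_mono mult_mono) auto
  finally show "\<bar>cos y - cos x\<bar> \<le> \<bar>y - x\<bar>" by (simp add: abs_minus_commute)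
  have "\<bar>sin y - sin x\<bar> = 2 * (\<bar>sin ((y - x) / 2)\<bar> * \<bar>cos ((y + x) / 2)\<bar>)"
    unfolding sin_diff_sin by (simp add: abs_mult)
  also have "\<dots> \<le> 2 * ((\<bar>y - x\<bar> / 2) * 1)" using s by (intro mult_left_mono mult_mono) auto
  finally show "\<bar>sin y - sin x\<bar> \<le> \<bar>y - x\<bar>" by simp
qed

lemma cos_taylor:
  fixes x :: real
  shows "(\<Sum>m<12. cos_coeff m * x^m) = 1 - x^2/2 + x^4/24 - x^6/720 + x^8/40320 - x^10/3628800"
  by (simp add: cos_coeff_def lessThan_nat_numeral fact_numeral)

lemma sin_taylor:
  fixes x :: real
  shows "(\<Sum>m<12. sin_coeff m * x^m) = x - x^3/6 + x^5/120 - x^7/5040 + x^9/362880 - x^11/39916800"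
  by (simp add: sin_coeff_def lessThan_nat_numeral fact_numeral)

text \<open>
  Taylor's formula at \<open>x\<close>, close to \<open>y = \<pi> (sqrt 5 - 2) = 2 \<pi> \<omega> - \<pi>\<close>; the shift by \<open>\<pi>\<close> keeps the
  argument below 1.
\<close>

lemma cis_golden:
  "cmod (Complex (-197935951) (-181325545) / 2^28 - cis (2 * pi * ((sqrt 5 - 1) / 2))) \<le> 2 / 2^28"
proof -
  define x :: real where "x = 0.7416294239"
  define y where "y = pi * (sqrt 5 - 2)"
  have y: "\<bar>y - x\<bar> \<le> 1 / 10^10"
  proof -
    have "y \<le> 3.1415926535899 * 0.2360679774998"
      unfolding y_def using pi_approx golden_bounds by (intro mult_mono) auto
    moreover have "3.141592653588 * 0.2360679774997 \<le> y"
      unfolding y_def using pi_approx golden_bounds by (intro mult_mono) auto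
    ultimately show ?thesis unfolding x_def by simp
  qed
  have remainder: "\<bar>(u / fact 12) * x^12\<bar> \<le> 1 / fact 12" if "\<bar>u\<bar> \<le> 1" for u :: real
  proof -
    have "\<bar>u\<bar> * x^12 \<le> 1" using that by (intro mult_le_one) (auto simp: x_def power_le_one)
    then show ?thesis by (simp add: abs_mult divide_right_mono x_def)
  qed
  have c: "\<bar>cos x - 197935951 / 2^28\<bar> \<le> 3 / 10^9"
  proof -
    obtain t where "cos x = (\<Sum>m<12. cos_coeff m * x^m) + (cos (t + 1/2 * real 12 * pi) / fact 12) * x^12"
      using Maclaurin_cos_expansion[of x 12] by blast
    moreover have "\<bar>(cos (t + 1/2 * real 12 * pi) / fact 12) * x^12\<bar> \<le> 1 / fact 12"
      by (rule remainder) simp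
    moreover have "\<bar>(\<Sum>m<12. cos_coeff m * x^m) - 197935951 / 2^28\<bar> \<le> 3 / 10^9 - 1 / fact 12"
      unfolding cos_taylor by (simp add: x_def fact_numeral power_divide)
    ultimately show ?thesis by linarith
  qed
  have s: "\<bar>sin x - 181325545 / 2^28\<bar> \<le> 3 / 10^9"
  proof -
    obtain t where "sin x = (\<Sum>m<12. sin_coeff m * x^m) + (sin (t + 1/2 * real 12 * pi) / fact 12) * x^12"
      using Maclaurin_sin_expansion[of x 12] by blast
    moreover have "\<bar>(sin (t + 1/2 * real 12 * pi) / fact 12) * x^12\<bar> \<le> 1 / fact 12"
      by (rule remainder) simp
    moreover have "\<bar>(\<Sum>m<12. sin_coeff m * x^m) - 181325545 / 2^28\<bar> \<le> 3 / 10^9 - 1 / fact 12"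
      unfolding sin_taylor by (simp add: x_def fact_numeral power_divide)
    ultimately show ?thesis by linarith
  qed
  have "\<bar>cos y - cos x\<bar> \<le> \<bar>y - x\<bar>" "\<bar>sin y - sin x\<bar> \<le> \<bar>y - x\<bar>"
    by (rule cos_sin_lipschitz)+
  moreover have "1 / 10^10 + 3 / 10^9 \<le> (1 / 2^28 :: real)" by simp
  ultimately have cs: "\<bar>cos y - 197935951 / 2^28\<bar> \<le> 1 / 2^28" "\<bar>sin y - 181325545 / 2^28\<bar> \<le> 1 / 2^28"
    using y c s by linarith+
  let ?d = "Complex (-197935951) (-181325545) / 2^28 - cis (2 * pi * ((sqrt 5 - 1) / 2))"
  have e: "2 * pi * ((sqrt 5 - 1) / 2) = y + pi" unfolding y_def by (simp add: field_simps)
  have "Re ?d = cos y - 197935951 / 2^28" "Im ?d = sin y - 181325545 / 2^28"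
    unfolding e by simp_all
  then have "cmod ?d \<le> 1 / 2^28 + 1 / 2^28" using cmod_le[of ?d] cs by linarith
  then show ?thesis by linarith
qed

definition roots_below_at_least :: "real \<Rightarrow> real \<Rightarrow> real \<Rightarrow> bool" where
  "roots_below_at_least \<omega> E1 d \<longleftrightarrow> (\<exists>K. \<forall>\<theta> E L. E1 < E \<longrightarrow>
     d * real L - K \<le> real (card {y \<in> jroots (cos_potential \<omega> \<theta>) L. y < E}))"

text \<open>
  The ratios are defined for all but countably many energies.
\<close>

lemma exists_generic_energy:
  assumes "a < b"
  shows "\<exists>x. a < x \<and> x < b \<and> (\<forall>i. poly (jac V i) x \<noteq> 0)"
proof -
  have "countable (\<Union>i. jroots V i)" by (intro countable_UN) (auto intro: countable_finite)
  moreover have "uncountable {a<..<b}" using assms by (rule uncountable_open_interval[THEN iffD2])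
  ultimately have "\<not> {a<..<b} \<subseteq> (\<Union>i. jroots V i)" using countable_subset by blast
  then show ?thesis by (auto simp: jroots_def)
qed

lemma (in tower_certificate) roots_below: "roots_below_at_least \<omega> E1 (k * \<omega> + j)"
proof -
  obtain K where K: "\<And>\<theta> E L. E1 \<le> E \<Longrightarrow> (\<And>i. poly (jac (cos_potential \<omega> \<theta>) i) E \<noteq> 0) \<Longrightarrow>
     (k * \<omega> + j) * real L - K \<le> real (pos_count (cos_potential \<omega> \<theta>) E L)"
    using tower_lower_bound by blast
  have "(k * \<omega> + j) * real L - K \<le> real (card {y \<in> jroots (cos_potential \<omega> \<theta>) L. y < E})" if E: "E1 < E" for \<theta> E L
  proof -
    obtain x where x: "E1 < x" "x < E" "\<And>i. poly (jac (cos_potential \<omega> \<theta>) i) x \<noteq> 0"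
      using exists_generic_energy[OF E] by blast
    have "(k * \<omega> + j) * real L - K \<le> real (pos_count (cos_potential \<omega> \<theta>) x L)"
      using K[of x \<theta> L] x by simp
    also have "pos_count (cos_potential \<omega> \<theta>) x L = card {y \<in> jroots (cos_potential \<omega> \<theta>) L. y < x}"
      using sturm_count[OF x(3)] by simp
    also have "real \<dots> \<le> real (card {y \<in> jroots (cos_potential \<omega> \<theta>) L. y < E})"
      using x(2) by (intro of_nat_mono card_mono) auto
    finally show ?thesis .
  qed
  then show ?thesis unfolding roots_below_at_least_def by blast
qed

lemma angle_bound:
  assumes "d \<le> d'" "2 * 3.1415927 * d' * 524288 \<le> of_int h" "0 \<le> d'"
  shows "2 * pi * d \<le> of_int h / 2^19"
proof -
  have "2 * pi * d \<le> 2 * pi * d'" using assms(1) by simp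
  also have "2 * pi * d' \<le> 2 * 3.1415927 * d'" using pi_approx assms(3) by (intro mult_right_mono) auto
  finally show ?thesis using assms(2) by simp
qed

text \<open>
  The hypotheses of \<open>tower_certificate\<close>, reduced to inequalities between rational numbers.
\<close>

lemma golden_tower:
  fixes E1 w :: real and q\<^sub>A q\<^sub>B :: nat and p\<^sub>A p\<^sub>B k j c \<sigma> eA hA eB hB :: int
  defines "w \<equiv> (sqrt 5 - 1) / 2"
  assumes sig: "\<sigma> = 1 \<or> \<sigma> = -1"
    and range: "0 \<le> k * w + j" "k * w + j \<le> 1"
    and okA: "word_ok eA hA 1 \<sigma> q\<^sub>A c N\<^sub>A" "N\<^sub>A = k * p\<^sub>A + j * int q\<^sub>A"
    and okB: "word_ok eB hB (-1) \<sigma> q\<^sub>B c N\<^sub>B" "N\<^sub>B = k * p\<^sub>B + j * int q\<^sub>B"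
    and q: "0 < q\<^sub>A" "0 < q\<^sub>B"
    and pA: "0 < real q\<^sub>A * 0.61803398874985 - p\<^sub>A" and pB: "0 < p\<^sub>B - real q\<^sub>B * 0.6180339887499"
    and hA: "2 * 3.1415927 * (p\<^sub>B - real q\<^sub>B * 0.61803398874985) * 524288 \<le> hA" "hA \<le> 1572864"
    and hB: "2 * 3.1415927 * (real q\<^sub>A * 0.6180339887499 - p\<^sub>A) * 524288 \<le> hB" "hB \<le> 1572864"
    and eA: "eA / 2^28 \<le> E1 - 2 * (real q\<^sub>A * (4 / 2^28)) - 2 * (hA / 2^19) * (real q\<^sub>A * (4 / 2^28)) - (hA / 2^19)\<^sup>2"
    and eB: "eB / 2^28 \<le> E1 - 2 * (real q\<^sub>B * (4 / 2^28)) - 2 * (hB / 2^19) * (real q\<^sub>B * (4 / 2^28)) - (hB / 2^19)\<^sup>2"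
  shows "roots_below_at_least w E1 (k * w + j)"
proof -
  have w: "0.61803398874985 \<le> w" "w \<le> 0.6180339887499"
    unfolding w_def using golden_bounds by auto
  have qw: "real q * 0.61803398874985 \<le> real q * w" "real q * w \<le> real q * 0.6180339887499" for q :: nat
    using w by (intro mult_left_mono; simp)+
  have "tower_certificate w E1 (if \<sigma> = 1 then 0 else 1/2) (hA / 2^19) (hB / 2^19) q\<^sub>A q\<^sub>B p\<^sub>A p\<^sub>B k j c \<sigma> eA hA eB hB"
  proof
    show "cmod (Complex (-197935951) (-181325545) / 2^28 - cis (2 * pi * w)) \<le> 2 / 2^28"
      using cis_golden unfolding w_def .
    show "cis (2 * pi * (if \<sigma> = 1 then 0 else 1/2)) = of_int \<sigma>"
      using sig by (auto simp: complex_eq_iff)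
    show "2 * pi * (p\<^sub>B - real q\<^sub>B * w) \<le> hA / 2^19"
      by (rule angle_bound[OF _ hA(1)]) (use qw[of q\<^sub>B] pB in linarith)+
    show "2 * pi * (real q\<^sub>A * w - p\<^sub>A) \<le> hB / 2^19"
      by (rule angle_bound[OF _ hB(1)]) (use qw[of q\<^sub>A] pA in linarith)+
    show "0 < real q\<^sub>A * w - p\<^sub>A" using qw[of q\<^sub>A] pA by linarith
    show "0 < p\<^sub>B - real q\<^sub>B * w" using qw[of q\<^sub>B] pB by linarith
  qed (use assms in auto)
  then show ?thesis by (rule tower_certificate.roots_below)
qed

section \<open>Evaluation of the return words\<close>

text \<open>
  The suffix names the gap (its label, or the top of the spectrum) and the branch.  The starting
  ratio, the last argument but one, comes from a numerical search; a whole range of values works.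
  The base phase is 0 or 1/2, encoded by 1 or -1 in the fourth argument.
\<close>

lemma word_pos1_A: "word_ok 72667295 26787 1 1 34 6000 21"
  by code_simp

lemma word_pos1_B: "word_ok 71533329 43342 (-1) 1 55 6000 34"
  by code_simp

lemma word_neg1_A: "word_ok (-481190049) 26787 1 1 34 2000 13"
  by code_simp

lemma word_neg1_B: "word_ok (-482324014) 43342 (-1) 1 55 2000 21"
  by code_simp

lemma word_neg2_A: "word_ok 539036978 10232 1 1 233 1000 178"
  by code_simp

lemma word_neg2_B: "word_ok 539100897 6324 (-1) 1 144 1000 110"
  by code_simp

lemma word_pos2_A: "word_ok (-619542709) 10232 1 (-1) 233 (-600000) 55"
  by code_simp

lemma word_pos2_B: "word_ok (-619478790) 6324 (-1) (-1) 144 (-600000) 34"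
  by code_simp

lemma word_pos3_A: "word_ok 637819704 3909 1 1 233 (-10000) 199"
  by code_simp

lemma word_pos3_B: "word_ok 637794396 6324 (-1) 1 377 (-10000) 322"
  by code_simp

lemma word_neg3_A: "word_ok (-673407225) 3909 1 (-1) 233 (-265000) 34"
  by code_simp

lemma word_neg3_B: "word_ok (-673432533) 6324 (-1) (-1) 377 (-265000) 55"
  by code_simp

lemma word_neg4_A: "word_ok 5257532 1493 1 (-1) 610 66000 322"
  by code_simp

lemma word_neg4_B: "word_ok 5250970 2416 (-1) (-1) 987 66000 521"
  by code_simp

lemma word_pos4_A: "word_ok (-34854412) 1493 1 1 610 20000 288"
  by code_simp

lemma word_pos4_B: "word_ok (-34860973) 2416 (-1) 1 987 20000 466"
  by code_simp

lemma word_top_A: "word_ok 697518619 1493 1 (-1) 1597 28000 1597"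
  by code_simp

lemma word_top_B: "word_ok 697524866 923 (-1) (-1) 987 28000 987"
  by code_simp

lemma lower_edge_pos1: "roots_below_at_least ((sqrt 5 - 1) / 2) 0.273318241882 (of_int 1 * ((sqrt 5 - 1) / 2) + of_int 0)"
  by (rule golden_tower[where p\<^sub>A = 21 and p\<^sub>B = 34, OF _ _ _ word_pos1_A _ word_pos1_B])
    (use golden_bounds in \<open>simp_all add: power2_eq_square field_simps\<close>)

lemma lower_edge_neg1: "roots_below_at_least ((sqrt 5 - 1) / 2) (-1.789961146545) (of_int (-1) * ((sqrt 5 - 1) / 2) + of_int 1)"
  by (rule golden_tower[where p\<^sub>A = 21 and p\<^sub>B = 34, OF _ _ _ word_neg1_A _ word_neg1_B])
    (use golden_bounds in \<open>simp_all add: power2_eq_square field_simps\<close>)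

lemma lower_edge_neg2: "roots_below_at_least ((sqrt 5 - 1) / 2) 2.00845718154 (of_int (-2) * ((sqrt 5 - 1) / 2) + of_int 2)"
  by (rule golden_tower[where p\<^sub>A = 144 and p\<^sub>B = 89, OF _ _ _ word_neg2_A _ word_neg2_B])
    (use golden_bounds in \<open>simp_all add: power2_eq_square field_simps\<close>)

lemma lower_edge_pos2: "roots_below_at_least ((sqrt 5 - 1) / 2) (-2.30758848800) (of_int 2 * ((sqrt 5 - 1) / 2) + of_int (-1))"
  by (rule golden_tower[where p\<^sub>A = 144 and p\<^sub>B = 89, OF _ _ _ word_pos2_A _ word_pos2_B])
    (use golden_bounds in \<open>simp_all add: power2_eq_square field_simps\<close>)

lemma lower_edge_pos3: "roots_below_at_least ((sqrt 5 - 1) / 2) 2.37612614288 (of_int 3 * ((sqrt 5 - 1) / 2) + of_int (-1))"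
  by (rule golden_tower[where p\<^sub>A = 144 and p\<^sub>B = 233, OF _ _ _ word_pos3_A _ word_pos3_B])
    (use golden_bounds in \<open>simp_all add: power2_eq_square field_simps\<close>)

lemma lower_edge_neg3: "roots_below_at_least ((sqrt 5 - 1) / 2) (-2.50857481536) (of_int (-3) * ((sqrt 5 - 1) / 2) + of_int 2)"
  by (rule golden_tower[where p\<^sub>A = 144 and p\<^sub>B = 233, OF _ _ _ word_neg3_A _ word_neg3_B])
    (use golden_bounds in \<open>simp_all add: power2_eq_square field_simps\<close>)

lemma lower_edge_neg4: "roots_below_at_least ((sqrt 5 - 1) / 2) 0.0196121757507 (of_int (-4) * ((sqrt 5 - 1) / 2) + of_int 3)"
  by (rule golden_tower[where p\<^sub>A = 377 and p\<^sub>B = 610, OF _ _ _ word_neg4_A _ word_neg4_B])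
    (use golden_bounds in \<open>simp_all add: power2_eq_square field_simps\<close>)

lemma lower_edge_pos4: "roots_below_at_least ((sqrt 5 - 1) / 2) (-0.1298164588928) (of_int 4 * ((sqrt 5 - 1) / 2) + of_int (-2))"
  by (rule golden_tower[where p\<^sub>A = 377 and p\<^sub>B = 610, OF _ _ _ word_pos4_A _ word_pos4_B])
    (use golden_bounds in \<open>simp_all add: power2_eq_square field_simps\<close>)

lemma lower_edge_top: "roots_below_at_least ((sqrt 5 - 1) / 2) 2.59851518536 (of_int 0 * ((sqrt 5 - 1) / 2) + of_int 1)"
  by (rule golden_tower[where p\<^sub>A = 987 and p\<^sub>B = 610, OF _ _ _ word_top_A _ word_top_B])
    (use golden_bounds in \<open>simp_all add: power2_eq_square field_simps\<close>)

section \<open>Gaps from eigenvalue counts\<close>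

text \<open>
  Reflection of the energy, the source of upper bounds from lower ones.
\<close>

lemma jac_mirror: "poly (jac (\<lambda>i. - V i) n) (- x) = (-1)^n * poly (jac V n) x"
proof (induction V n rule: jac.induct)
  case (3 V n)
  then show ?case by (simp add: jac.simps(3) algebra_simps)
qed auto

lemma jroots_mirror: "jroots (\<lambda>i. - V i) n = uminus ` jroots V n"
proof -
  have "poly (jac (\<lambda>i. - V i) n) x = 0 \<longleftrightarrow> poly (jac V n) (- x) = 0" for x
    using jac_mirror[of V n "- x"] by simp
  then have e: "x \<in> jroots (\<lambda>i. - V i) n \<longleftrightarrow> - x \<in> jroots V n" for x
    unfolding jroots_def by simp
  show ?thesis
  proof (intro equalityI subsetI)
    fix x assume "x \<in> jroots (\<lambda>i. - V i) n"
    then show "x \<in> uminus ` jroots V n" using e[of x] by (intro image_eqI[of _ _ "- x"]) simp_all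
  next
    fix x assume "x \<in> uminus ` jroots V n"
    then obtain y where "y \<in> jroots V n" "x = - y" by blast
    then show "x \<in> jroots (\<lambda>i. - V i) n" using e[of x] by simp
  qed
qed

lemma cos_potential_half: "cos_potential \<omega> (\<theta> + 1/2) = (\<lambda>i. - cos_potential \<omega> \<theta> i)"
proof
  fix i
  have "2 * pi * (\<omega> * real (Suc i) + (\<theta> + 1/2)) = 2 * pi * (\<omega> * real (Suc i) + \<theta>) + pi"
    by (simp add: algebra_simps)
  then show "cos_potential \<omega> (\<theta> + 1/2) i = - cos_potential \<omega> \<theta> i"
    unfolding cos_potential_def by (simp only: cos_periodic_pi)
qed

text \<open>
  The error \<open>K\<close> is uniform in the phase so that the bound applies to boxes at every position on the
  lattice.
\<close>

definition counts_like :: "real \<Rightarrow> real set \<Rightarrow> real \<Rightarrow> bool" where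
  "counts_like \<omega> S d \<longleftrightarrow> (\<exists>K. \<forall>\<theta> L. \<forall>E\<in>S.
     d * real L - K \<le> real (card {y \<in> jroots (cos_potential \<omega> \<theta>) L. y < E}) \<and>
     real (card {y \<in> jroots (cos_potential \<omega> \<theta>) L. y \<le> E}) \<le> d * real L + K)"

lemma roots_upto_at_most:
  assumes "roots_below_at_least \<omega> E1 d"
  shows "\<exists>K. \<forall>\<theta> E L. E < - E1 \<longrightarrow>
     real (card {y \<in> jroots (cos_potential \<omega> \<theta>) L. y \<le> E}) \<le> (1 - d) * real L + K"
proof -
  obtain K where K: "\<And>\<theta> E L. E1 < E \<Longrightarrow>
     d * real L - K \<le> real (card {y \<in> jroots (cos_potential \<omega> \<theta>) L. y < E})"
    using assms unfolding roots_below_at_least_def by blast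
  have "real (card {y \<in> jroots (cos_potential \<omega> \<theta>) L. y \<le> E}) \<le> (1 - d) * real L + K"
    if E: "E < - E1" for \<theta> E L
  proof -
    let ?J = "jroots (cos_potential \<omega> \<theta>) L"
    have "{y \<in> jroots (cos_potential \<omega> (\<theta> + 1/2)) L. y < - E} = uminus ` {y \<in> ?J. E < y}"
      unfolding cos_potential_half jroots_mirror by auto
    then have "card {y \<in> jroots (cos_potential \<omega> (\<theta> + 1/2)) L. y < - E} = card {y \<in> ?J. E < y}"
      by (simp add: card_image)
    then have 1: "d * real L - K \<le> real (card {y \<in> ?J. E < y})"
      using K[of "- E" L "\<theta> + 1/2"] E by simp
    have "?J = {y \<in> ?J. y \<le> E} \<union> {y \<in> ?J. E < y}" by auto
    then have "card ?J = card {y \<in> ?J. y \<le> E} + card {y \<in> ?J. E < y}"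
      by (subst card_Un_disjoint[symmetric]) auto
    then have "real (card {y \<in> ?J. y \<le> E}) + real (card {y \<in> ?J. E < y}) = real L"
      using card_jroots[of "cos_potential \<omega> \<theta>" L] by simp
    with 1 show ?thesis by (simp add: algebra_simps)
  qed
  then show ?thesis by blast
qed

lemma counts_like_interval:
  assumes "roots_below_at_least \<omega> a d" "roots_below_at_least \<omega> (- b) (1 - d)"
  shows "counts_like \<omega> {a<..<b} d"
proof -
  obtain K where K: "\<And>\<theta> E L. a < E \<Longrightarrow>
     d * real L - K \<le> real (card {y \<in> jroots (cos_potential \<omega> \<theta>) L. y < E})"
    using assms(1) unfolding roots_below_at_least_def by blast
  obtain K' where K': "\<And>\<theta> E L. E < b \<Longrightarrow>
     real (card {y \<in> jroots (cos_potential \<omega> \<theta>) L. y \<le> E}) \<le> d * real L + K'"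
    using roots_upto_at_most[OF assms(2)] by auto
  show ?thesis unfolding counts_like_def
  proof (intro exI[of _ "max K K'"] allI ballI conjI)
    fix \<theta> L E assume "E \<in> {a<..<b}"
    then show "d * real L - max K K' \<le> real (card {y \<in> jroots (cos_potential \<omega> \<theta>) L. y < E})"
      "real (card {y \<in> jroots (cos_potential \<omega> \<theta>) L. y \<le> E}) \<le> d * real L + max K K'"
      using K[of E L \<theta>] K'[of E \<theta> L] by auto
  qed
qed

lemma counts_like_above:
  assumes "roots_below_at_least \<omega> a 1"
  shows "counts_like \<omega> {a<..} 1"
proof -
  obtain K where K: "\<And>\<theta> E L. a < E \<Longrightarrow>
     1 * real L - K \<le> real (card {y \<in> jroots (cos_potential \<omega> \<theta>) L. y < E})"
    using assms(1) unfolding roots_below_at_least_def by blast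
  have "card {y \<in> jroots (cos_potential \<omega> \<theta>) L. y \<le> E} \<le> L" for \<theta> L E
    using card_mono[of "jroots (cos_potential \<omega> \<theta>) L"] card_jroots[of "cos_potential \<omega> \<theta>" L] by auto
  then have "real (card {y \<in> jroots (cos_potential \<omega> \<theta>) L. y \<le> E}) \<le> real L" for \<theta> L E
    by simp
  then show ?thesis unfolding counts_like_def
  proof (intro exI[of _ "max K 0"] allI ballI conjI)
    fix \<theta> L E assume "E \<in> {a<..}"
    then show "1 * real L - max K 0 \<le> real (card {y \<in> jroots (cos_potential \<omega> \<theta>) L. y < E})"
      using K[of E L \<theta>] by auto
  qed (simp add: add_increasing2)
qed

lemma counts_like_below:
  assumes "roots_below_at_least \<omega> a 1"
  shows "counts_like \<omega> {..<- a} 0"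
proof -
  obtain K where K: "\<And>\<theta> E L. E < - a \<Longrightarrow>
     real (card {y \<in> jroots (cos_potential \<omega> \<theta>) L. y \<le> E}) \<le> (1 - 1) * real L + K"
    using roots_upto_at_most[OF assms] by blast
  show ?thesis unfolding counts_like_def
  proof (intro exI[of _ "max K 0"] allI ballI conjI)
    fix \<theta> L E assume "E \<in> {..<- a}"
    then show "real (card {y \<in> jroots (cos_potential \<omega> \<theta>) L. y \<le> E}) \<le> 0 * real L + max K 0"
      using K[of E \<theta> L] by auto
  qed auto
qed

text \<open>
  The counts at \<open>E0 - e\<close> and \<open>E0 + e\<close> have the same density.
\<close>

lemma counts_like_few_roots:
  assumes "counts_like \<omega> S d" "open S" "E0 \<in> S"
  obtains C e where "0 < e" "\<And>\<theta> L. card {y \<in> jroots (cos_potential \<omega> \<theta>) L. \<bar>y - E0\<bar> < e} \<le> C"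
proof -
  obtain r where r: "0 < r" "ball E0 r \<subseteq> S" using assms(2,3) by (meson open_contains_ball)
  define e where "e = r / 2"
  have e: "0 < e" "E0 - e \<in> S" "E0 + e \<in> S" using r by (auto simp: e_def dist_real_def)
  obtain K where K: "\<And>\<theta> L E. E \<in> S \<Longrightarrow> d * real L - K \<le> real (card {y \<in> jroots (cos_potential \<omega> \<theta>) L. y < E})"
     "\<And>\<theta> L E. E \<in> S \<Longrightarrow> real (card {y \<in> jroots (cos_potential \<omega> \<theta>) L. y \<le> E}) \<le> d * real L + K"
    using assms(1) unfolding counts_like_def by blast
  show thesis
  proof (rule that[OF e(1)])
    fix \<theta> L
    let ?J = "jroots (cos_potential \<omega> \<theta>) L"
    have "card {y \<in> ?J. \<bar>y - E0\<bar> < e} + card {y \<in> ?J. y < E0 - e} = card ({y \<in> ?J. \<bar>y - E0\<bar> < e} \<union> {y \<in> ?J. y < E0 - e})"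
      by (rule card_Un_disjoint[symmetric]) auto
    also have "\<dots> \<le> card {y \<in> ?J. y \<le> E0 + e}" using e(1) by (intro card_mono) auto
    finally have "real (card {y \<in> ?J. \<bar>y - E0\<bar> < e}) + real (card {y \<in> ?J. y < E0 - e}) \<le> real (card {y \<in> ?J. y \<le> E0 + e})"
      by linarith
    then have "real (card {y \<in> ?J. \<bar>y - E0\<bar> < e}) \<le> 2 * K"
      using K(1)[OF e(2), of L \<theta>] K(2)[OF e(3), of \<theta> L] by linarith
    then show "card {y \<in> ?J. \<bar>y - E0\<bar> < e} \<le> nat \<lceil>2 * K\<rceil>" by linarith
  qed
qed

lemma sum_shift_window:
  fixes F :: "int \<Rightarrow> real"
  assumes "\<And>n. int b < \<bar>n\<bar> \<Longrightarrow> F n = 0" "b \<le> o'" "o' + b < L"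
  shows "(\<Sum>i<L. F (int i - int o')) = (\<Sum>n\<in>{- int b..int b}. F n)"
proof -
  have "(\<Sum>i<L. F (int i - int o')) = (\<Sum>i\<in>{o' - b..o' + b}. F (int i - int o'))"
    using assms by (intro sum.mono_neutral_right) auto
  also have "\<dots> = (\<Sum>n\<in>{- int b..int b}. F n)"
    using assms(2) by (intro sum.reindex_bij_witness[of _ "\<lambda>n. nat (n + int o')" "\<lambda>i. int i - int o'"]) auto
  finally show ?thesis .
qed

definition amo_shifted :: "real \<Rightarrow> real \<Rightarrow> real \<Rightarrow> (int \<Rightarrow> real) \<Rightarrow> int \<Rightarrow> real" where
  "amo_shifted \<omega> \<theta> E x n = x (n + 1) + x (n - 1) + (amo_potential 2 \<omega> \<theta> n - E) * x n"

definition bounded_below :: "real \<Rightarrow> real \<Rightarrow> real \<Rightarrow> real \<Rightarrow> bool" where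
  "bounded_below \<omega> \<theta> E \<kappa> \<longleftrightarrow> 0 < \<kappa> \<and> (\<forall>l x. (\<forall>n. int l < \<bar>n\<bar> \<longrightarrow> x n = 0) \<longrightarrow>
     \<kappa>\<^sup>2 * (\<Sum>n\<in>{- int l..int l}. (x n)\<^sup>2) \<le> (\<Sum>n\<in>{- int (Suc l)..int (Suc l)}. (amo_shifted \<omega> \<theta> E x n)\<^sup>2))"

lemma cos_minus_int_period:
  fixes x :: real
  shows "cos (x - of_int z * (2 * pi)) = cos x"
  using cos_int_2pin[of z] sin_int_2pin[of z] by (simp add: cos_diff mult.commute)

text \<open>
  If \<open>x\<close> violated the bound with \<open>\<kappa> = e / 2\<close>, then \<open>Suc C\<close> disjoint translates of \<open>x\<close> by almost
  periods would violate it with \<open>\<kappa> = e\<close>, and so would all their combinations.  One of these is orthogonal to the at most \<open>C\<close>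
  eigenvectors of a long restriction with eigenvalues near \<open>E0\<close>, which contradicts
  \<open>jop_lower_bound\<close>.
\<close>

lemma gap_lower_bound:
  assumes "counts_like \<omega> S d" "open S" "E0 \<in> S"
  shows "\<exists>\<kappa>. bounded_below \<omega> \<theta> E0 \<kappa>"
proof -
  obtain C e where e: "0 < e" and C: "\<And>\<theta> L. card {y \<in> jroots (cos_potential \<omega> \<theta>) L. \<bar>y - E0\<bar> < e} \<le> C"
    by (rule counts_like_few_roots[OF assms]) (rule that)
  have "(e/2)\<^sup>2 * (\<Sum>n\<in>{- int l..int l}. (x n)\<^sup>2) \<le> (\<Sum>n\<in>{- int (Suc l)..int (Suc l)}. (amo_shifted \<omega> \<theta> E0 x n)\<^sup>2)"
    if x0: "\<And>n. int l < \<bar>n\<bar> \<Longrightarrow> x n = 0" for l x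
  proof (rule ccontr)
    define X where "X = (\<Sum>n\<in>{- int l..int l}. (x n)\<^sup>2)"
    let ?T = "amo_shifted \<omega> \<theta> E0 x"
    define Y where "Y = (\<Sum>n\<in>{- int (Suc l)..int (Suc l)}. (?T n)\<^sup>2)"
    assume "\<not> ?thesis"
    then have YX: "Y < (e/2)\<^sup>2 * X" unfolding X_def Y_def by simp
    \<comment> \<open>The factor \<open>2 * l + 3\<close> makes the almost period \<open>s\<close> exceed the support of \<open>T x\<close>, so that
      translates by its multiples are disjoint; with this \<open>N\<close> the first \<open>C\<close> multiples move the potential by
      at most \<open>e / 2\<close>.\<close>
    define N where "N = nat \<lceil>8 * pi * real C / e\<rceil> + 1"
    have N: "8 * pi * real C / e \<le> real N" "0 < N" unfolding N_def by linarith+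
    obtain h k where hk: "0 < k" "k \<le> int N" "\<bar>of_int k * (\<omega> * real (2 * l + 3)) - of_int h\<bar> < 1 / real N"
      using Dirichlet_approx[OF N(2), of "\<omega> * real (2 * l + 3)"] by blast
    define s where "s = nat k * (2 * l + 3)"
    have s: "2 * l + 3 \<le> s" using hk(1) unfolding s_def by (cases "nat k") auto
    have sw: "\<bar>real s * \<omega> - of_int h\<bar> < 1 / real N" using hk(1,3) unfolding s_def by (simp add: mult_ac)
    have per: "\<bar>amo_potential 2 \<omega> \<theta> n - amo_potential 2 \<omega> \<theta> (n - int (t * s))\<bar> \<le> e / 2" if t: "t \<le> C" for t n
    proof -
      let ?a = "2 * pi * (\<omega> * of_int n + \<theta>)" and ?b = "2 * pi * (\<omega> * of_int (n - int (t * s)) + \<theta>)"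
      have "?b = ?a - real t * (2 * pi * (real s * \<omega> - of_int h)) - of_int (int t * h) * (2 * pi)"
        by (simp add: algebra_simps)
      then have "cos ?b = cos (?a - real t * (2 * pi * (real s * \<omega> - of_int h)))"
        by (simp only: cos_minus_int_period)
      then have "\<bar>cos ?a - cos ?b\<bar> \<le> \<bar>real t * (2 * pi * (real s * \<omega> - of_int h))\<bar>"
        using cos_sin_lipschitz(1)[of ?a "?a - real t * (2 * pi * (real s * \<omega> - of_int h))"] by simp
      also have "\<dots> = real t * (2 * pi * \<bar>real s * \<omega> - of_int h\<bar>)" by (simp add: abs_mult)
      also have "\<dots> \<le> real C * (2 * pi * (1 / real N))"
        using t sw by (intro mult_mono) auto
      also have "\<dots> \<le> e / 4" using N e by (simp add: field_simps)
      finally show ?thesis unfolding amo_potential_def by linarith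
    qed
    \<comment> \<open>A box that contains all translates \<open>f t\<close> and a margin, so that the truncation of the
      operator to the box has no effect on them.\<close>
    define L where "L = C * s + 2 * l + 3"
    define V where "V = cos_potential \<omega> (\<theta> - \<omega> * real (l + 2))"
    have V: "V i = amo_potential 2 \<omega> \<theta> (int i - int (Suc l))" for i
      unfolding V_def cos_potential_def amo_potential_def by (rule arg_cong[of _ _ "\<lambda>z. 2 * cos (2 * pi * z)"]) (simp add: algebra_simps)
    define f where "f t i = x (int i - int (Suc l + t * s))" for t i
    define g where "g t i = jop V L (f t) i - E0 * f t i" for t i
    have ts: "t * s \<le> C * s" if "t \<le> C" for t using that by simp
    have g: "g t i = ?T (int i - int (Suc l + t * s)) + (amo_potential 2 \<omega> \<theta> (int i - int (Suc l)) - amo_potential 2 \<omega> \<theta> (int i - int (Suc l) - int (t * s))) * f t i"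
      if t: "t \<le> C" and i: "i < L" for t i
    proof -
      have 1: "(if i = 0 then 0 else f t (i - 1)) = x (int i - int (Suc l + t * s) - 1)"
      proof (cases i)
        case 0
        have "0 \<le> int (t * s)" by simp
        then have "int l < \<bar>- int (Suc l + t * s) - 1\<bar>" unfolding of_nat_add of_nat_Suc by linarith
        then have "x (- int (Suc l + t * s) - 1) = 0" by (rule x0)
        then show ?thesis using 0 by simp
      next
        case (Suc j)
        then show ?thesis unfolding f_def by (simp add: algebra_simps)
      qed
      have 2: "(if Suc i < L then f t (Suc i) else 0) = x (int i - int (Suc l + t * s) + 1)"
      proof (cases "Suc i < L")
        case True
        then show ?thesis unfolding f_def by (simp add: algebra_simps)
      next
        case False
        then have "i = C * s + 2 * l + 2" using i unfolding L_def by linarith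
        then have "int i = int (C * s) + 2 * int l + 2" by linarith
        then have "int l < \<bar>int i - int (Suc l + t * s) + 1\<bar>" using ts[OF t] by linarith
        then show ?thesis using False x0 by simp
      qed
      show ?thesis unfolding g_def jop_def 1 2 V amo_shifted_def
        by (simp add: f_def algebra_simps)
    qed
    have T0: "?T n = 0" if "int (Suc l) < \<bar>n\<bar>" for n
      unfolding amo_shifted_def using that x0[of n] x0[of "n+1"] x0[of "n-1"] by auto
    have sumf: "(\<Sum>i<L. (f t i)\<^sup>2) = X" if t: "t \<le> C" for t
      unfolding f_def X_def
    proof (rule sum_shift_window)
      show "Suc l + t * s + l < L" using ts[OF t] unfolding L_def by linarith
    qed (use x0 in auto)
    have sumT: "(\<Sum>i<L. (?T (int i - int (Suc l + t * s)))\<^sup>2) = Y" if t: "t \<le> C" for t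
      unfolding Y_def
    proof (rule sum_shift_window)
      show "Suc l + t * s + Suc l < L" using ts[OF t] unfolding L_def by linarith
    qed (use T0 in auto)
    have sumg: "(\<Sum>i<L. (g t i)\<^sup>2) < e\<^sup>2 * X" if t: "t \<le> C" for t
    proof -
      have "(g t i)\<^sup>2 \<le> 2 * (?T (int i - int (Suc l + t * s)))\<^sup>2 + (e\<^sup>2 / 2) * (f t i)\<^sup>2" if "i < L" for i
      proof -
        let ?p = "?T (int i - int (Suc l + t * s))"
        let ?v = "amo_potential 2 \<omega> \<theta> (int i - int (Suc l)) - amo_potential 2 \<omega> \<theta> (int i - int (Suc l) - int (t * s))"
        have "\<bar>?v\<bar> \<le> \<bar>e / 2\<bar>" using per[OF t] e by simp
        then have "?v\<^sup>2 \<le> (e / 2)\<^sup>2" by (simp only: abs_le_square_iff)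
        then have "2 * (?v * f t i)\<^sup>2 \<le> (e\<^sup>2 / 2) * (f t i)\<^sup>2"
          using mult_right_mono[of "?v\<^sup>2" "(e/2)\<^sup>2" "2 * (f t i)\<^sup>2"] by (simp add: power_mult_distrib power_divide)
        moreover have "(?p + ?v * f t i)\<^sup>2 \<le> 2 * ?p\<^sup>2 + 2 * (?v * f t i)\<^sup>2"
          using zero_le_power2[of "?p - ?v * f t i"] by (simp add: power2_sum power2_diff)
        ultimately show ?thesis unfolding g[OF t that] by linarith
      qed
      then have "(\<Sum>i<L. (g t i)\<^sup>2) \<le> (\<Sum>i<L. 2 * (?T (int i - int (Suc l + t * s)))\<^sup>2 + (e\<^sup>2 / 2) * (f t i)\<^sup>2)"
        by (intro sum_mono) auto
      also have "\<dots> = 2 * Y + (e\<^sup>2 / 2) * X"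
        by (simp only: sum.distrib sum_distrib_left[symmetric] sumf[OF t] sumT[OF t])
      also have "\<dots> < e\<^sup>2 * X" using YX by (simp add: power_divide)
      finally show ?thesis .
    qed
    define B where "B = {y \<in> jroots V L. \<bar>y - E0\<bar> < e}"
    have "finite B" unfolding B_def by simp
    then obtain \<beta> where \<beta>: "bij_betw \<beta> {..<card B} B"
      using ex_bij_betw_nat_finite by (metis atLeast0LessThan)
    have "card B < Suc C" using C unfolding B_def V_def by (simp add: le_imp_less_Suc)
    then obtain c where c: "\<exists>t<Suc C. c t \<noteq> 0"
      "\<And>k. k < card B \<Longrightarrow> (\<Sum>t<Suc C. (\<Sum>i<L. f t i * poly (jac V i) (\<beta> k)) * c t) = 0"
      by (rule underdetermined[of "card B" "Suc C" "\<lambda>k t. \<Sum>i<L. f t i * poly (jac V i) (\<beta> k)"]) (rule that)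
    define y where "y i = (\<Sum>t<Suc C. c t * f t i)" for i
    have orth: "(\<Sum>i<L. y i * poly (jac V i) E) = 0" if E: "E \<in> jroots V L" "\<bar>E - E0\<bar> < e" for E
    proof -
      have "E \<in> B" using E by (simp add: B_def)
      also have "B = \<beta> ` {..<card B}" using \<beta> by (simp add: bij_betw_def)
      finally obtain k where k: "k < card B" "\<beta> k = E" by blast
      have "(\<Sum>i<L. y i * poly (jac V i) E) = (\<Sum>i<L. \<Sum>t<Suc C. f t i * poly (jac V i) E * c t)"
        unfolding y_def by (simp only: sum_distrib_right) (simp only: mult_ac)
      also have "\<dots> = (\<Sum>t<Suc C. (\<Sum>i<L. f t i * poly (jac V i) E) * c t)"
        by (subst sum.swap) (simp only: sum_distrib_right)
      also have "\<dots> = 0" using c(2)[OF k(1)] unfolding k(2) .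
      finally show ?thesis .
    qed
    have jy: "jop V L y i - E0 * y i = (\<Sum>t<Suc C. c t * g t i)" for i
    proof -
      have "jop V L y i = (\<Sum>t<Suc C. c t * jop V L (f t) i)"
        unfolding jop_def y_def
        by (simp add: sum_distrib_left distrib_left sum.distrib mult_ac del: sum.lessThan_Suc)
      then show ?thesis unfolding g_def y_def
        by (simp add: right_diff_distrib sum_subtractf sum_distrib_left mult_ac del: sum.lessThan_Suc)
    qed
    have sep: "int (2 * l + 3) \<le> \<bar>int (t * s) - int (t' * s)\<bar>" if "t \<noteq> t'" for t t'
    proof -
      have "\<bar>int (t * s) - int (t' * s)\<bar> = \<bar>int t - int t'\<bar> * int s" by (simp add: abs_mult left_diff_distrib[symmetric])
      also have "\<dots> \<ge> 1 * int s" using that by (intro mult_right_mono) auto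
      finally show ?thesis using s by linarith
    qed
    have supp_f: "f t i = 0" if "int l < \<bar>int i - int (Suc l + t * s)\<bar>" for t i
      unfolding f_def using x0[OF that] .
    have supp_g: "g t i = 0" if "t \<le> C" "i < L" "int (Suc l) < \<bar>int i - int (Suc l + t * s)\<bar>" for t i
      using g[OF that(1,2)] T0[OF that(3)] supp_f[of i t] that(3) by simp
    have dis_f: "(\<Sum>i<L. f t i * f t' i) = 0" if "t \<noteq> t'" for t t'
    proof (intro sum.neutral ballI)
      fix i show "f t i * f t' i = 0"
        using sep[OF that] supp_f[of i t] supp_f[of i t'] by (cases "int l < \<bar>int i - int (Suc l + t * s)\<bar>") auto
    qed
    have dis_g: "(\<Sum>i<L. g t i * g t' i) = 0" if "t \<le> C" "t' \<le> C" "t \<noteq> t'" for t t'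
    proof (intro sum.neutral ballI)
      fix i assume "i \<in> {..<L}"
      then have i: "i < L" by simp
      show "g t i * g t' i = 0"
        using sep[OF that(3)] supp_g[OF that(1) i] supp_g[OF that(2) i]
        by (cases "int (Suc l) < \<bar>int i - int (Suc l + t * s)\<bar>") auto
    qed
    have "e\<^sup>2 * (\<Sum>t<Suc C. (c t)\<^sup>2 * X) = e\<^sup>2 * (\<Sum>i<L. (y i)\<^sup>2)"
    proof -
      have "(\<Sum>i<L. (y i)\<^sup>2) = (\<Sum>t<Suc C. (c t)\<^sup>2 * (\<Sum>i<L. (f t i)\<^sup>2))"
        unfolding y_def by (rule sum_square_orthogonal) (rule dis_f)
      also have "\<dots> = (\<Sum>t<Suc C. (c t)\<^sup>2 * X)" by (rule sum.cong) (simp_all add: sumf)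
      finally show ?thesis by simp
    qed
    also have "\<dots> \<le> (\<Sum>i<L. (jop V L y i - E0 * y i)\<^sup>2)"
      by (rule jop_lower_bound) (use orth e in auto)
    also have "\<dots> = (\<Sum>t<Suc C. (c t)\<^sup>2 * (\<Sum>i<L. (g t i)\<^sup>2))"
      unfolding jy by (rule sum_square_orthogonal) (simp add: dis_g)
    also have "\<dots> < (\<Sum>t<Suc C. (c t)\<^sup>2 * (e\<^sup>2 * X))"
    proof (rule sum_strict_mono_ex1)
      show "\<forall>t\<in>{..<Suc C}. (c t)\<^sup>2 * (\<Sum>i<L. (g t i)\<^sup>2) \<le> (c t)\<^sup>2 * (e\<^sup>2 * X)"
      proof
        fix t assume "t \<in> {..<Suc C}"
        then have "t \<le> C" by simp
        then have "(\<Sum>i<L. (g t i)\<^sup>2) \<le> e\<^sup>2 * X" by (rule less_imp_le[OF sumg])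
        then show "(c t)\<^sup>2 * (\<Sum>i<L. (g t i)\<^sup>2) \<le> (c t)\<^sup>2 * (e\<^sup>2 * X)"
          by (rule mult_left_mono) simp
      qed
      obtain t where "t < Suc C" "c t \<noteq> 0" using c(1) by blast
      then show "\<exists>t\<in>{..<Suc C}. (c t)\<^sup>2 * (\<Sum>i<L. (g t i)\<^sup>2) < (c t)\<^sup>2 * (e\<^sup>2 * X)"
        using sumg[of t] by (intro bexI[of _ t]) auto
    qed simp
    also have "\<dots> = e\<^sup>2 * (\<Sum>t<Suc C. (c t)\<^sup>2 * X)" by (simp only: sum_distrib_left) (simp only: mult_ac)
    finally show False by simp
  qed
  then have "bounded_below \<omega> \<theta> E0 (e/2)" using e unfolding bounded_below_def by simp
  then show ?thesis ..
qed

section \<open>Jacobi operators on square-summable sequences\<close>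

definition sq_summable :: "(int \<Rightarrow> real) \<Rightarrow> bool" where
  "sq_summable x \<longleftrightarrow> (\<lambda>n. (x n)\<^sup>2) summable_on UNIV"

definition l2norm :: "(int \<Rightarrow> real) \<Rightarrow> real" where
  "l2norm x = sqrt (\<Sum>\<^sub>\<infinity>n. (x n)\<^sup>2)"

lemma l2norm_nonneg [simp]: "0 \<le> l2norm x"
  unfolding l2norm_def by (simp add: infsum_nonneg)

lemma l2norm_power2: "(l2norm x)\<^sup>2 = (\<Sum>\<^sub>\<infinity>n. (x n)\<^sup>2)"
  unfolding l2norm_def by (simp add: infsum_nonneg)

lemma L2_set_le_l2norm:
  assumes "sq_summable x" "finite F"
  shows "L2_set x F \<le> l2norm x"
  unfolding L2_set_def l2norm_def
  by (rule real_sqrt_le_mono, rule finite_sum_le_infsum) (use assms in \<open>auto simp: sq_summable_def\<close>)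

lemma l2norm_leI:
  assumes "\<And>F. finite F \<Longrightarrow> L2_set x F \<le> B" 
  shows "sq_summable x" "l2norm x \<le> B"
proof -
  have B: "0 \<le> B" using assms[of "{}"] by simp
  have b: "(\<Sum>n\<in>F. (x n)\<^sup>2) \<le> B\<^sup>2" if "finite F" for F
    using assms[OF that] B by (metis L2_set_def real_sqrt_le_iff real_sqrt_abs abs_of_nonneg)
  show s: "sq_summable x" unfolding sq_summable_def
    by (rule nonneg_bdd_above_summable_on) (auto intro!: bdd_aboveI2[of _ _ "B\<^sup>2"] b)
  have "(\<Sum>\<^sub>\<infinity>n. (x n)\<^sup>2) \<le> B\<^sup>2"
    by (rule infsum_le_finite_sums) (use s b in \<open>auto simp: sq_summable_def\<close>)
  then show "l2norm x \<le> B" unfolding l2norm_def using B real_le_lsqrt by (simp add: infsum_nonneg)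
qed

lemma sq_summable_add:
  assumes "sq_summable x" "sq_summable y"
  shows "sq_summable (\<lambda>n. x n + y n)" "l2norm (\<lambda>n. x n + y n) \<le> l2norm x + l2norm y"
proof -
  have b: "L2_set (\<lambda>n. x n + y n) F \<le> l2norm x + l2norm y" if "finite F" for F
    using L2_set_triangle_ineq[of x y F] L2_set_le_l2norm[OF assms(1) that] L2_set_le_l2norm[OF assms(2) that] by linarith
  show "sq_summable (\<lambda>n. x n + y n)" "l2norm (\<lambda>n. x n + y n) \<le> l2norm x + l2norm y"
    using l2norm_leI[of "\<lambda>n. x n + y n", OF b] by blast+
qed

lemma sq_summable_bounded_mult:
  assumes "sq_summable x" "\<And>n. \<bar>d n\<bar> \<le> D"
  shows "sq_summable (\<lambda>n. d n * x n)" "l2norm (\<lambda>n. d n * x n) \<le> D * l2norm x"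
proof -
  have D: "0 \<le> D" using assms(2)[of 0] by linarith
  have b: "L2_set (\<lambda>n. d n * x n) F \<le> D * l2norm x" if "finite F" for F
  proof -
    have "L2_set (\<lambda>n. d n * x n) F = L2_set (\<lambda>n. \<bar>d n\<bar> * \<bar>x n\<bar>) F"
      unfolding L2_set_def by (simp add: power_mult_distrib)
    also have "\<dots> \<le> L2_set (\<lambda>n. D * \<bar>x n\<bar>) F"
      by (rule L2_set_mono) (use assms(2) in \<open>auto intro: mult_right_mono\<close>)
    also have "\<dots> = D * L2_set x F"
      using L2_set_right_distrib[OF D, of "\<lambda>n. \<bar>x n\<bar>" F] by (simp add: L2_set_def)
    also have "\<dots> \<le> D * l2norm x" using L2_set_le_l2norm[OF assms(1) that] D by (rule mult_left_mono)
    finally show ?thesis .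
  qed
  show "sq_summable (\<lambda>n. d n * x n)" "l2norm (\<lambda>n. d n * x n) \<le> D * l2norm x"
    using l2norm_leI[of "\<lambda>n. d n * x n", OF b] by blast+
qed

lemma sq_summable_scale:
  assumes "sq_summable x"
  shows "sq_summable (\<lambda>n. c * x n)" "l2norm (\<lambda>n. c * x n) \<le> \<bar>c\<bar> * l2norm x"
  using sq_summable_bounded_mult[OF assms, of "\<lambda>_. c" "\<bar>c\<bar>"] by auto

lemma bij_add_int: "bij (\<lambda>n :: int. n + k)"
  by (rule bij_betw_byWitness[of _ "\<lambda>n. n - k"]) auto

lemma sq_summable_shift:
  "sq_summable (\<lambda>n. x (n + k)) \<longleftrightarrow> sq_summable x" "l2norm (\<lambda>n. x (n + k)) = l2norm x"
  unfolding sq_summable_def l2norm_def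
  using summable_on_reindex_bij_betw[OF bij_add_int[of k], of "\<lambda>n. (x n)\<^sup>2"]
    infsum_reindex_bij_betw[OF bij_add_int[of k], of "\<lambda>n. (x n)\<^sup>2"] by simp_all

lemma sq_summable_product:
  assumes "sq_summable x" "sq_summable y"
  shows "(\<lambda>n. x n * y n) summable_on UNIV"
proof -
  have s: "(\<lambda>n. (x n)\<^sup>2 + (y n)\<^sup>2) summable_on UNIV"
    using assms unfolding sq_summable_def by (rule summable_on_add)
  have "(\<lambda>n. \<bar>x n * y n\<bar>) summable_on UNIV"
  proof (rule summable_on_comparison_test[OF s])
    fix n
    have "2 * (\<bar>x n\<bar> * \<bar>y n\<bar>) \<le> (x n)\<^sup>2 + (y n)\<^sup>2"
      using zero_le_power2[of "\<bar>x n\<bar> - \<bar>y n\<bar>"] by (simp add: power2_diff)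
    moreover have "0 \<le> \<bar>x n\<bar> * \<bar>y n\<bar>" by simp
    ultimately show "\<bar>x n * y n\<bar> \<le> (x n)\<^sup>2 + (y n)\<^sup>2" unfolding abs_mult by linarith
  qed simp
  then have "(\<lambda>n. norm (x n * y n)) summable_on UNIV" by simp
  then show ?thesis by (rule abs_summable_summable)
qed

locale bounded_jacobi =
  fixes d :: "int \<Rightarrow> real" and D :: real
  assumes d: "\<And>n. \<bar>d n\<bar> \<le> D"
begin

definition T :: "(int \<Rightarrow> real) \<Rightarrow> int \<Rightarrow> real" where
  "T x n = x (n + 1) + x (n - 1) + d n * x n"

lemma D0: "0 \<le> D" using d[of 0] by linarith

lemma T_bounded:
  assumes "sq_summable x"
  shows "sq_summable (T x)" "l2norm (T x) \<le> (D + 2) * l2norm x"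
proof -
  have sh: "sq_summable (\<lambda>n. x (n + k))" for k using assms sq_summable_shift(1) by blast
  have sh': "sq_summable (\<lambda>n. x (n - 1))" "l2norm (\<lambda>n. x (n - 1)) = l2norm x"
    using sh[of "-1"] sq_summable_shift(2)[of x "-1"] by simp_all
  note a1 = sq_summable_add[OF sh[of 1] sh'(1)]
  note a2 = sq_summable_bounded_mult[of x d, OF assms d]
  note a3 = sq_summable_add[OF a1(1) a2(1)]
  have e: "T x = (\<lambda>n. x (n + 1) + x (n - 1) + d n * x n)" by (rule ext) (simp add: T_def)
  show "sq_summable (T x)" unfolding e by (rule a3(1))
  show "l2norm (T x) \<le> (D + 2) * l2norm x"
    unfolding e using a3(2) a2(2) a1(2) sq_summable_shift(2)[of x 1] sh'(2) by (simp add: algebra_simps)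
qed

lemma T_linear: "T (\<lambda>n. a * x n + b * y n) = (\<lambda>n. a * T x n + b * T y n)"
  by (rule ext) (simp add: T_def algebra_simps)

lemma T_symmetric:
  assumes "sq_summable x" "sq_summable y"
  shows "(\<Sum>\<^sub>\<infinity>n. T x n * y n) = (\<Sum>\<^sub>\<infinity>n. x n * T y n)"
proof -
  have sh: "sq_summable (\<lambda>n. x (n + k))" if "sq_summable x" for k and x :: "int \<Rightarrow> real"
    using that sq_summable_shift(1) by blast
  have shift: "(\<Sum>\<^sub>\<infinity>n. x (n + 1) * y n) = (\<Sum>\<^sub>\<infinity>n. x n * y (n - 1))" for x y :: "int \<Rightarrow> real"
    using infsum_reindex_bij_betw[OF bij_add_int[of 1], of "\<lambda>n. x n * y (n - 1)"] by simp
  have m: "sq_summable (\<lambda>n. x (n - 1))" if "sq_summable x" for x :: "int \<Rightarrow> real"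
    using sh[OF that, of "-1"] by simp
  note p = sq_summable_product
  note dx = sq_summable_bounded_mult(1)[of _ d, OF _ d]
  have s1: "(\<lambda>n. x (n + 1) * y n) summable_on UNIV" "(\<lambda>n. x (n - 1) * y n) summable_on UNIV"
    "(\<lambda>n. d n * x n * y n) summable_on UNIV"
    "(\<lambda>n. x n * y (n + 1)) summable_on UNIV" "(\<lambda>n. x n * y (n - 1)) summable_on UNIV"
    using p[OF sh[OF assms(1)] assms(2)] p[OF m[OF assms(1)] assms(2)] p[OF dx[OF assms(1)] assms(2)]
      p[OF assms(1) sh[OF assms(2)]] p[OF assms(1) m[OF assms(2)]] by auto
  have "(\<Sum>\<^sub>\<infinity>n. T x n * y n) = (\<Sum>\<^sub>\<infinity>n. (x (n + 1) * y n + x (n - 1) * y n) + d n * x n * y n)"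
    unfolding T_def by (simp add: algebra_simps)
  also have "\<dots> = (\<Sum>\<^sub>\<infinity>n. x (n + 1) * y n) + (\<Sum>\<^sub>\<infinity>n. x (n - 1) * y n) + (\<Sum>\<^sub>\<infinity>n. d n * x n * y n)"
    using s1 by (simp add: infsum_add summable_on_add)
  also have "(\<Sum>\<^sub>\<infinity>n. x (n + 1) * y n) = (\<Sum>\<^sub>\<infinity>n. x n * y (n - 1))" by (rule shift)
  also have "(\<Sum>\<^sub>\<infinity>n. x (n - 1) * y n) = (\<Sum>\<^sub>\<infinity>n. x n * y (n + 1))"
    using shift[of y x] by (simp add: mult.commute)
  also have "(\<Sum>\<^sub>\<infinity>n. x n * y (n - 1)) + (\<Sum>\<^sub>\<infinity>n. x n * y (n + 1)) + (\<Sum>\<^sub>\<infinity>n. d n * x n * y n)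
      = (\<Sum>\<^sub>\<infinity>n. (x n * y (n - 1) + x n * y (n + 1)) + d n * x n * y n)"
    using s1 by (simp add: infsum_add summable_on_add)
  also have "\<dots> = (\<Sum>\<^sub>\<infinity>n. x n * T y n)" unfolding T_def by (simp add: algebra_simps)
  finally show ?thesis .
qed

text \<open>
  Split \<open>x\<close> into a finitely supported part and a small tail.
\<close>

lemma T_lower_bound_extends:
  assumes low: "\<And>l x. (\<And>n. int l < \<bar>n\<bar> \<Longrightarrow> x n = 0) \<Longrightarrow>
     \<kappa>\<^sup>2 * (\<Sum>n\<in>{- int l..int l}. (x n)\<^sup>2) \<le> (\<Sum>n\<in>{- int (Suc l)..int (Suc l)}. (T x n)\<^sup>2)"
    and \<kappa>: "0 < \<kappa>" and x: "sq_summable x"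
  shows "\<kappa> * l2norm x \<le> l2norm (T x)"
proof (rule field_le_epsilon)
  fix e :: real assume e: "0 < e"
  define \<epsilon> where "\<epsilon> = e / (D + 2 + \<kappa>)"
  have \<epsilon>: "0 < \<epsilon>" using e D0 \<kappa> by (simp add: \<epsilon>_def)
  have hs: "((\<lambda>n. (x n)\<^sup>2) has_sum (l2norm x)\<^sup>2) UNIV"
    using x has_sum_infsum unfolding sq_summable_def l2norm_power2 by blast
  then obtain F where F: "finite F" "dist (\<Sum>n\<in>F. (x n)\<^sup>2) ((l2norm x)\<^sup>2) \<le> \<epsilon>\<^sup>2"
    using has_sum_finite_approximation[OF hs, of "\<epsilon>\<^sup>2"] \<epsilon> by auto
  obtain l where l: "F \<subseteq> {- int l..int l}"
  proof -
    have "finite (abs ` F)" using F(1) by simp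
    then obtain b where b: "\<And>n. n \<in> F \<Longrightarrow> \<bar>n\<bar> \<le> b" by (meson bdd_above_finite bdd_above.unfold imageI)
    show thesis by (rule that[of "nat b"]) (use b in fastforce)
  qed
  define u where "u n = (if \<bar>n\<bar> \<le> int l then x n else 0)" for n
  define v where "v n = (if \<bar>n\<bar> \<le> int l then 0 else x n)" for n
  have xuv: "x = (\<lambda>n. u n + v n)" by (rule ext) (simp add: u_def v_def)
  have u: "sq_summable u" and v: "sq_summable v"
    using sq_summable_bounded_mult(1)[OF x, of "\<lambda>n. if \<bar>n\<bar> \<le> int l then 1 else 0" 1]
      sq_summable_bounded_mult(1)[OF x, of "\<lambda>n. if \<bar>n\<bar> \<le> int l then 0 else 1" 1]
    by (simp_all add: u_def[abs_def] v_def[abs_def] if_distrib if_distribR cong: if_cong)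
  have lv: "l2norm v \<le> \<epsilon>"
  proof (rule l2norm_leI(2))
    fix G :: "int set" assume G: "finite G"
    have vF: "v n = 0" if "n \<in> F" for n
      using subsetD[OF l that] by (auto simp: v_def)
    have "(\<Sum>n\<in>G. (v n)\<^sup>2) + (\<Sum>n\<in>F. (x n)\<^sup>2) = (\<Sum>n\<in>G - F. (v n)\<^sup>2) + (\<Sum>n\<in>F. (x n)\<^sup>2)"
      using G vF by (intro arg_cong2[of _ _ _ _ "(+)"] sum.mono_neutral_right refl) auto
    also have "\<dots> \<le> (\<Sum>n\<in>G - F. (x n)\<^sup>2) + (\<Sum>n\<in>F. (x n)\<^sup>2)"
      by (intro add_right_mono sum_mono) (auto simp: v_def)
    also have "\<dots> = (\<Sum>n\<in>(G - F) \<union> F. (x n)\<^sup>2)"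
      using G F(1) by (intro sum.union_disjoint[symmetric]) auto
    also have "\<dots> \<le> (l2norm x)\<^sup>2" unfolding l2norm_power2
      by (rule finite_sum_le_infsum) (use G F(1) x in \<open>auto simp: sq_summable_def\<close>)
    finally have "(\<Sum>n\<in>G. (v n)\<^sup>2) \<le> \<epsilon>\<^sup>2" using F(2) by (simp add: dist_real_def)
    then show "L2_set v G \<le> \<epsilon>" unfolding L2_set_def using \<epsilon> by (simp add: real_le_lsqrt sum_nonneg)
  qed
  have "\<kappa>\<^sup>2 * (l2norm u)\<^sup>2 \<le> (l2norm (T u))\<^sup>2"
  proof -
    have "(l2norm u)\<^sup>2 = (\<Sum>\<^sub>\<infinity>n\<in>{- int l..int l}. (u n)\<^sup>2)"
      unfolding l2norm_power2 by (rule infsum_cong_neutral) (auto simp: u_def)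
    also have "\<dots> = (\<Sum>n\<in>{- int l..int l}. (u n)\<^sup>2)" by simp
    finally have "\<kappa>\<^sup>2 * (l2norm u)\<^sup>2 \<le> (\<Sum>n\<in>{- int (Suc l)..int (Suc l)}. (T u n)\<^sup>2)"
      using low[of l u] by (simp add: u_def)
    also have "\<dots> \<le> (l2norm (T u))\<^sup>2" unfolding l2norm_power2
      by (rule finite_sum_le_infsum) (use T_bounded(1)[OF u] in \<open>auto simp: sq_summable_def\<close>)
    finally show ?thesis .
  qed
  then have "(\<kappa> * l2norm u)\<^sup>2 \<le> (l2norm (T u))\<^sup>2" by (simp add: power_mult_distrib)
  then have 1: "\<kappa> * l2norm u \<le> l2norm (T u)" by (rule power2_le_imp_le) simp
  have Tu: "T u = (\<lambda>n. T x n + (-1) * T v n)" unfolding xuv by (rule ext) (simp add: T_def algebra_simps)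
  have "l2norm (T u) \<le> l2norm (T x) + l2norm (\<lambda>n. (-1) * T v n)"
    unfolding Tu by (rule sq_summable_add(2)[OF T_bounded(1)[OF x] sq_summable_scale(1)[OF T_bounded(1)[OF v]]])
  also have "l2norm (\<lambda>n. (-1) * T v n) \<le> (D + 2) * l2norm v"
    using sq_summable_scale(2)[OF T_bounded(1)[OF v], of "-1"] T_bounded(2)[OF v] by simp
  finally have 2: "l2norm (T u) \<le> l2norm (T x) + (D + 2) * l2norm v" by simp
  have "l2norm x \<le> l2norm u + l2norm v" using sq_summable_add(2)[OF u v] xuv by simp
  then have "\<kappa> * l2norm x \<le> \<kappa> * l2norm u + \<kappa> * l2norm v"
    using \<kappa> by (metis distrib_left mult_left_mono less_imp_le)
  also have "\<dots> \<le> l2norm (T x) + (D + 2 + \<kappa>) * l2norm v" using 1 2 by (simp add: algebra_simps)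
  also have "(D + 2 + \<kappa>) * l2norm v \<le> (D + 2 + \<kappa>) * \<epsilon>" using lv D0 \<kappa> by (intro mult_left_mono) auto
  also have "\<dots> = e" using D0 \<kappa> by (simp add: \<epsilon>_def)
  finally show "\<kappa> * l2norm x \<le> l2norm (T x) + e" by simp
qed

end

lemma abs_le_l2norm: "sq_summable x \<Longrightarrow> \<bar>x n\<bar> \<le> l2norm x"
  using L2_set_le_l2norm[of x "{n}"] by (simp add: L2_set_def)

lemma l2norm_eq_0: "sq_summable x \<Longrightarrow> l2norm x = 0 \<Longrightarrow> x n = 0"
  using abs_le_l2norm[of x n] by simp

locale bounded_below_jacobi = bounded_jacobi +
  fixes \<kappa> :: real
  assumes \<kappa>: "0 < \<kappa>" and low: "\<And>x. sq_summable x \<Longrightarrow> \<kappa> * l2norm x \<le> l2norm (T x)"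
begin

definition c :: real where "c = 1 / (D + 2)\<^sup>2"
definition r :: real where "r = sqrt (max 0 (1 - c * \<kappa>\<^sup>2))"
text \<open>
  The equation \<open>T (T w) = y\<close> is solved by the series \<open>w = \<Sum>\<^sub>k c G\<^sup>k y\<close>.  The choice of \<open>c\<close> makes
  \<open>G = 1 - c T\<^sup>2\<close> a contraction because \<open>T\<close> is symmetric, bounded and bounded below.
\<close>

definition G :: "(int \<Rightarrow> real) \<Rightarrow> int \<Rightarrow> real" where "G x n = x n - c * T (T x) n"

lemma c_pos: "0 < c" unfolding c_def using D0 by simp

lemma r_range: "0 \<le> r" "r < 1"
proof -
  show "0 \<le> r" unfolding r_def by simp
  have "max 0 (1 - c * \<kappa>\<^sup>2) < 1" using c_pos \<kappa> by simp
  then show "r < 1" unfolding r_def by (metis real_sqrt_lt_1_iff)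
qed

lemma G_contraction:
  assumes x: "sq_summable x"
  shows "sq_summable (G x)" "l2norm (G x) \<le> r * l2norm x"
proof -
  have Tx: "sq_summable (T x)" and TTx: "sq_summable (T (T x))" using T_bounded(1) x by auto
  have e: "G x = (\<lambda>n. x n + (- c) * T (T x) n)" by (rule ext) (simp add: G_def)
  show s: "sq_summable (G x)" unfolding e
    by (rule sq_summable_add(1)[OF x sq_summable_scale(1)[OF TTx]])
  have s1: "(\<lambda>n. (x n)\<^sup>2) summable_on UNIV" "(\<lambda>n. (T (T x) n)\<^sup>2) summable_on UNIV"
    using x TTx unfolding sq_summable_def by auto
  have s2: "(\<lambda>n. x n * T (T x) n) summable_on UNIV" by (rule sq_summable_product[OF x TTx])
  have "(l2norm (G x))\<^sup>2 = (\<Sum>\<^sub>\<infinity>n. ((x n)\<^sup>2 + (- 2 * c) * (x n * T (T x) n)) + c\<^sup>2 * (T (T x) n)\<^sup>2)"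
    unfolding l2norm_power2 G_def by (simp add: power2_diff power_mult_distrib algebra_simps)
  also have "\<dots> = (\<Sum>\<^sub>\<infinity>n. (x n)\<^sup>2) + (- 2 * c) * (\<Sum>\<^sub>\<infinity>n. x n * T (T x) n) + c\<^sup>2 * (\<Sum>\<^sub>\<infinity>n. (T (T x) n)\<^sup>2)"
    using s1 s2 by (simp only: infsum_add summable_on_add summable_on_cmult_right infsum_cmult_right')
  also have "(\<Sum>\<^sub>\<infinity>n. x n * T (T x) n) = (l2norm (T x))\<^sup>2"
    using T_symmetric[OF x Tx] unfolding l2norm_power2 by (simp add: power2_eq_square)
  also have "c\<^sup>2 * (\<Sum>\<^sub>\<infinity>n. (T (T x) n)\<^sup>2) \<le> c * (l2norm (T x))\<^sup>2"
  proof -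
    have "(l2norm (T (T x)))\<^sup>2 \<le> ((D + 2) * l2norm (T x))\<^sup>2"
      using T_bounded(2)[OF Tx] by (intro power_mono) auto
    then have "c\<^sup>2 * (l2norm (T (T x)))\<^sup>2 \<le> c\<^sup>2 * ((D + 2) * l2norm (T x))\<^sup>2" by (rule mult_left_mono) simp
    also have "\<dots> = c * (l2norm (T x))\<^sup>2"
      unfolding c_def using D0 by (simp add: power_mult_distrib power2_eq_square)
    finally show ?thesis unfolding l2norm_power2 .
  qed
  also have "(\<Sum>\<^sub>\<infinity>n. (x n)\<^sup>2) = (l2norm x)\<^sup>2" by (simp add: l2norm_power2)
  finally have "(l2norm (G x))\<^sup>2 \<le> (l2norm x)\<^sup>2 - c * (l2norm (T x))\<^sup>2" by simp
  moreover have "c * (\<kappa> * l2norm x)\<^sup>2 \<le> c * (l2norm (T x))\<^sup>2"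
    using low[OF x] \<kappa> c_pos by (intro mult_left_mono power_mono) auto
  ultimately have "(l2norm (G x))\<^sup>2 \<le> (1 - c * \<kappa>\<^sup>2) * (l2norm x)\<^sup>2"
    by (simp add: power_mult_distrib algebra_simps)
  also have "\<dots> \<le> r\<^sup>2 * (l2norm x)\<^sup>2"
    unfolding r_def by (intro mult_right_mono) auto
  finally have "(l2norm (G x))\<^sup>2 \<le> (r * l2norm x)\<^sup>2" by (simp add: power_mult_distrib)
  then show "l2norm (G x) \<le> r * l2norm x"
    by (rule power2_le_imp_le) (use r_range in simp)
qed

lemma G_iterate:
  assumes "sq_summable y"
  shows "sq_summable ((G ^^ k) y) \<and> l2norm ((G ^^ k) y) \<le> r ^ k * l2norm y"
proof (induction k)
  case (Suc k)
  have "l2norm (G ((G ^^ k) y)) \<le> r * l2norm ((G ^^ k) y)" using G_contraction(2) Suc by blast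
  also have "\<dots> \<le> r * (r ^ k * l2norm y)" using Suc r_range by (intro mult_left_mono) auto
  finally show ?case using G_contraction(1) Suc by (simp add: mult.assoc)
qed (use assms in simp)

lemma T_surj:
  assumes y: "sq_summable y"
  shows "\<exists>x. sq_summable x \<and> T x = y"
proof -
  define g where "g k n = c * (G ^^ k) y n" for k n
  have gl: "sq_summable (g k)" "l2norm (g k) \<le> c * l2norm y * r ^ k" for k
  proof -
    have G: "sq_summable ((G ^^ k) y)" "l2norm ((G ^^ k) y) \<le> r ^ k * l2norm y" using G_iterate[OF y] by auto
    show "sq_summable (g k)" unfolding g_def[abs_def] by (rule sq_summable_scale(1)[OF G(1)])
    have "l2norm (g k) \<le> \<bar>c\<bar> * l2norm ((G ^^ k) y)" unfolding g_def[abs_def] by (rule sq_summable_scale(2)[OF G(1)])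
    also have "\<dots> \<le> c * (r ^ k * l2norm y)" using G(2) c_pos by simp
    finally show "l2norm (g k) \<le> c * l2norm y * r ^ k" by (simp add: mult_ac)
  qed
  have geo: "summable (\<lambda>k. c * l2norm y * r ^ k)"
    using r_range by (intro summable_mult summable_geometric) auto
  have summ: "summable (\<lambda>k. g k n)" for n
    by (rule summable_comparison_test'[OF geo, of 0])
      (use order_trans[OF abs_le_l2norm gl(2)] gl(1) in auto)
  define w where "w n = (\<Sum>k. g k n)" for n
  have gs: "(\<lambda>k. g k n) sums w n" for n unfolding w_def using summ by (rule summable_sums)
  define B where "B = (\<Sum>k. c * l2norm y * r ^ k)"
  have part: "sq_summable (\<lambda>n. \<Sum>k<K. g k n) \<and> l2norm (\<lambda>n. \<Sum>k<K. g k n) \<le> (\<Sum>k<K. c * l2norm y * r ^ k)" for K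
  proof (induction K)
    case 0
    show ?case by (simp add: sq_summable_def l2norm_def)
  next
    case (Suc K)
    then show ?case
      using sq_summable_add[of "\<lambda>n. \<Sum>k<K. g k n" "g K"] gl[of K] by auto
  qed
  have w: "sq_summable w"
  proof (rule l2norm_leI(1))
    fix F :: "int set" assume F: "finite F"
    have "(\<lambda>K. L2_set (\<lambda>n. \<Sum>k<K. g k n) F) \<longlonglongrightarrow> L2_set w F"
      unfolding L2_set_def using gs unfolding sums_def by (intro tendsto_intros) 
    moreover have "L2_set (\<lambda>n. \<Sum>k<K. g k n) F \<le> B" for K
    proof -
      have "L2_set (\<lambda>n. \<Sum>k<K. g k n) F \<le> l2norm (\<lambda>n. \<Sum>k<K. g k n)"
        using L2_set_le_l2norm part F by blast
      also have "\<dots> \<le> (\<Sum>k<K. c * l2norm y * r ^ k)" using part by blast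
      also have "\<dots> \<le> B" unfolding B_def
        by (rule sum_le_suminf[OF geo]) (use c_pos r_range in auto)
      finally show ?thesis .
    qed
    ultimately show "L2_set w F \<le> B" by (intro LIMSEQ_le_const2) auto
  qed
  have Tsum: "(\<lambda>k. T (f k) m) sums T u m" if "\<And>n. (\<lambda>k. f k n) sums u n" for f :: "nat \<Rightarrow> int \<Rightarrow> real" and u m
    unfolding T_def using that by (intro sums_add sums_mult) auto
  have "T (T w) m = y m" for m
  proof -
    have "(\<lambda>k. T (T (g k)) m) sums T (T w) m" by (rule Tsum, rule Tsum, rule gs)
    moreover have "T (T (g k)) m = (G ^^ k) y m - (G ^^ Suc k) y m" for k
      unfolding g_def T_def[abs_def] by (simp add: G_def T_def algebra_simps)
    moreover have "(\<lambda>k. (G ^^ k) y m - (G ^^ Suc k) y m) sums ((G ^^ 0) y m - 0)"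
    proof (rule telescope_sums')
      have "(\<lambda>k. r ^ k * l2norm y) \<longlonglongrightarrow> 0 * l2norm y"
        using r_range by (intro tendsto_intros LIMSEQ_power_zero) auto
      moreover have "\<bar>(G ^^ k) y m\<bar> \<le> r ^ k * l2norm y" for k
        using G_iterate[OF y, of k] abs_le_l2norm[of "(G ^^ k) y" m] by linarith
      ultimately show "(\<lambda>k. (G ^^ k) y m) \<longlonglongrightarrow> 0"
        by (intro Lim_null_comparison[of "\<lambda>k. (G ^^ k) y m" "\<lambda>k. r ^ k * l2norm y"]) auto
    qed
    ultimately show ?thesis using sums_unique2 by fastforce
  qed
  then show ?thesis using T_bounded(1)[OF w] by blast
qed

lemma T_inj:
  assumes "sq_summable x" "sq_summable x'" "T x = T x'"
  shows "x = x'"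
proof -
  have d: "sq_summable (\<lambda>n. x n + (-1) * x' n)"
    by (rule sq_summable_add(1)[OF assms(1) sq_summable_scale(1)[OF assms(2)]])
  have "T (\<lambda>n. x n + (-1) * x' n) = (\<lambda>n. T x n + (-1) * T x' n)"
    by (rule ext) (simp add: T_def algebra_simps)
  then have "T (\<lambda>n. x n + (-1) * x' n) = (\<lambda>n. 0)" using assms(3) by simp
  then have "\<kappa> * l2norm (\<lambda>n. x n + (-1) * x' n) \<le> 0" using low[OF d] by (simp add: l2norm_def)
  then have "l2norm (\<lambda>n. x n + (-1) * x' n) = 0"
    using \<kappa> l2norm_nonneg by (metis mult_le_0_iff not_less order_antisym)
  then show ?thesis using l2norm_eq_0[OF d] by (intro ext) simp
qed

definition S :: "(int \<Rightarrow> real) \<Rightarrow> int \<Rightarrow> real" where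
  "S y = (SOME x. sq_summable x \<and> T x = y)"

lemma S: assumes "sq_summable y" shows "sq_summable (S y)" "T (S y) = y"
  using someI_ex[OF T_surj[OF assms]] unfolding S_def by auto

lemma S_eqI: "sq_summable x \<Longrightarrow> T x = y \<Longrightarrow> S y = x"
  using S T_bounded(1) T_inj by metis

lemma S_linear:
  assumes "sq_summable x" "sq_summable y"
  shows "S (\<lambda>n. a * x n + b * y n) = (\<lambda>n. a * S x n + b * S y n)"
proof (rule S_eqI)
  show "sq_summable (\<lambda>n. a * S x n + b * S y n)"
    by (rule sq_summable_add(1)[OF sq_summable_scale(1)[OF S(1)[OF assms(1)]] sq_summable_scale(1)[OF S(1)[OF assms(2)]]])
  show "T (\<lambda>n. a * S x n + b * S y n) = (\<lambda>n. a * x n + b * y n)"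
    unfolding T_linear S(2)[OF assms(1)] S(2)[OF assms(2)] ..
qed

lemma S_bounded: "sq_summable y \<Longrightarrow> l2norm (S y) \<le> l2norm y / \<kappa>"
  using low[OF S(1)] S(2) \<kappa> by (simp add: field_simps)

end

lemma l2_int_iff: "x \<in> l2_int \<longleftrightarrow> sq_summable (\<lambda>n. Re (x n)) \<and> sq_summable (\<lambda>n. Im (x n))"
proof -
  have "(\<lambda>n. (cmod (x n))\<^sup>2) summable_on UNIV" if "sq_summable (\<lambda>n. Re (x n))" "sq_summable (\<lambda>n. Im (x n))"
    using that unfolding sq_summable_def cmod_power2 by (rule summable_on_add)
  moreover have "sq_summable (\<lambda>n. Re (x n))" "sq_summable (\<lambda>n. Im (x n))"
    if "(\<lambda>n. (cmod (x n))\<^sup>2) summable_on UNIV"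
    unfolding sq_summable_def
    by (rule summable_on_comparison_test[OF that]; simp add: cmod_power2)+
  ultimately show ?thesis unfolding l2_int_def by auto
qed

lemma l2_int_norm_power2:
  assumes "x \<in> l2_int"
  shows "(l2_int_norm x)\<^sup>2 = (l2norm (\<lambda>n. Re (x n)))\<^sup>2 + (l2norm (\<lambda>n. Im (x n)))\<^sup>2"
proof -
  have "(l2_int_norm x)\<^sup>2 = (\<Sum>\<^sub>\<infinity>n. (Re (x n))\<^sup>2 + (Im (x n))\<^sup>2)"
    unfolding l2_int_norm_def by (simp add: infsum_nonneg cmod_power2)
  also have "\<dots> = (l2norm (\<lambda>n. Re (x n)))\<^sup>2 + (l2norm (\<lambda>n. Im (x n)))\<^sup>2"
    unfolding l2norm_power2 using assms unfolding l2_int_iff sq_summable_def by (intro infsum_add) auto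
  finally show ?thesis .
qed

lemma l2_int_norm_nonneg: "0 \<le> l2_int_norm x"
  unfolding l2_int_norm_def by (simp add: infsum_nonneg)

section \<open>Spectrum and lower bounds\<close>

lemma resolvent_of_lower_bound:
  assumes "bounded_below_jacobi (\<lambda>n. amo_potential 2 \<omega> \<theta> n - E) D \<kappa>"
  shows "E \<notin> amo_spectrum 2 \<omega> \<theta>"
proof -
  interpret bounded_below_jacobi "\<lambda>n. amo_potential 2 \<omega> \<theta> n - E" D \<kappa> by (rule assms)
  define R where "R x n = Complex (S (\<lambda>n. Re (x n)) n) (S (\<lambda>n. Im (x n)) n)" for x :: "int \<Rightarrow> complex" and n
  let ?H = "almost_mathieu 2 \<omega> \<theta>"
  let ?A = "\<lambda>x n. ?H x n - complex_of_real E * x n"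
  have Re_A: "(\<lambda>n. Re (?A x n)) = T (\<lambda>n. Re (x n))" and Im_A: "(\<lambda>n. Im (?A x n)) = T (\<lambda>n. Im (x n))" for x
    by (auto simp: almost_mathieu_def T_def algebra_simps fun_eq_iff)
  have Re_R: "(\<lambda>n. Re (R x n)) = S (\<lambda>n. Re (x n))" and Im_R: "(\<lambda>n. Im (R x n)) = S (\<lambda>n. Im (x n))" for x
    unfolding R_def by simp_all
  have l2R: "R x \<in> l2_int" if "x \<in> l2_int" for x
    using that S(1) unfolding l2_int_iff Re_R Im_R by blast
  have "bounded_operator_l2 R"
    unfolding bounded_operator_l2_def
  proof (intro conjI ballI allI)
    show "R x \<in> l2_int" if "x \<in> l2_int" for x using l2R[OF that] .
  next
    fix x y assume "x \<in> l2_int" "y \<in> l2_int"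
    then have s: "sq_summable (\<lambda>n. Re (x n))" "sq_summable (\<lambda>n. Im (x n))" "sq_summable (\<lambda>n. Re (y n))" "sq_summable (\<lambda>n. Im (y n))"
      unfolding l2_int_iff by auto
    show "R (\<lambda>n. x n + y n) = (\<lambda>n. R x n + R y n)"
      using S_linear[OF s(1,3), of 1 1] S_linear[OF s(2,4), of 1 1]
      unfolding R_def by (simp add: fun_eq_iff complex_eq_iff)
  next
    fix a x assume "x \<in> l2_int"
    then have s: "sq_summable (\<lambda>n. Re (x n))" "sq_summable (\<lambda>n. Im (x n))"
      unfolding l2_int_iff by auto
    show "R (\<lambda>n. a * x n) = (\<lambda>n. a * R x n)"
      using S_linear[OF s, of "Re a" "- Im a"] S_linear[OF s, of "Im a" "Re a"]
      unfolding R_def by (simp add: fun_eq_iff complex_eq_iff algebra_simps)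
  next
    show "\<exists>C. \<forall>x\<in>l2_int. l2_int_norm (R x) \<le> C * l2_int_norm x"
    proof (intro exI[of _ "1 / \<kappa>"] ballI)
      fix x assume x: "x \<in> l2_int"
      then have s: "sq_summable (\<lambda>n. Re (x n))" "sq_summable (\<lambda>n. Im (x n))"
        unfolding l2_int_iff by auto
      have "(l2norm (S (\<lambda>n. Re (x n))))\<^sup>2 \<le> (l2norm (\<lambda>n. Re (x n)) / \<kappa>)\<^sup>2"
        "(l2norm (S (\<lambda>n. Im (x n))))\<^sup>2 \<le> (l2norm (\<lambda>n. Im (x n)) / \<kappa>)\<^sup>2"
        using S_bounded s by (auto intro!: power_mono)
      then have "(l2_int_norm (R x))\<^sup>2 \<le> (1 / \<kappa> * l2_int_norm x)\<^sup>2"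
        unfolding l2_int_norm_power2[OF l2R[OF x]] power_mult_distrib l2_int_norm_power2[OF x] Re_R Im_R
        by (simp add: power_divide add_divide_distrib)
      then show "l2_int_norm (R x) \<le> 1 / \<kappa> * l2_int_norm x"
        by (rule power2_le_imp_le) (use \<kappa> l2_int_norm_nonneg in simp)
    qed
  qed
  moreover have "R (?A x) = x \<and> ?A (R x) = x" if x: "x \<in> l2_int" for x
  proof
    have s: "sq_summable (\<lambda>n. Re (x n))" "sq_summable (\<lambda>n. Im (x n))" using x unfolding l2_int_iff by auto
    have "S (T (\<lambda>n. Re (x n))) = (\<lambda>n. Re (x n))" "S (T (\<lambda>n. Im (x n))) = (\<lambda>n. Im (x n))"
      using S_eqI s by blast+
    then show "R (?A x) = x" unfolding R_def Re_A Im_A by simp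
    have "(\<lambda>n. Re (?A (R x) n)) = (\<lambda>n. Re (x n))" "(\<lambda>n. Im (?A (R x) n)) = (\<lambda>n. Im (x n))"
      unfolding Re_A Im_A Re_R Im_R using S(2) s by auto
    then show "?A (R x) = x" by (simp add: fun_eq_iff complex_eq_iff)
  qed
  ultimately have "complex_of_real E \<notin> spectrum_l2 ?H" unfolding spectrum_l2_def by blast
  then show ?thesis unfolding amo_spectrum_def by simp
qed

lemma gap_not_in_spectrum:
  assumes "counts_like \<omega> S d" "open S" "E \<in> S"
  shows "E \<notin> amo_spectrum 2 \<omega> \<theta>"
proof -
  obtain \<kappa> where "bounded_below \<omega> \<theta> E \<kappa>" using gap_lower_bound[OF assms] by blast
  then have \<kappa>: "0 < \<kappa>" "\<And>l x. (\<And>n. int l < \<bar>n\<bar> \<Longrightarrow> x n = 0) \<Longrightarrow>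
     \<kappa>\<^sup>2 * (\<Sum>n\<in>{- int l..int l}. (x n)\<^sup>2) \<le> (\<Sum>n\<in>{- int (Suc l)..int (Suc l)}. (amo_shifted \<omega> \<theta> E x n)\<^sup>2)"
    unfolding bounded_below_def by blast+
  interpret bounded_jacobi "\<lambda>n. amo_potential 2 \<omega> \<theta> n - E" "2 + \<bar>E\<bar>"
  proof
    fix n
    have "\<bar>2 * cos (2 * pi * (\<omega> * of_int n + \<theta>))\<bar> \<le> 2" unfolding abs_mult by simp
    then show "\<bar>amo_potential 2 \<omega> \<theta> n - E\<bar> \<le> 2 + \<bar>E\<bar>" unfolding amo_potential_def by linarith
  qed
  have T: "T = amo_shifted \<omega> \<theta> E" unfolding T_def amo_shifted_def fun_eq_iff by simp
  have "bounded_below_jacobi (\<lambda>n. amo_potential 2 \<omega> \<theta> n - E) (2 + \<bar>E\<bar>) \<kappa>"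
    by unfold_locales (use \<kappa>(1) T_lower_bound_extends[OF _ \<kappa>(1)] \<kappa>(2) in \<open>auto simp: T\<close>)
  then show ?thesis by (rule resolvent_of_lower_bound)
qed

lemma finite_support_l2:
  fixes z :: "int \<Rightarrow> real"
  assumes "\<And>n. n \<notin> {- int l..int l} \<Longrightarrow> z n = 0"
  shows "(\<lambda>n. complex_of_real (z n)) \<in> l2_int"
    "l2_int_norm (\<lambda>n. complex_of_real (z n)) = sqrt (\<Sum>n\<in>{- int l..int l}. (z n)\<^sup>2)"
proof -
  have h: "((\<lambda>n. (cmod (complex_of_real (z n)))\<^sup>2) has_sum (\<Sum>n\<in>{- int l..int l}. (z n)\<^sup>2)) UNIV"
  proof -
    have "((\<lambda>n. (z n)\<^sup>2) has_sum (\<Sum>n\<in>{- int l..int l}. (z n)\<^sup>2)) {- int l..int l}"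
      by (rule has_sum_finite) simp
    then have "((\<lambda>n. (z n)\<^sup>2) has_sum (\<Sum>n\<in>{- int l..int l}. (z n)\<^sup>2)) UNIV"
      by (rule has_sum_cong_neutral[THEN iffD1, rotated -1]) (use assms in auto)
    then show ?thesis by simp
  qed
  show "(\<lambda>n. complex_of_real (z n)) \<in> l2_int" unfolding l2_int_def using h by (auto simp: summable_on_def)
  show "l2_int_norm (\<lambda>n. complex_of_real (z n)) = sqrt (\<Sum>n\<in>{- int l..int l}. (z n)\<^sup>2)"
    unfolding l2_int_norm_def using infsumI[OF h] by simp
qed

lemma lower_bound_of_resolvent:
  assumes "E \<notin> amo_spectrum 2 \<omega> \<theta>"
  shows "\<exists>\<kappa>. bounded_below \<omega> \<theta> E \<kappa>"
proof -
  let ?A = "\<lambda>x n. almost_mathieu 2 \<omega> \<theta> x n - complex_of_real E * x n"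
  obtain R where R: "bounded_operator_l2 R" "\<And>x. x \<in> l2_int \<Longrightarrow> R (?A x) = x"
    using assms unfolding amo_spectrum_def spectrum_l2_def by blast
  obtain C where C: "\<And>x. x \<in> l2_int \<Longrightarrow> l2_int_norm (R x) \<le> C * l2_int_norm x"
    using R(1) unfolding bounded_operator_l2_def by blast
  define K where "K = max C 1"
  have K: "0 < K" "C \<le> K" unfolding K_def by auto
  have "(1 / K)\<^sup>2 * (\<Sum>n\<in>{- int l..int l}. (x n)\<^sup>2) \<le> (\<Sum>n\<in>{- int (Suc l)..int (Suc l)}. (amo_shifted \<omega> \<theta> E x n)\<^sup>2)"
    if x0: "\<And>n. int l < \<bar>n\<bar> \<Longrightarrow> x n = 0" for l and x :: "int \<Rightarrow> real"
  proof -
    let ?y = "amo_shifted \<omega> \<theta> E x"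
    have A: "?A (\<lambda>n. complex_of_real (x n)) = (\<lambda>n. complex_of_real (?y n))"
      unfolding almost_mathieu_def amo_shifted_def fun_eq_iff by (simp add: algebra_simps)
    have y0: "?y n = 0" if "n \<notin> {- int (Suc l)..int (Suc l)}" for n
      unfolding amo_shifted_def using that x0[of n] x0[of "n+1"] x0[of "n-1"] by auto
    note fx = finite_support_l2[of l x] and fy = finite_support_l2[of "Suc l" ?y, OF y0]
    have xl: "(\<lambda>n. complex_of_real (x n)) \<in> l2_int" by (rule fx(1)) (use x0 in auto)
    have "l2_int_norm (\<lambda>n. complex_of_real (x n)) \<le> C * l2_int_norm (\<lambda>n. complex_of_real (?y n))"
      using C[OF fy(1)] R(2)[OF xl] unfolding A by simp
    also have "\<dots> \<le> K * l2_int_norm (\<lambda>n. complex_of_real (?y n))"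
      using K l2_int_norm_nonneg by (intro mult_right_mono) auto
    finally have le: "(l2_int_norm (\<lambda>n. complex_of_real (x n)))\<^sup>2 \<le> (K * l2_int_norm (\<lambda>n. complex_of_real (?y n)))\<^sup>2"
      using l2_int_norm_nonneg by (intro power_mono) auto
    have "(l2_int_norm (\<lambda>n. complex_of_real (x n)))\<^sup>2 = (\<Sum>n\<in>{- int l..int l}. (x n)\<^sup>2)"
    proof -
      have "l2_int_norm (\<lambda>n. complex_of_real (x n)) = sqrt (\<Sum>n\<in>{- int l..int l}. (x n)\<^sup>2)"
        by (rule fx(2)) (use x0 in auto)
      then show ?thesis by (simp add: sum_nonneg)
    qed
    moreover have "(l2_int_norm (\<lambda>n. complex_of_real (?y n)))\<^sup>2 = (\<Sum>n\<in>{- int (Suc l)..int (Suc l)}. (?y n)\<^sup>2)"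
    proof -
      have "l2_int_norm (\<lambda>n. complex_of_real (?y n)) = sqrt (\<Sum>n\<in>{- int (Suc l)..int (Suc l)}. (?y n)\<^sup>2)"
        by (rule fy(2))
      then show ?thesis by (simp add: sum_nonneg del: of_nat_Suc)
    qed
    ultimately have "(\<Sum>n\<in>{- int l..int l}. (x n)\<^sup>2) \<le> K\<^sup>2 * (\<Sum>n\<in>{- int (Suc l)..int (Suc l)}. (?y n)\<^sup>2)"
      using le unfolding power_mult_distrib by simp
    then show ?thesis using K by (simp add: power_divide pos_divide_le_eq mult.commute)
  qed
  then have "bounded_below \<omega> \<theta> E (1 / K)" using K unfolding bounded_below_def by simp
  then show ?thesis ..
qed

text \<open>
  Three eigenvectors with eigenvalues near \<open>E0\<close> have a combination that vanishes at both ends of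
  the box.  Extended by zero, it is an approximate eigenvector of the whole operator.
\<close>

lemma few_roots_off_spectrum:
  assumes "E0 \<notin> amo_spectrum 2 \<omega> \<theta>"
  obtains \<delta> where "0 < \<delta>" "\<And>L. card {y \<in> jroots (cos_potential \<omega> \<theta>) L. \<bar>y - E0\<bar> < \<delta>} \<le> 2"
proof -
  obtain \<kappa> where "bounded_below \<omega> \<theta> E0 \<kappa>" using lower_bound_of_resolvent[OF assms] by blast
  then have \<kappa>: "0 < \<kappa>" and low: "\<And>l x. (\<And>n. int l < \<bar>n\<bar> \<Longrightarrow> x n = 0) \<Longrightarrow>
     \<kappa>\<^sup>2 * (\<Sum>n\<in>{- int l..int l}. (x n)\<^sup>2) \<le> (\<Sum>n\<in>{- int (Suc l)..int (Suc l)}. (amo_shifted \<omega> \<theta> E0 x n)\<^sup>2)"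
    unfolding bounded_below_def by blast+
  have "card {y \<in> jroots (cos_potential \<omega> \<theta>) L. \<bar>y - E0\<bar> < \<kappa>} \<le> 2" for L
  proof (rule ccontr)
    let ?V = "cos_potential \<omega> \<theta>"
    let ?B = "{y \<in> jroots ?V L. \<bar>y - E0\<bar> < \<kappa>}"
    assume "\<not> ?thesis"
    then have "3 \<le> card ?B" by simp
    then obtain B where B: "B \<subseteq> ?B" "card B = 3" "finite B" by (rule obtain_subset_with_card_n) auto
    obtain \<beta> where \<beta>: "bij_betw \<beta> {..<3::nat} B"
      using ex_bij_betw_nat_finite[OF B(3)] B(2) by (metis atLeast0LessThan)
    have \<beta>B: "\<beta> t \<in> jroots ?V L" "\<bar>\<beta> t - E0\<bar> < \<kappa>" if "t < 3" for t
      using \<beta> B(1) that by (auto simp: bij_betw_def)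
    have \<beta>inj: "\<beta> t \<noteq> \<beta> t'" if "t < 3" "t' < 3" "t \<noteq> t'" for t t'
      using \<beta> that by (auto simp: bij_betw_def inj_on_def)
    define f where "f t i = poly (jac ?V i) (\<beta> t)" for t i
    have L: "3 \<le> L" using card_mono[of "jroots ?V L" B] B card_jroots[of ?V L] by auto
    obtain c where c: "\<exists>t<3. c t \<noteq> 0" "\<And>k::nat. k < 2 \<Longrightarrow> (\<Sum>t<3. (if k = 0 then f t 0 else f t (L - 1)) * c t) = 0"
      by (rule underdetermined[of 2 3 "\<lambda>k t. if k = 0 then f t 0 else f t (L - 1)"]) (simp, rule that)
    have c0: "(\<Sum>t<3. c t * f t 0) = 0" "(\<Sum>t<3. c t * f t (L - 1)) = 0"
      using c(2)[of 0] c(2)[of 1] by (simp_all add: mult.commute)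
    define Y where "Y i = (\<Sum>t<3. c t * f t i)" for i
    define y where "y n = (if 1 \<le> n \<and> n \<le> int L then Y (nat n - 1) else 0)" for n :: int
    define Z where "Z i = (\<Sum>t<3. (c t * (\<beta> t - E0)) * f t i)" for i
    have Z: "Z i = jop ?V L Y i - E0 * Y i" if "i < L" for i
    proof -
      have "jop ?V L Y i = (\<Sum>t<3. c t * jop ?V L (f t) i)"
        unfolding jop_def Y_def
        by (simp add: sum_distrib_left distrib_left sum.distrib mult_ac)
      also have "\<dots> = (\<Sum>t<3. c t * (\<beta> t * f t i))"
        unfolding f_def[abs_def] by (intro sum.cong refl) (simp add: jop_eigen[OF \<beta>B(1) that])
      finally show ?thesis unfolding Z_def Y_def
        by (simp add: algebra_simps sum_subtractf sum_distrib_left)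
    qed
    have Y0: "Y 0 = 0" "Y (L - 1) = 0" unfolding Y_def using c0 by auto
    have Tin: "amo_shifted \<omega> \<theta> E0 y (int i + 1) = Z i" if i: "i < L" for i
    proof -
      have "y (int i + 1 + 1) = (if Suc i < L then Y (Suc i) else 0)" unfolding y_def by (auto simp: nat_add_distrib)
      moreover have "y (int i + 1 - 1) = (if i = 0 then 0 else Y (i - 1))" using i unfolding y_def by auto
      moreover have "y (int i + 1) = Y i" using i unfolding y_def by (simp add: nat_add_distrib)
      moreover have "amo_potential 2 \<omega> \<theta> (int i + 1) = ?V i"
        unfolding amo_potential_def cos_potential_def by (simp add: algebra_simps)
      ultimately show ?thesis unfolding Z[OF i] amo_shifted_def jop_def by (simp add: algebra_simps)
    qed
    have Tout: "amo_shifted \<omega> \<theta> E0 y n = 0" if n: "n \<notin> {1..int L}" for n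
    proof -
      have "y n = 0" using n unfolding y_def by auto
      moreover have "y (n + 1) = 0"
        using n Y0 L unfolding y_def by (cases "n = 0") auto
      moreover have "y (n - 1) = 0"
      proof (cases "n = int L + 1")
        case True
        then have "nat (n - 1) - 1 = L - 1" by simp
        then show ?thesis using Y0 unfolding y_def by simp
      qed (use n in \<open>auto simp: y_def\<close>)
      ultimately show ?thesis unfolding amo_shifted_def by simp
    qed
    have window: "(\<Sum>n\<in>{- int l..int l}. (F n)\<^sup>2) = (\<Sum>i<L. (F (int i + 1))\<^sup>2)"
      if "\<And>n. n \<notin> {1..int L} \<Longrightarrow> F n = 0" "L \<le> l" for F :: "int \<Rightarrow> real" and l
    proof -
      have "(\<Sum>n\<in>{- int l..int l}. (F n)\<^sup>2) = (\<Sum>n\<in>{1..int L}. (F n)\<^sup>2)"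
        using that by (intro sum.mono_neutral_right) auto
      also have "\<dots> = (\<Sum>i<L. (F (int i + 1))\<^sup>2)"
        by (rule sum.reindex_bij_witness[of _ "\<lambda>i. int i + 1" "\<lambda>n. nat (n - 1)"]) auto
      finally show ?thesis .
    qed
    have y_out: "y n = 0" if "n \<notin> {1..int L}" for n using that unfolding y_def by auto
    have y_in: "y (int i + 1) = Y i" if "i < L" for i using that unfolding y_def by (simp add: nat_add_distrib)
    have "\<kappa>\<^sup>2 * (\<Sum>n\<in>{- int L..int L}. (y n)\<^sup>2) \<le> (\<Sum>n\<in>{- int (Suc L)..int (Suc L)}. (amo_shifted \<omega> \<theta> E0 y n)\<^sup>2)"
      by (rule low) (auto simp: y_def)
    also have "(\<Sum>n\<in>{- int (Suc L)..int (Suc L)}. (amo_shifted \<omega> \<theta> E0 y n)\<^sup>2) = (\<Sum>i<L. (Z i)\<^sup>2)"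
      using window[of "amo_shifted \<omega> \<theta> E0 y" "Suc L"] Tout Tin by simp
    also have "(\<Sum>n\<in>{- int L..int L}. (y n)\<^sup>2) = (\<Sum>i<L. (Y i)\<^sup>2)"
      using window[of y L, OF y_out order_refl] y_in by simp
    finally have "\<kappa>\<^sup>2 * (\<Sum>i<L. (Y i)\<^sup>2) \<le> (\<Sum>i<L. (Z i)\<^sup>2)" .
    moreover have orth: "(\<Sum>i<L. f t i * f t' i) = 0" if "t < 3" "t' < 3" "t \<noteq> t'" for t t'
      unfolding f_def using jac_orthogonal \<beta>B(1) \<beta>inj that by blast
    moreover have "(\<Sum>i<L. (Y i)\<^sup>2) = (\<Sum>t<3. (c t)\<^sup>2 * (\<Sum>i<L. (f t i)\<^sup>2))"
      unfolding Y_def by (rule sum_square_orthogonal) (rule orth)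
    moreover have "(\<Sum>i<L. (Z i)\<^sup>2) = (\<Sum>t<3. (c t * (\<beta> t - E0))\<^sup>2 * (\<Sum>i<L. (f t i)\<^sup>2))"
      unfolding Z_def by (rule sum_square_orthogonal) (rule orth)
    moreover have "(\<Sum>t<3. (c t * (\<beta> t - E0))\<^sup>2 * (\<Sum>i<L. (f t i)\<^sup>2)) < (\<Sum>t<3. \<kappa>\<^sup>2 * ((c t)\<^sup>2 * (\<Sum>i<L. (f t i)\<^sup>2)))"
    proof (rule sum_strict_mono_ex1)
      have lt: "(\<beta> t - E0)\<^sup>2 < \<kappa>\<^sup>2" if "t < 3" for t
        using \<beta>B(2)[OF that] \<kappa> by (metis abs_of_pos abs_less_iff power2_abs power_strict_mono abs_ge_zero zero_less_numeral)
      have norm: "0 < (\<Sum>i<L. (f t i)\<^sup>2)" if "t < 3" for t unfolding f_def by (rule jac_norm_pos[OF \<beta>B(1)[OF that]])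
      have eq: "(c t * (\<beta> t - E0))\<^sup>2 * (\<Sum>i<L. (f t i)\<^sup>2) = (\<beta> t - E0)\<^sup>2 * ((c t)\<^sup>2 * (\<Sum>i<L. (f t i)\<^sup>2))" for t
        by (simp add: power_mult_distrib)
      show "\<forall>t\<in>{..<3}. (c t * (\<beta> t - E0))\<^sup>2 * (\<Sum>i<L. (f t i)\<^sup>2) \<le> \<kappa>\<^sup>2 * ((c t)\<^sup>2 * (\<Sum>i<L. (f t i)\<^sup>2))"
      proof
        fix t :: nat assume "t \<in> {..<3}"
        then have "(\<beta> t - E0)\<^sup>2 \<le> \<kappa>\<^sup>2" "0 < (\<Sum>i<L. (f t i)\<^sup>2)" using lt[of t] norm[of t] by auto
        then show "(c t * (\<beta> t - E0))\<^sup>2 * (\<Sum>i<L. (f t i)\<^sup>2) \<le> \<kappa>\<^sup>2 * ((c t)\<^sup>2 * (\<Sum>i<L. (f t i)\<^sup>2))"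
          unfolding eq by (intro mult_right_mono) auto
      qed
      obtain t where t: "t < 3" "c t \<noteq> 0" using c(1) by blast
      then have "(\<beta> t - E0)\<^sup>2 * ((c t)\<^sup>2 * (\<Sum>i<L. (f t i)\<^sup>2)) < \<kappa>\<^sup>2 * ((c t)\<^sup>2 * (\<Sum>i<L. (f t i)\<^sup>2))"
        using lt[of t] norm[of t] by (intro mult_strict_right_mono) auto
      then show "\<exists>t\<in>{..<3}. (c t * (\<beta> t - E0))\<^sup>2 * (\<Sum>i<L. (f t i)\<^sup>2) < \<kappa>\<^sup>2 * ((c t)\<^sup>2 * (\<Sum>i<L. (f t i)\<^sup>2))"
        unfolding eq using t(1) by blast
    qed simp
    ultimately show False by (simp only: sum_distrib_left[symmetric])
  qed
  then show thesis using that[of \<kappa>] \<kappa> by blast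
qed

section \<open>The integrated density of states on the gaps\<close>

definition has_ids :: "real \<Rightarrow> real \<Rightarrow> real \<Rightarrow> real \<Rightarrow> bool" where
  "has_ids \<omega> \<theta> v E \<longleftrightarrow> (\<lambda>L. real (card {y \<in> jroots (cos_potential \<omega> \<theta>) L. y \<le> E}) / real L) \<longlonglongrightarrow> v"

lemma amo_ids_eq: "has_ids \<omega> \<theta> v E \<Longrightarrow> amo_ids 2 \<omega> \<theta> E = v"
proof -
  assume v: "has_ids \<omega> \<theta> v E"
  have "amo_restriction 2 \<omega> \<theta> L = tridiag (cos_potential \<omega> \<theta>) L" for L
    unfolding amo_restriction_def tridiag_def amo_potential_def cos_potential_def
    by (rule cong_mat) (auto simp: algebra_simps)
  then show ?thesis
    using v unfolding amo_ids_def has_ids_def by (simp add: eigenvalue_count_tridiag limI)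
qed

lemma counts_like_has_ids:
  assumes "counts_like \<omega> S d" "E \<in> S"
  shows "has_ids \<omega> \<theta> d E"
proof -
  obtain K where K: "\<And>L. d * real L - K \<le> real (card {y \<in> jroots (cos_potential \<omega> \<theta>) L. y < E})"
     "\<And>L. real (card {y \<in> jroots (cos_potential \<omega> \<theta>) L. y \<le> E}) \<le> d * real L + K"
    using assms unfolding counts_like_def by blast
  let ?N = "\<lambda>L. real (card {y \<in> jroots (cos_potential \<omega> \<theta>) L. y \<le> E})"
  have lo: "d * real L - K \<le> ?N L" for L
  proof -
    have "card {y \<in> jroots (cos_potential \<omega> \<theta>) L. y < E} \<le> card {y \<in> jroots (cos_potential \<omega> \<theta>) L. y \<le> E}"
      by (rule card_mono) auto
    then show ?thesis using K(1)[of L] by linarith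
  qed
  have lower: "\<forall>\<^sub>F L in sequentially. d - K * (1 / real L) \<le> ?N L / real L"
  proof (rule eventually_sequentiallyI[of 1])
    fix L :: nat assume "1 \<le> L"
    then have "d - K * (1 / real L) = (d * real L - K) / real L" by (simp add: diff_divide_distrib)
    also have "\<dots> \<le> ?N L / real L" by (rule divide_right_mono[OF lo]) simp
    finally show "d - K * (1 / real L) \<le> ?N L / real L" .
  qed
  have upper: "\<forall>\<^sub>F L in sequentially. ?N L / real L \<le> d + K * (1 / real L)"
  proof (rule eventually_sequentiallyI[of 1])
    fix L :: nat assume L: "1 \<le> L"
    have "?N L / real L \<le> (d * real L + K) / real L" by (rule divide_right_mono[OF K(2)]) simp
    also have "\<dots> = d + K * (1 / real L)" using L by (simp add: add_divide_distrib)
    finally show "?N L / real L \<le> d + K * (1 / real L)" .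
  qed
  have limits: "(\<lambda>L. d - K * (1 / real L)) \<longlonglongrightarrow> d" "(\<lambda>L. d + K * (1 / real L)) \<longlonglongrightarrow> d"
    using tendsto_diff[OF tendsto_const tendsto_mult[OF tendsto_const lim_1_over_n], of d K]
      tendsto_add[OF tendsto_const tendsto_mult[OF tendsto_const lim_1_over_n], of d K] by simp_all
  show ?thesis unfolding has_ids_def by (rule tendsto_sandwich[OF lower upper limits])
qed

text \<open>
  By \<open>few_roots_off_spectrum\<close> the counts at nearby energies off the spectrum differ by at most 2,
  which disappears in the limit.
\<close>

lemma has_ids_locally_constant:
  assumes "E0 \<notin> amo_spectrum 2 \<omega> \<theta>"
  shows "\<exists>\<delta>>0. \<forall>E E'. \<bar>E - E0\<bar> < \<delta> \<longrightarrow> \<bar>E' - E0\<bar> < \<delta> \<longrightarrow> has_ids \<omega> \<theta> v E \<longrightarrow> has_ids \<omega> \<theta> v E'"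
proof -
  obtain \<delta> where \<delta>: "0 < \<delta>" "\<And>L. card {y \<in> jroots (cos_potential \<omega> \<theta>) L. \<bar>y - E0\<bar> < \<delta>} \<le> 2"
    by (rule few_roots_off_spectrum[OF assms]) (rule that)
  let ?N = "\<lambda>E L. card {y \<in> jroots (cos_potential \<omega> \<theta>) L. y \<le> E}"
  have le: "?N E' L \<le> ?N E L + 2" if "\<bar>E - E0\<bar> < \<delta>" "\<bar>E' - E0\<bar> < \<delta>" for E E' L
  proof -
    have "{y \<in> jroots (cos_potential \<omega> \<theta>) L. y \<le> E'} \<subseteq>
      {y \<in> jroots (cos_potential \<omega> \<theta>) L. y \<le> E} \<union> {y \<in> jroots (cos_potential \<omega> \<theta>) L. \<bar>y - E0\<bar> < \<delta>}"
      using that by auto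
    then have "?N E' L \<le> card ({y \<in> jroots (cos_potential \<omega> \<theta>) L. y \<le> E} \<union> {y \<in> jroots (cos_potential \<omega> \<theta>) L. \<bar>y - E0\<bar> < \<delta>})"
      by (rule card_mono[rotated]) auto
    also have "\<dots> \<le> ?N E L + card {y \<in> jroots (cos_potential \<omega> \<theta>) L. \<bar>y - E0\<bar> < \<delta>}" by (rule card_Un_le)
    finally show ?thesis using \<delta>(2)[of L] by linarith
  qed
  have "has_ids \<omega> \<theta> v E'" if E: "\<bar>E - E0\<bar> < \<delta>" "\<bar>E' - E0\<bar> < \<delta>" and v: "has_ids \<omega> \<theta> v E" for E E'
  proof -
    have close: "norm (real (?N E' L) / real L - real (?N E L) / real L) \<le> 2 * (1 / real L)" for L
    proof -
      have "\<bar>real (?N E' L) - real (?N E L)\<bar> \<le> 2" using le[OF E, of L] le[OF E(2,1), of L] by linarith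
      then have "\<bar>real (?N E' L) - real (?N E L)\<bar> / real L \<le> 2 / real L" by (rule divide_right_mono) simp
      then show ?thesis by (simp add: diff_divide_distrib[symmetric])
    qed
    have "(\<lambda>L. 2 * (1 / real L)) \<longlonglongrightarrow> 0"
      using tendsto_mult[OF tendsto_const lim_1_over_n, of 2] by simp
    then have "(\<lambda>L. real (?N E' L) / real L - real (?N E L) / real L) \<longlonglongrightarrow> 0"
      by (rule Lim_null_comparison[OF always_eventually[OF allI[OF close]]])
    from tendsto_add[OF this v[unfolded has_ids_def]] show ?thesis unfolding has_ids_def by simp
  qed
  then show ?thesis using \<delta>(1) by blast
qed

lemma has_ids_connected:
  assumes "connected G" "G \<inter> amo_spectrum 2 \<omega> \<theta> = {}" "E1 \<in> G" "has_ids \<omega> \<theta> v E1" "E \<in> G"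
  shows "has_ids \<omega> \<theta> v E"
proof (rule connected_induction_simple[OF assms(1,3,5), of "has_ids \<omega> \<theta> v", OF assms(4)])
  fix E0 assume E0: "E0 \<in> G"
  then have "E0 \<notin> amo_spectrum 2 \<omega> \<theta>" using assms(2) by blast
  then obtain \<delta> where \<delta>: "0 < \<delta>" "\<And>E E'. \<bar>E - E0\<bar> < \<delta> \<Longrightarrow> \<bar>E' - E0\<bar> < \<delta> \<Longrightarrow> has_ids \<omega> \<theta> v E \<Longrightarrow> has_ids \<omega> \<theta> v E'"
    using has_ids_locally_constant[of E0 \<omega> \<theta> v] by blast
  show "\<exists>T. openin (top_of_set G) T \<and> E0 \<in> T \<and> (\<forall>x\<in>T. \<forall>y\<in>T. has_ids \<omega> \<theta> v x \<longrightarrow> has_ids \<omega> \<theta> v y)"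
  proof (intro exI[of _ "G \<inter> ball E0 \<delta>"] conjI)
    show "openin (top_of_set G) (G \<inter> ball E0 \<delta>)" by (simp add: openin_open_Int)
    show "\<forall>x\<in>G \<inter> ball E0 \<delta>. \<forall>y\<in>G \<inter> ball E0 \<delta>. has_ids \<omega> \<theta> v x \<longrightarrow> has_ids \<omega> \<theta> v y"
      using \<delta>(2) by (auto simp: dist_real_def abs_minus_commute)
  qed (use E0 \<delta>(1) in auto)
qed

lemma gap_component:
  fixes \<omega> \<theta> d E :: real and S :: "real set"
  assumes "counts_like \<omega> S d" "open S" "connected S" "E \<in> S"
  defines "G \<equiv> connected_component_set (UNIV - amo_spectrum 2 \<omega> \<theta>) E"
  shows "G \<in> amo_gaps 2 \<omega> \<theta>" "S \<subseteq> G" "\<And>E'. E' \<in> G \<Longrightarrow> has_ids \<omega> \<theta> d E'"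
proof -
  have S: "S \<subseteq> UNIV - amo_spectrum 2 \<omega> \<theta>" using gap_not_in_spectrum[OF assms(1,2)] by auto
  then show "G \<in> amo_gaps 2 \<omega> \<theta>" unfolding G_def amo_gaps_def using assms(4) by (auto simp: components_iff)
  show SG: "S \<subseteq> G" unfolding G_def using connected_component_maximal[OF assms(4,3) S] .
  show "has_ids \<omega> \<theta> d E'" if "E' \<in> G" for E'
  proof (rule has_ids_connected[of G])
    show "connected G" unfolding G_def by (rule connected_connected_component)
    show "G \<inter> amo_spectrum 2 \<omega> \<theta> = {}" unfolding G_def using connected_component_subset by blast
    show "E \<in> G" using SG assms(4) by auto
    show "has_ids \<omega> \<theta> d E" by (rule counts_like_has_ids[OF assms(1,4)])
  qed (rule that)
qed

lemma has_ids_unique: "has_ids \<omega> \<theta> v E \<Longrightarrow> has_ids \<omega> \<theta> v' E \<Longrightarrow> v = v'"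
  unfolding has_ids_def by (rule LIMSEQ_unique)

section \<open>The gaps for the golden mean\<close>

definition golden :: real where "golden = (sqrt 5 - 1) / 2"

lemma golden_range: "0.61803398874985 \<le> golden" "golden \<le> 0.6180339887499"
  unfolding golden_def using golden_bounds by simp_all

lemma golden_counts:
  "counts_like golden {0.273318241882<..<1.789961146545} golden"
  "counts_like golden {-1.789961146545<..<-0.273318241882} (- golden + 1)"
  "counts_like golden {-2.30758848800<..<-2.00845718154} (2 * golden - 1)"
  "counts_like golden {2.00845718154<..<2.30758848800} (-2 * golden + 2)"
  "counts_like golden {2.37612614288<..<2.50857481536} (3 * golden - 1)"
  "counts_like golden {-2.50857481536<..<-2.37612614288} (-3 * golden + 2)"
  "counts_like golden {-0.1298164588928<..<-0.0196121757507} (4 * golden - 2)"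
  "counts_like golden {0.0196121757507<..<0.1298164588928} (-4 * golden + 3)"
  "counts_like golden {2.59851518536<..} 1"
  "counts_like golden {..<-2.59851518536} 0"
  using lower_edge_pos1 lower_edge_neg1 lower_edge_pos2 lower_edge_neg2 lower_edge_pos3 lower_edge_neg3 lower_edge_pos4 lower_edge_neg4 lower_edge_top
  by (auto intro!: counts_like_interval counts_like_above counts_like_below simp: golden_def[symmetric])

lemma has_ids_outside:
  "2.59851518536 < E \<Longrightarrow> has_ids golden \<theta> 1 E" "E < -2.59851518536 \<Longrightarrow> has_ids golden \<theta> 0 E"
  using counts_like_has_ids[OF golden_counts(9)] counts_like_has_ids[OF golden_counts(10)] by auto

text \<open>
  The gap is bounded since the integrated density of states is 0 or 1 far out.
\<close>

lemma golden_gap: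
  assumes cl: "counts_like golden {a<..<b} (of_int k * golden + of_int j)" and ab: "a < b"
    and d: "0 < of_int k * golden + of_int j" "of_int k * golden + of_int j < 1"
  shows "\<exists>G\<in>amo_gaps 2 golden \<theta>. bounded G \<and> has_gap_label 2 golden \<theta> G k \<and> {a<..<b} \<subseteq> G \<and>
    (\<exists>E\<in>G. has_ids golden \<theta> (frac (of_int k * golden)) E)"
proof -
  let ?d = "of_int k * golden + of_int j"
  have m: "(a + b) / 2 \<in> {a<..<b}" using ab by simp
  define G where "G = connected_component_set (UNIV - amo_spectrum 2 golden \<theta>) ((a + b) / 2)"
  have G: "G \<in> amo_gaps 2 golden \<theta>" "{a<..<b} \<subseteq> G" "\<And>E. E \<in> G \<Longrightarrow> has_ids golden \<theta> ?d E"
    unfolding G_def using gap_component[OF cl _ _ m] by auto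
  have fr: "frac (of_int k * golden) = ?d"
    using d by (intro frac_unique_iff[THEN iffD2]) auto
  have "\<bar>E\<bar> \<le> 2.59851518536" if "E \<in> G" for E
  proof (rule ccontr)
    assume "\<not> ?thesis"
    then consider "2.59851518536 < E" | "E < -2.59851518536" by linarith
    then show False
      using has_ids_outside[of E \<theta>] has_ids_unique[OF G(3)[OF that]] d by cases force+
  qed
  then have bG: "bounded G" unfolding bounded_iff by (intro exI[of _ "2.59851518536"]) auto
  have "has_gap_label 2 golden \<theta> G k"
    unfolding has_gap_label_def using bG G(3) amo_ids_eq fr by metis
  then show ?thesis using G bG m unfolding fr by blast
qed

theorem mainTheorem1:
  fixes \<omega> \<theta> :: real
  assumes "\<omega> = (sqrt 5 - 1) / 2"
  shows "(\<exists>G :: int \<Rightarrow> real set.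
      inj_on G {-4, -3, -2, -1, 1, 2, 3, 4} \<and>
      (\<forall>k \<in> {-4, -3, -2, -1, 1, 2, 3, 4}.
         G k \<in> amo_gaps 2 \<omega> \<theta> \<and> bounded (G k) \<and> has_gap_label 2 \<omega> \<theta> (G k) k) \<and>
      {-2.50857481536 <..< -2.37612614288} \<subseteq> G (-3) \<and>
      {-2.30758848800 <..< -2.00845718154} \<subseteq> G 2 \<and>
      {-1.789961146545 <..< -0.273318241882} \<subseteq> G (-1) \<and>
      {-0.1298164588928 <..< -0.0196121757507} \<subseteq> G 4 \<and>
      {0.0196121757507 <..< 0.1298164588928} \<subseteq> G (-4) \<and>
      {0.273318241882 <..< 1.789961146545} \<subseteq> G 1 \<and>
      {2.00845718154 <..< 2.30758848800} \<subseteq> G (-2) \<and>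
      {2.37612614288 <..< 2.50857481536} \<subseteq> G 3) \<and>
    (\<exists>G \<in> amo_gaps 2 \<omega> \<theta>. \<not> bdd_below G \<and> bdd_above G \<and>
           has_gap_label 2 \<omega> \<theta> G 0 \<and> {..< -2.59851518536} \<subseteq> G) \<and>
    (\<exists>G \<in> amo_gaps 2 \<omega> \<theta>. bdd_below G \<and> \<not> bdd_above G \<and>
           has_gap_label 2 \<omega> \<theta> G 0 \<and> {2.59851518536 <..} \<subseteq> G)"
proof -
  have w: "\<omega> = golden" using assms by (simp add: golden_def)
  let ?K = "{-4, -3, -2, -1, 1, 2, 3, 4} :: int set"
  define lo :: "int \<Rightarrow> real" where "lo k = (if k = -3 then -2.50857481536 else if k = 2 then -2.30758848800
    else if k = -1 then -1.789961146545 else if k = 4 then -0.1298164588928 else if k = -4 then 0.0196121757507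
    else if k = 1 then 0.273318241882 else if k = -2 then 2.00845718154 else 2.37612614288)" for k
  define hi :: "int \<Rightarrow> real" where "hi k = (if k = -3 then -2.37612614288 else if k = 2 then -2.00845718154
    else if k = -1 then -0.273318241882 else if k = 4 then -0.0196121757507 else if k = -4 then 0.1298164588928
    else if k = 1 then 1.789961146545 else if k = -2 then 2.30758848800 else 2.50857481536)" for k
  define j :: "int \<Rightarrow> int" where "j k = (if k = -3 then 2 else if k = 2 then -1
    else if k = -1 then 1 else if k = 4 then -2 else if k = -4 then 3
    else if k = 1 then 0 else if k = -2 then 2 else -1)" for k
  have gaps: "\<forall>k\<in>?K. \<exists>G. G \<in> amo_gaps 2 golden \<theta> \<and> bounded G \<and> has_gap_label 2 golden \<theta> G k \<and> {lo k<..<hi k} \<subseteq> G \<and>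
    (\<exists>E\<in>G. has_ids golden \<theta> (frac (of_int k * golden)) E)"
  proof
    fix k assume k: "k \<in> ?K"
    have cl: "counts_like golden {lo k<..<hi k} (of_int k * golden + of_int (j k))"
      using k golden_counts(1-8) by (auto simp: lo_def hi_def j_def)
    have ab: "lo k < hi k" using k by (auto simp: lo_def hi_def)
    have d: "0 < of_int k * golden + of_int (j k) \<and> of_int k * golden + of_int (j k) < 1"
      using k golden_range by (auto simp: j_def)
    show "\<exists>G. G \<in> amo_gaps 2 golden \<theta> \<and> bounded G \<and> has_gap_label 2 golden \<theta> G k \<and> {lo k<..<hi k} \<subseteq> G \<and>
      (\<exists>E\<in>G. has_ids golden \<theta> (frac (of_int k * golden)) E)"
      using golden_gap[OF cl ab conjunct1[OF d] conjunct2[OF d], of \<theta>] by blast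
  qed
  from bchoice[OF this] obtain G where G: "\<forall>k\<in>?K. G k \<in> amo_gaps 2 golden \<theta> \<and> bounded (G k) \<and>
    has_gap_label 2 golden \<theta> (G k) k \<and> {lo k<..<hi k} \<subseteq> G k \<and> (\<exists>E\<in>G k. has_ids golden \<theta> (frac (of_int k * golden)) E)"
    by blast
  have inj: "inj_on G ?K"
  proof (rule inj_onI)
    fix k l assume k: "k \<in> ?K" and l: "l \<in> ?K" and eq: "G k = G l"
    obtain E where E: "E \<in> G k" "has_ids golden \<theta> (frac (of_int k * golden)) E" using G k by blast
    have "bounded (G k)" "has_gap_label 2 golden \<theta> (G k) l" using G k l eq by auto
    then have "amo_ids 2 golden \<theta> E = frac (of_int l * golden)"
      using E(1) unfolding has_gap_label_def by (auto dest: bounded_imp_bdd_below bounded_imp_bdd_above)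
    then have "frac (of_int k * golden) = frac (of_int l * golden)" using amo_ids_eq[OF E(2)] by simp
    moreover have "frac (of_int i * golden) = of_int i * golden + of_int (j i)" if "i \<in> ?K" for i
      using that golden_range by (intro frac_unique_iff[THEN iffD2]) (auto simp: j_def)
    ultimately have "of_int k * golden + of_int (j k) = of_int l * golden + of_int (j l)" using k l by simp
    then show "k = l" using k l golden_range by (auto simp: j_def)
  qed
  have main: "\<exists>G :: int \<Rightarrow> real set. inj_on G ?K \<and>
      (\<forall>k \<in> ?K. G k \<in> amo_gaps 2 \<omega> \<theta> \<and> bounded (G k) \<and> has_gap_label 2 \<omega> \<theta> (G k) k) \<and>
      {-2.50857481536 <..< -2.37612614288} \<subseteq> G (-3) \<and>
      {-2.30758848800 <..< -2.00845718154} \<subseteq> G 2 \<and>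
      {-1.789961146545 <..< -0.273318241882} \<subseteq> G (-1) \<and>
      {-0.1298164588928 <..< -0.0196121757507} \<subseteq> G 4 \<and>
      {0.0196121757507 <..< 0.1298164588928} \<subseteq> G (-4) \<and>
      {0.273318241882 <..< 1.789961146545} \<subseteq> G 1 \<and>
      {2.00845718154 <..< 2.30758848800} \<subseteq> G (-2) \<and>
      {2.37612614288 <..< 2.50857481536} \<subseteq> G 3"
  proof (intro exI[of _ G] conjI)
    show "inj_on G ?K" by (rule inj)
    show "\<forall>k \<in> ?K. G k \<in> amo_gaps 2 \<omega> \<theta> \<and> bounded (G k) \<and> has_gap_label 2 \<omega> \<theta> (G k) k"
      using G unfolding w by blast
    have sub: "{lo k<..<hi k} \<subseteq> G k" if "k \<in> ?K" for k using G that by blast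
    show "{-2.50857481536 <..< -2.37612614288} \<subseteq> G (-3)" using sub[of "-3"] by (simp add: lo_def hi_def)
    show "{-2.30758848800 <..< -2.00845718154} \<subseteq> G 2" using sub[of 2] by (simp add: lo_def hi_def)
    show "{-1.789961146545 <..< -0.273318241882} \<subseteq> G (-1)" using sub[of "-1"] by (simp add: lo_def hi_def)
    show "{-0.1298164588928 <..< -0.0196121757507} \<subseteq> G 4" using sub[of 4] by (simp add: lo_def hi_def)
    show "{0.0196121757507 <..< 0.1298164588928} \<subseteq> G (-4)" using sub[of "-4"] by (simp add: lo_def hi_def)
    show "{0.273318241882 <..< 1.789961146545} \<subseteq> G 1" using sub[of 1] by (simp add: lo_def hi_def)
    show "{2.00845718154 <..< 2.30758848800} \<subseteq> G (-2)" using sub[of "-2"] by (simp add: lo_def hi_def)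
    show "{2.37612614288 <..< 2.50857481536} \<subseteq> G 3" using sub[of 3] by (simp add: lo_def hi_def)
  qed
  have below: "\<exists>G \<in> amo_gaps 2 golden \<theta>. \<not> bdd_below G \<and> bdd_above G \<and>
           has_gap_label 2 golden \<theta> G 0 \<and> {..< -2.59851518536} \<subseteq> G"
  proof -
    define G where "G = connected_component_set (UNIV - amo_spectrum 2 golden \<theta>) (-3)"
    have G: "G \<in> amo_gaps 2 golden \<theta>" "{..< -2.59851518536} \<subseteq> G" "\<And>E. E \<in> G \<Longrightarrow> has_ids golden \<theta> 0 E"
      unfolding G_def using gap_component[OF golden_counts(10), of "-3"] by auto
    have nb: "\<not> bdd_below G"
    proof
      assume "bdd_below G"
      then obtain m where m: "\<And>x. x \<in> G \<Longrightarrow> m \<le> x" unfolding bdd_below_def by blast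
      have "min m (-3) - 1 \<in> G" using G(2) by auto
      then show False using m by fastforce
    qed
    have "E \<le> 2.59851518536" if "E \<in> G" for E
      using has_ids_outside(1)[of E \<theta>] has_ids_unique[OF G(3)[OF that], of 1] by force
    then have "bdd_above G" by (rule bdd_aboveI)
    moreover have "has_gap_label 2 golden \<theta> G 0"
      unfolding has_gap_label_def using nb by (simp add: amo_ids_eq[OF G(3)])
    ultimately show ?thesis using G(1,2) nb by (intro bexI[of _ G] conjI)
  qed
  have above: "\<exists>G \<in> amo_gaps 2 golden \<theta>. bdd_below G \<and> \<not> bdd_above G \<and>
           has_gap_label 2 golden \<theta> G 0 \<and> {2.59851518536 <..} \<subseteq> G"
  proof -
    define G where "G = connected_component_set (UNIV - amo_spectrum 2 golden \<theta>) 3"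
    have G: "G \<in> amo_gaps 2 golden \<theta>" "{2.59851518536 <..} \<subseteq> G" "\<And>E. E \<in> G \<Longrightarrow> has_ids golden \<theta> 1 E"
      unfolding G_def using gap_component[OF golden_counts(9), of 3] by auto
    have nb: "\<not> bdd_above G"
    proof
      assume "bdd_above G"
      then obtain m where m: "\<And>x. x \<in> G \<Longrightarrow> x \<le> m" unfolding bdd_above_def by blast
      have "max m 3 + 1 \<in> G" using G(2) by auto
      then show False using m by fastforce
    qed
    have "-2.59851518536 \<le> E" if "E \<in> G" for E
      using has_ids_outside(2)[of E \<theta>] has_ids_unique[OF G(3)[OF that], of 0] by force
    then have "bdd_below G" by (rule bdd_belowI)
    moreover have "has_gap_label 2 golden \<theta> G 0"
      unfolding has_gap_label_def using nb by (simp add: amo_ids_eq[OF G(3)])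
    ultimately show ?thesis using G(1,2) nb by (intro bexI[of _ G] conjI)
  qed
  show ?thesis using main below above unfolding w by blast
qed

end
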